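(* Assume that the $(d-1)$-dimensional measure of $\partial\Omega_1$ is positive. Let $0<\lambda_1\le\lambda_2\le\dots\le\lambda_N$ be the eigenvalues (counted with multiplicity) of $\widetilde{\mathsf A}^{-1}\mathsf A$, where $\mathsf A,\widetilde{\mathsf A}\in\mathbb R^{N\times N}$ are the finite element stiffness matrices of the original and of the preconditioning diffusion operator defined in the context. Let $\lambda^{\rm L}_k,\lambda^{\rm U}_k$, $k=1,\dots,N$, be the patch-wise bounds defined in the context, and let $r,s:\{1,\dots,N\}\to\{1,\dots,N\}$ be bijections such that $$\lambda^{\rm L}_{r(1)}\le\lambda^{\rm L}_{r(2)}\le\dots\le\lambda^{\rm L}_{r(N)},\qquad \lambda^{\rm U}_{s(1)}\le\lambda^{\rm U}_{s(2)}\le\dots\le\lambda^{\rm U}_{s(N)}.$$ Then $$\lambda^{\rm L}_{r(k)}\le\lambda_k\le\lambda^{\rm U}_{s(k)},\qquad k=1,\dots,N.$$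
   Context: Domain and data. $\Omega\subset\mathbb R^d$, $d\in\{2,3\}$, is a bounded polygonal (polyhedral) domain whose boundary is split into two disjoint parts, $\partial\Omega=\partial\Omega_1\cup\partial\Omega_2$ (Dirichlet part $\partial\Omega_1$, Robin part $\partial\Omega_2$). $V=\{v\in H^1(\Omega):\ v=0\text{ on }\partial\Omega_1\}$. The data $\boldsymbol A,\widetilde{\boldsymbol A}\in L^\infty(\Omega;\mathbb R^{d\times d})$ are symmetric and uniformly positive definite in $\Omega$ (i.e. $c\|\boldsymbol v\|^2\le(\boldsymbol A(\boldsymbol x)\boldsymbol v,\boldsymbol v)\le C\|\boldsymbol v\|^2$ for some constants $0<c\le C<\infty$, all $\boldsymbol x\in\Omega$, $\boldsymbol v\in\mathbb R^d$, and similarly for $\widetilde{\boldsymbol A}$). The functions $g_3,\widetilde g_3\in L^\infty(\partial\Omega_2)$ are nonnegative and there are constants $0<c_g\le C_g<\infty$ with $0\le c_g\widetilde g_3(\boldsymbol x)\le g_3(\boldsymbol x)\le C_g\widetilde g_3(\boldsymbol x)$ for $\boldsymbol x\in\partial\Omega_2$. Discretization. $\Omega$ is decomposed into finitely many elements $\mathcal E_j$, $j=1,\dots,N_e$, such that every element edge (face if $d=3$) contained in $\partial\Omega$ lies in $\partial\Omega_1$ or in $\partial\Omega_2$ (up to a set of zero $(d-1)$-dimensional measure). $\varphi_1,\dots,\varphi_N\in V$ are linearly independent continuous conforming finite element basis functions, and $\mathcal P_k$ denotes the smallest patch (union) of elements covering the support of $\varphi_k$. The matrices have elements $$\mathsf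 A_{kl}=\int_\Omega\nabla\varphi_l\cdot\boldsymbol A\nabla\varphi_k\,d\boldsymbol x+\int_{\partial\Omega_2}g_3\varphi_l\varphi_k\,dS,\qquad \widetilde{\mathsf A}_{kl}=\int_\Omega\nabla\varphi_l\cdot\widetilde{\boldsymbol A}\nabla\varphi_k\,d\boldsymbol x+\int_{\partial\Omega_2}\widetilde g_3\varphi_l\varphi_k\,dS.$$ Bounds. If no edge (face) of $\mathcal E_j$ lies in $\partial\Omega_2$, set $$\alpha_j^{\min}=\operatorname*{ess\,inf}_{\boldsymbol x\in\mathcal E_j}\lambda_{\min}\big(\widetilde{\boldsymbol A}^{-1}(\boldsymbol x)\boldsymbol A(\boldsymbol x)\big),\qquad \alpha_j^{\max}=\operatorname*{ess\,sup}_{\boldsymbol x\in\mathcal E_j}\lambda_{\max}\big(\widetilde{\boldsymbol A}^{-1}(\boldsymbol x)\boldsymbol A(\boldsymbol x)\big).$$ If at least one edge (face) of $\mathcal E_j$ lies in $\partial\Omega_2$, set $$\alpha_j^{\min}=\min\Big\{\operatorname*{ess\,inf}_{\boldsymbol x\in\partial\Omega_2\cap\overline{\mathcal E}_j,\ g_3(\boldsymbol x)\ne0}\widetilde g_3^{-1}(\boldsymbol x)g_3(\boldsymbol x),\ \operatorname*{ess\,inf}_{\boldsymbol x\in\mathcal E_j}\lambda_{\min}\big(\widetilde{\boldsymbol A}^{-1}(\boldsymbol x)\boldsymbol A(\boldsymbol x)\big)\Big\},$$ $$\alpha_j^{\max}=\max\Big\{\operatorname*{ess\,sup}_{\boldsymbol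 x\in\partial\Omega_2\cap\overline{\mathcal E}_j,\ g_3(\boldsymbol x)\ne0}\widetilde g_3^{-1}(\boldsymbol x)g_3(\boldsymbol x),\ \operatorname*{ess\,sup}_{\boldsymbol x\in\mathcal E_j}\lambda_{\max}\big(\widetilde{\boldsymbol A}^{-1}(\boldsymbol x)\boldsymbol A(\boldsymbol x)\big)\Big\},$$ where boundary terms over a set of zero surface measure are omitted. Here $\lambda_{\min},\lambda_{\max}$ denote the smallest and largest eigenvalue. Finally, for $k=1,\dots,N$, $$\lambda_k^{\rm L}=\min_{\mathcal E_j\subset\mathcal P_k}\alpha_j^{\min},\qquad \lambda_k^{\rm U}=\max_{\mathcal E_j\subset\mathcal P_k}\alpha_j^{\max}.$$ *)

theory Defs
  imports
    "HOL-Probability.Essential_Supremum"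
    "Jordan_Normal_Form.Gauss_Jordan_Elimination"
    "Jordan_Normal_Form.Char_Poly"
begin

text \<open>Two matrix types occur below. The coefficient matrices \<open>A x\<close> are of type
  \<open>real^'d^'d\<close> from HOL-Analysis, since the space dimension \<open>d = CARD('d)\<close> is fixed; the
  \<open>N \<times> N\<close> stiffness matrices are of type \<open>real mat\<close> from Jordan_Normal_Form. The infix dot
  always denotes the Euclidean inner product.\<close>

no_notation scalar_prod (infix \<open>\<bullet>\<close> 70)


section \<open>Surface measure\<close>

text \<open>\<open>s\<close>-dimensional Hausdorff measure, normalised so as to agree with Lebesgue measure on
  \<open>s\<close>-dimensional flats. Boundedness of the covering sets has to be required separately,
  because \<^const>\<open>diameter\<close> is unspecified on unbounded sets.\<close>

definition hausdorff_pre :: "nat \<Rightarrow> real \<Rightarrow> 'a::metric_space set \<Rightarrow> ennreal" where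
  "hausdorff_pre s \<delta> S =
     (INF U \<in> {U :: nat \<Rightarrow> 'a set. (\<forall>i. bounded (U i) \<and> diameter (U i) \<le> \<delta>) \<and> S \<subseteq> (\<Union>i. U i)}.
        \<Sum>i. ennreal (unit_ball_vol (real s) * (diameter (U i) / 2) ^ s))"

definition hausdorff_outer :: "nat \<Rightarrow> 'a::metric_space set \<Rightarrow> ennreal" where
  "hausdorff_outer s S = (SUP \<delta> \<in> {0<..}. hausdorff_pre s \<delta> S)"

definition hausdorff_measure :: "nat \<Rightarrow> 'a::metric_space measure" where
  "hausdorff_measure s = completion (measure_of UNIV (sets borel) (hausdorff_outer s))"

definition surface :: "(real^'d) measure" where
  "surface = hausdorff_measure (CARD('d) - 1)"


section \<open>Polyhedral domains and meshes\<close>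

text \<open>A list \<open>F\<close> of the edges (\<open>d = 2\<close>) or faces (\<open>d = 3\<close>) of \<open>U\<close>. If \<open>closure U\<close> is a convex
  polytope with interior \<open>U\<close>, its facets are such a list; a nonconvex planar face is listed as
  several convex pieces.\<close>

definition face_decomposition :: "(real^'d) set \<Rightarrow> (real^'d) set set \<Rightarrow> bool" where
  "face_decomposition U F \<longleftrightarrow>
     finite F \<and> frontier U = \<Union>F \<and>
     (\<forall>f\<in>F. polytope f \<and> aff_dim f = int CARD('d) - 1) \<and>
     pairwise (\<lambda>f g. rel_interior f \<inter> rel_interior g = {}) F"

definition polyhedral_domain :: "(real^'d) set \<Rightarrow> bool" where
  "polyhedral_domain U \<longleftrightarrow>
     open U \<and> connected U \<and> bounded U \<and> U \<noteq> {} \<and> (\<exists>F. face_decomposition U F)"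

text \<open>The elements \<open>E j\<close> are open, and \<open>F j\<close> is the set of faces of \<open>E j\<close>. Elements need not be
  convex and hanging nodes inside the domain are allowed; the last condition says that the
  mesh resolves the boundary, i.e. no face lies only partially in it.\<close>

definition mesh ::
  "(real^'d) set \<Rightarrow> nat \<Rightarrow> (nat \<Rightarrow> (real^'d) set) \<Rightarrow> (nat \<Rightarrow> (real^'d) set set) \<Rightarrow> bool" where
  "mesh \<Omega> Ne E F \<longleftrightarrow>
     (\<forall>j\<in>{1..Ne}. polyhedral_domain (E j) \<and> E j \<subseteq> \<Omega> \<and> face_decomposition (E j) (F j)) \<and>
     (\<forall>i\<in>{1..Ne}. \<forall>j\<in>{1..Ne}. i \<noteq> j \<longrightarrow> E i \<inter> E j = {}) \<and>
     closure \<Omega> = (\<Union>j\<in>{1..Ne}. closure (E j)) \<and>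
     (\<forall>j\<in>{1..Ne}. \<forall>f\<in>F j. f \<subseteq> frontier \<Omega> \<or> f \<inter> frontier \<Omega> \<in> null_sets surface)"

text \<open>A face lies in the boundary part \<open>\<Gamma>\<close> up to a set of zero surface measure.\<close>

definition face_in :: "(real^'d) set \<Rightarrow> (real^'d) set \<Rightarrow> bool" where
  "face_in f \<Gamma> \<longleftrightarrow> f - \<Gamma> \<in> null_sets surface"


section \<open>Function spaces\<close>

definition Linf :: "'a measure \<Rightarrow> ('a \<Rightarrow> 'b::real_normed_vector) \<Rightarrow> bool" where
  "Linf M f \<longleftrightarrow> f \<in> borel_measurable M \<and> (\<exists>C. AE x in M. norm (f x) \<le> C)"

definition L2 :: "'a measure \<Rightarrow> ('a \<Rightarrow> 'b::real_normed_vector) \<Rightarrow> bool" where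
  "L2 M f \<longleftrightarrow> f \<in> borel_measurable M \<and> integrable M (\<lambda>x. (norm (f x))\<^sup>2)"

primrec continuously_diff :: "nat \<Rightarrow> ('a::euclidean_space \<Rightarrow> real) \<Rightarrow> bool" where
  "continuously_diff 0 f = continuous_on UNIV f"
| "continuously_diff (Suc n) f =
     ((\<forall>x. f differentiable (at x)) \<and>
      (\<forall>b\<in>Basis. continuously_diff n (\<lambda>x. frechet_derivative f (at x) b)))"

definition test_function :: "'a::euclidean_space set \<Rightarrow> ('a \<Rightarrow> real) \<Rightarrow> bool" where
  "test_function \<Omega> \<psi> \<longleftrightarrow>
     (\<forall>n. continuously_diff n \<psi>) \<and>
     compact (closure {x. \<psi> x \<noteq> 0}) \<and> closure {x. \<psi> x \<noteq> 0} \<subseteq> \<Omega>"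

definition H1_gradient ::
  "'a::euclidean_space set \<Rightarrow> ('a \<Rightarrow> real) \<Rightarrow> ('a \<Rightarrow> 'a) \<Rightarrow> bool" where
  "H1_gradient \<Omega> v G \<longleftrightarrow>
     L2 (lebesgue_on \<Omega>) v \<and> L2 (lebesgue_on \<Omega>) G \<and>
     (\<forall>\<psi>. test_function \<Omega> \<psi> \<longrightarrow>
       (\<forall>b\<in>Basis. (LINT x|lebesgue_on \<Omega>. v x * frechet_derivative \<psi> (at x) b)
                 = - (LINT x|lebesgue_on \<Omega>. (G x \<bullet> b) * \<psi> x)))"

definition H1 :: "'a::euclidean_space set \<Rightarrow> ('a \<Rightarrow> real) set" where
  "H1 \<Omega> = {v. \<exists>G. H1_gradient \<Omega> v G}"

text \<open>The weak gradient is unique only up to null sets; the integrals below do not depend on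
  the chosen representative.\<close>

definition grad :: "'a::euclidean_space set \<Rightarrow> ('a \<Rightarrow> real) \<Rightarrow> 'a \<Rightarrow> 'a" where
  "grad \<Omega> v = (SOME G. H1_gradient \<Omega> v G)"

text \<open>The continuous members of \<open>V = {v \<in> H1 \<Omega>. v = 0 on \<Gamma>}\<close>. The trace of a function that is
  continuous on \<open>closure \<Omega>\<close> is its pointwise restriction to the boundary.\<close>

definition V_cont :: "(real^'d) set \<Rightarrow> (real^'d) set \<Rightarrow> (real^'d \<Rightarrow> real) set" where
  "V_cont \<Omega> \<Gamma> = {v. v \<in> H1 \<Omega> \<and> continuous_on (closure \<Omega>) v \<and>
                     (AE x in restrict_space surface \<Gamma>. v x = 0)}"


section \<open>Coefficients and stiffness matrices\<close>

definition diffusion_tensor :: "(real^'d) set \<Rightarrow> (real^'d \<Rightarrow> real^'d^'d) \<Rightarrow> bool" where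
  "diffusion_tensor \<Omega> A \<longleftrightarrow>
     Linf (lebesgue_on \<Omega>) A \<and>
     (\<forall>x\<in>\<Omega>. transpose (A x) = A x) \<and>
     (\<exists>c C. 0 < c \<and> c \<le> C \<and>
        (\<forall>x\<in>\<Omega>. \<forall>v. c * (norm v)\<^sup>2 \<le> (A x *v v) \<bullet> v \<and> (A x *v v) \<bullet> v \<le> C * (norm v)\<^sup>2))"

text \<open>The basis functions are \<open>\<phi> 1, \<dots>, \<phi> N\<close>, whereas entries of \<open>real mat\<close> are indexed from 0.\<close>

definition stiffness ::
  "(real^'d) set \<Rightarrow> (real^'d) set \<Rightarrow> (real^'d \<Rightarrow> real^'d^'d) \<Rightarrow> (real^'d \<Rightarrow> real) \<Rightarrow>
   nat \<Rightarrow> (nat \<Rightarrow> real^'d \<Rightarrow> real) \<Rightarrow> real mat" where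
  "stiffness \<Omega> \<Gamma> A g N \<phi> = Matrix.mat N N (\<lambda>(k, l).
     (LINT x|lebesgue_on \<Omega>. grad \<Omega> (\<phi> (l + 1)) x \<bullet> (A x *v grad \<Omega> (\<phi> (k + 1)) x)) +
     (LINT x|restrict_space surface \<Gamma>. g x * \<phi> (l + 1) x * \<phi> (k + 1) x))"


section \<open>Local bounds\<close>

definition eigenvalues :: "real^'d^'d \<Rightarrow> real set" where
  "eigenvalues M = {\<mu>. \<exists>v. v \<noteq> 0 \<and> M *v v = \<mu> *\<^sub>R v}"

definition eig_min :: "real^'d^'d \<Rightarrow> real" where
  "eig_min M = Min (eigenvalues M)"

definition eig_max :: "real^'d^'d \<Rightarrow> real" where
  "eig_max M = Max (eigenvalues M)"

definition essinf :: "'a measure \<Rightarrow> ('a \<Rightarrow> ereal) \<Rightarrow> ereal" where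
  "essinf M f = - esssup M (\<lambda>x. - f x)"

text \<open>The bounds are extended reals. Over a null set the essential infimum is \<open>\<infinity>\<close> and the
  essential supremum is \<open>- \<infinity>\<close>, so such boundary terms drop out of \<^const>\<open>min\<close> and \<^const>\<open>max\<close>.
  Arguments: \<open>\<Gamma>\<close> is the Robin part of the boundary, \<open>e\<close> an element with faces \<open>F\<close>, and
  \<open>B\<close>, \<open>h\<close> are the coefficients of the preconditioner.\<close>

definition alpha_min ::
  "(real^'d) set \<Rightarrow> (real^'d \<Rightarrow> real^'d^'d) \<Rightarrow> (real^'d \<Rightarrow> real^'d^'d) \<Rightarrow>
   (real^'d \<Rightarrow> real) \<Rightarrow> (real^'d \<Rightarrow> real) \<Rightarrow> (real^'d) set \<Rightarrow> (real^'d) set set \<Rightarrow> ereal" where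
  "alpha_min \<Gamma> A B g h e F =
     (let vol = essinf (lebesgue_on e) (\<lambda>x. ereal (eig_min (matrix_inv (B x) ** A x)));
          bd = essinf (restrict_space surface {x \<in> \<Gamma> \<inter> closure e. g x \<noteq> 0})
                 (\<lambda>x. ereal (inverse (h x) * g x))
      in if \<exists>f\<in>F. face_in f \<Gamma> then min bd vol else vol)"

definition alpha_max ::
  "(real^'d) set \<Rightarrow> (real^'d \<Rightarrow> real^'d^'d) \<Rightarrow> (real^'d \<Rightarrow> real^'d^'d) \<Rightarrow>
   (real^'d \<Rightarrow> real) \<Rightarrow> (real^'d \<Rightarrow> real) \<Rightarrow> (real^'d) set \<Rightarrow> (real^'d) set set \<Rightarrow> ereal" where
  "alpha_max \<Gamma> A B g h e F =
     (let vol = esssup (lebesgue_on e) (\<lambda>x. ereal (eig_max (matrix_inv (B x) ** A x)));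
          bd = esssup (restrict_space surface {x \<in> \<Gamma> \<inter> closure e. g x \<noteq> 0})
                 (\<lambda>x. ereal (inverse (h x) * g x))
      in if \<exists>f\<in>F. face_in f \<Gamma> then max bd vol else vol)"

text \<open>The smallest union of closed elements that covers the support of \<open>v\<close>. The intersection is
  itself such a union, because the elements are open, disjoint and dense in \<open>\<Omega>\<close>.\<close>

definition patch ::
  "(real^'d) set \<Rightarrow> nat \<Rightarrow> (nat \<Rightarrow> (real^'d) set) \<Rightarrow> (real^'d \<Rightarrow> real) \<Rightarrow> (real^'d) set" where
  "patch \<Omega> Ne E v =
     \<Inter>{P. (\<exists>J\<subseteq>{1..Ne}. P = (\<Union>j\<in>J. closure (E j))) \<and> closure {x\<in>\<Omega>. v x \<noteq> 0} \<subseteq> P}"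

definition lambda_L ::
  "(real^'d) set \<Rightarrow> (real^'d) set \<Rightarrow> (real^'d \<Rightarrow> real^'d^'d) \<Rightarrow> (real^'d \<Rightarrow> real^'d^'d) \<Rightarrow>
   (real^'d \<Rightarrow> real) \<Rightarrow> (real^'d \<Rightarrow> real) \<Rightarrow>
   nat \<Rightarrow> (nat \<Rightarrow> (real^'d) set) \<Rightarrow> (nat \<Rightarrow> (real^'d) set set) \<Rightarrow> (real^'d \<Rightarrow> real) \<Rightarrow> ereal" where
  "lambda_L \<Omega> \<Gamma> A B g h Ne E F v =
     Min ((\<lambda>j. alpha_min \<Gamma> A B g h (E j) (F j)) ` {j\<in>{1..Ne}. E j \<subseteq> patch \<Omega> Ne E v})"

definition lambda_U ::
  "(real^'d) set \<Rightarrow> (real^'d) set \<Rightarrow> (real^'d \<Rightarrow> real^'d^'d) \<Rightarrow> (real^'d \<Rightarrow> real^'d^'d) \<Rightarrow>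
   (real^'d \<Rightarrow> real) \<Rightarrow> (real^'d \<Rightarrow> real) \<Rightarrow>
   nat \<Rightarrow> (nat \<Rightarrow> (real^'d) set) \<Rightarrow> (nat \<Rightarrow> (real^'d) set set) \<Rightarrow> (real^'d \<Rightarrow> real) \<Rightarrow> ereal" where
  "lambda_U \<Omega> \<Gamma> A B g h Ne E F v =
     Max ((\<lambda>j. alpha_max \<Gamma> A B g h (E j) (F j)) ` {j\<in>{1..Ne}. E j \<subseteq> patch \<Omega> Ne E v})"

end

theory Submission
  imports Defs "Jordan_Normal_Form.Schur_Decomposition"
begin

(* The infix dot denotes the Euclidean inner product throughout. *)
no_notation scalar_prod (infix \<open>\<bullet>\<close> 70)

text \<open>Both stiffness matrices are Gram matrices: for a coefficient vector \<open>c\<close> and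
  \<open>v = \<Sum>k. c k * \<phi> k\<close> the quadratic form \<open>c\<^sup>T K c\<close> is the energy
  \<open>\<integral> \<nabla>v \<bullet> A \<nabla>v + \<integral> g3 * v\<^sup>2\<close>, and likewise for \<open>Kt\<close> with the coefficients of the preconditioner
  (\<open>stiffness_form\<close>). Let \<open>\<mu>\<close> be a real number and let \<open>S\<close> be the set of all indices \<open>k\<close> with
  \<open>\<mu> \<le> lamL k\<close>. If \<open>c\<close> is supported in \<open>S\<close>, then \<open>v\<close> and \<open>\<nabla>v\<close> live on elements whose local bound is
  at least \<open>\<mu>\<close>, and there \<open>A - \<mu> At\<close> is positive semidefinite and \<open>g3 \<ge> \<mu> gt3\<close>. Integration gives
  \<open>c\<^sup>T K c \<ge> \<mu> c\<^sup>T Kt c\<close> on the coordinate subspace of \<open>S\<close> (\<open>stiffness_comparison\<close>).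

  By the Courant-Fischer principle such an inequality on a subspace of dimension \<open>N - k + 1\<close> forces
  \<open>lam k \<ge> \<mu>\<close>: the subspace meets the span of the eigenvectors for \<open>lam 1, \<dots>, lam k\<close>
  (\<open>pencil_eigenvalue_bound\<close>). If \<open>\<mu> \<le> lamL (r k)\<close>, then \<open>S\<close> contains \<open>r k, \<dots>, r N\<close>, which are
  \<open>N - k + 1\<close> indices. The upper bounds follow in the same way with all inequalities
  reversed; the sign \<open>\<sigma>\<close> in the lemmas below covers both cases.

  Three facts make this argument precise. First, \<open>Kt\<close> is positive definite (\<open>stiffness_pos_def\<close>):
  a continuous function with vanishing weak gradient on a connected domain is constant
  (\<open>weak_gradient_0_imp_constant\<close>), and the Dirichlet part has positive measure. Second, the weak
  gradient of a function that is zero on an element vanishes almost everywhere on that element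
  (\<open>H1_gradient_eq_0_where_function_0\<close>). Both rest on explicit smooth test functions, built from
  \<open>exp (- 1 / t)\<close>. Third, polyhedral boundaries have finite surface measure
  (\<open>emeasure_surface_frontier_finite\<close>), so the boundary integrals of bounded functions exist.\<close>

section \<open>Smooth functions with compact support\<close>

lemma continuously_diff_SucI:
  fixes f :: "'a::euclidean_space \<Rightarrow> real"
  assumes "\<And>x. (f has_derivative f' x) (at x)"
    and "\<And>b. b \<in> Basis \<Longrightarrow> continuously_diff n (\<lambda>x. f' x b)"
  shows "continuously_diff (Suc n) f"
proof -
  have "frechet_derivative f (at x) = f' x" for x
    using frechet_derivative_at[OF assms(1)] by simp
  then show ?thesis
    using assms by (auto simp: differentiable_def)
qed

lemma continuously_diff_has_derivative:
  assumes "continuously_diff (Suc n) f"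
  shows "(f has_derivative frechet_derivative f (at x)) (at x)"
  using assms by (simp add: frechet_derivative_works)

lemma continuously_diff_continuous_on:
  "continuously_diff n f \<Longrightarrow> continuous_on UNIV f"
  using differentiable_imp_continuous_on[of f UNIV]
  by (cases n) (simp_all add: differentiable_on_def)

lemma continuously_diff_SucD: "continuously_diff (Suc n) f \<Longrightarrow> continuously_diff n f"
proof (induction n arbitrary: f)
  case 0
  then show ?case using continuously_diff_continuous_on[of "Suc 0" f] by simp
next
  case (Suc n)
  then show ?case by (metis continuously_diff.simps(2))
qed

lemma continuously_diff_const: "continuously_diff n (\<lambda>x::'a::euclidean_space. c::real)"
proof (induction n arbitrary: c)
  case (Suc n)
  show ?case by (rule continuously_diff_SucI[where f' = "\<lambda>_ _. 0"]) (auto intro: Suc)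
qed auto

lemma continuously_diff_add:
  assumes "continuously_diff n f" "continuously_diff n g"
  shows "continuously_diff n (\<lambda>x. f x + g x)"
  using assms
proof (induction n arbitrary: f g)
  case 0
  then show ?case by (auto intro: continuous_intros)
next
  case (Suc n)
  show ?case
  proof (rule continuously_diff_SucI)
    show "((\<lambda>x. f x + g x) has_derivative
        (\<lambda>h. frechet_derivative f (at x) h + frechet_derivative g (at x) h)) (at x)" for x
      using Suc.prems by (intro has_derivative_add continuously_diff_has_derivative)
  qed (use Suc in auto)
qed

lemma continuously_diff_mult:
  assumes "continuously_diff n f" "continuously_diff n g"
  shows "continuously_diff n (\<lambda>x. f x * g x)"
  using assms
proof (induction n arbitrary: f g)
  case 0
  then show ?case by (auto intro: continuous_intros)
next
  case (Suc n)
  show ?case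
  proof (rule continuously_diff_SucI)
    show "((\<lambda>x. f x * g x) has_derivative
        (\<lambda>h. f x * frechet_derivative g (at x) h + frechet_derivative f (at x) h * g x)) (at x)" for x
      using Suc.prems by (intro has_derivative_mult continuously_diff_has_derivative)
    show "continuously_diff n
        (\<lambda>x. f x * frechet_derivative g (at x) b + frechet_derivative f (at x) b * g x)"
      if "b \<in> Basis" for b
      using Suc.prems that continuously_diff_SucD[OF Suc.prems(1)] continuously_diff_SucD[OF Suc.prems(2)]
      by (intro continuously_diff_add Suc.IH) auto
  qed
qed

lemma continuously_diff_prod:
  assumes "\<And>i. i \<in> I \<Longrightarrow> continuously_diff n (f i)"
  shows "continuously_diff n (\<lambda>x. \<Prod>i\<in>I. f i x)"
proof (cases "finite I")
  case True
  then show ?thesis using assms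
    by (induction I rule: finite_induct) (auto intro: continuously_diff_const continuously_diff_mult)
qed (auto intro: continuously_diff_const)

lemma continuously_diff_compose_affine:
  fixes f :: "real \<Rightarrow> real" and u :: "'a::euclidean_space"
  assumes "continuously_diff n f"
  shows "continuously_diff n (\<lambda>x. f (x \<bullet> u + c))"
  using assms
proof (induction n arbitrary: f)
  case 0
  then show ?case by (auto intro!: continuous_intros continuous_on_compose2[of UNIV f])
next
  case (Suc n)
  have df: "(f has_derivative frechet_derivative f (at t)) (at t)" for t
    using Suc.prems by (rule continuously_diff_has_derivative)
  show ?case
  proof (rule continuously_diff_SucI)
    show "((\<lambda>x. f (x \<bullet> u + c)) has_derivative
        (\<lambda>h. frechet_derivative f (at (x \<bullet> u + c)) (h \<bullet> u))) (at x)" for x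
      by (rule has_derivative_compose[OF _ df]) (auto intro!: derivative_eq_intros)
    fix b :: 'a
    have "frechet_derivative f (at t) (b \<bullet> u) = frechet_derivative f (at t) 1 * (b \<bullet> u)" for t
      using linear_scale[OF has_derivative_linear[OF df], of t "b \<bullet> u" 1] by simp
    then show "continuously_diff n (\<lambda>x. frechet_derivative f (at (x \<bullet> u + c)) (b \<bullet> u))"
      using Suc.prems by (auto intro!: continuously_diff_mult continuously_diff_const Suc.IH)
  qed
qed

lemma continuously_diff_real_SucI:
  fixes f :: "real \<Rightarrow> real"
  assumes "\<And>x. (f has_real_derivative f' x) (at x)" "continuously_diff n f'"
  shows "continuously_diff (Suc n) f"
  by (rule continuously_diff_SucI[where f' = "\<lambda>x h. f' x * h"])
     (use assms in \<open>auto simp: has_field_derivative_def\<close>)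

text \<open>Every derivative of \<open>exp (- 1 / t)\<close> has the form \<open>p (1 / t) * exp (- 1 / t)\<close> with a
  polynomial \<open>p\<close>, and such a function decays at \<open>0\<close> faster than any power of \<open>t\<close>. This class
  is therefore closed under differentiation.\<close>

definition flat_exp :: "real poly \<Rightarrow> real \<Rightarrow> real" where
  "flat_exp p t = (if t \<le> 0 then 0 else poly p (1 / t) * exp (- (1 / t)))"

lemma poly_times_exp_minus_tendsto_0: "((\<lambda>s. poly p s * exp (- s)) \<longlongrightarrow> (0::real)) at_top"
proof -
  have "((\<lambda>s. \<Sum>i\<le>degree p. coeff p i * (s ^ i / exp s)) \<longlongrightarrow>
      (\<Sum>i\<le>degree p. coeff p i * (0::real))) at_top"
    by (intro tendsto_intros tendsto_power_div_exp_0)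
  then show ?thesis
    by (simp add: poly_altdef sum_distrib_right exp_minus divide_inverse mult.assoc)
qed

lemma flat_exp_DERIV:
  "(flat_exp p has_real_derivative flat_exp ([:0, 0, 1:] * (p - pderiv p)) t) (at t)"
proof -
  consider "t < 0" | "t > 0" | "t = 0" by linarith
  then show ?thesis
  proof cases
    case 1
    have "((\<lambda>_. 0) has_real_derivative 0) (at t)" by simp
    then have "(flat_exp p has_real_derivative 0) (at t)"
      by (rule has_field_derivative_transform_within[where d = "- t"])
         (use 1 in \<open>auto simp: flat_exp_def dist_real_def\<close>)
    then show ?thesis using 1 by (simp add: flat_exp_def)
  next
    case 2
    have "((\<lambda>t. poly p (1 / t) * exp (- (1 / t))) has_real_derivative
        flat_exp ([:0, 0, 1:] * (p - pderiv p)) t) (at t)"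
      using 2
      by (auto intro!: derivative_eq_intros DERIV_chain2[OF poly_DERIV]
          simp: flat_exp_def divide_simps power2_eq_square algebra_simps)
    then show ?thesis
      by (rule has_field_derivative_transform_within[where d = t])
         (use 2 in \<open>auto simp: flat_exp_def dist_real_def\<close>)
  next
    case 3
    have "((\<lambda>h. flat_exp p h / h) \<longlongrightarrow> 0) (at_right 0)"
    proof -
      have "((\<lambda>h. poly (pCons 0 p) (inverse h) * exp (- inverse h)) \<longlongrightarrow> (0::real)) (at_right 0)"
        by (rule filterlim_compose[OF poly_times_exp_minus_tendsto_0 filterlim_inverse_at_top_right])
      then show ?thesis
        by (rule Lim_transform_eventually)
           (auto simp: flat_exp_def eventually_at_filter divide_simps)
    qed
    moreover have "((\<lambda>h. flat_exp p h / h) \<longlongrightarrow> 0) (at_left 0)"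
      by (rule Lim_transform_eventually[OF tendsto_const])
         (auto simp: flat_exp_def eventually_at_filter)
    ultimately have "((\<lambda>h. flat_exp p h / h) \<longlongrightarrow> 0) (at 0)"
      by (simp add: filterlim_split_at_real filterlim_at_split)
    then show ?thesis
      using 3 by (simp add: flat_exp_def DERIV_def)
  qed
qed

lemma continuously_diff_flat_exp: "continuously_diff n (flat_exp p)"
proof (induction n arbitrary: p)
  case 0
  show ?case
    using DERIV_isCont[OF flat_exp_DERIV] by (simp add: continuous_on_eq_continuous_at)
next
  case (Suc n)
  show ?case by (rule continuously_diff_real_SucI[OF flat_exp_DERIV Suc])
qed

text \<open>The smooth function \<open>exp (- 1 / t)\<close>, extended by \<open>0\<close> to \<open>t \<le> 0\<close>. Its rescalings \<open>half_bump (m * t)\<close>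
  increase to the indicator of the positive half line.\<close>

definition half_bump :: "real \<Rightarrow> real" where
  "half_bump = flat_exp 1"

lemma half_bump_simps: "t \<le> 0 \<Longrightarrow> half_bump t = 0" "t > 0 \<Longrightarrow> half_bump t = exp (- (1 / t))"
  by (auto simp: half_bump_def flat_exp_def)

lemma half_bump_nonneg: "0 \<le> half_bump t"
  by (auto simp: half_bump_def flat_exp_def)

lemma half_bump_le_1: "half_bump t \<le> 1"
  by (auto simp: half_bump_def flat_exp_def)

lemma half_bump_pos_iff: "half_bump t > 0 \<longleftrightarrow> t > 0"
  by (auto simp: half_bump_def flat_exp_def)

definition bump :: "real \<Rightarrow> real \<Rightarrow> real \<Rightarrow> real \<Rightarrow> real" where
  "bump m a b t = half_bump (m * (t - a)) * half_bump (m * (b - t))"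

lemma continuously_diff_bump: "continuously_diff n (bump m a b)"
proof -
  have "continuously_diff n (\<lambda>t. half_bump (t \<bullet> m + - (m * a)) * half_bump (t \<bullet> (- m) + m * b))"
    unfolding half_bump_def
    by (intro continuously_diff_mult continuously_diff_compose_affine continuously_diff_flat_exp)
  also have "(\<lambda>t. half_bump (t \<bullet> m + - (m * a)) * half_bump (t \<bullet> (- m) + m * b)) = bump m a b"
    by (auto simp: bump_def algebra_simps)
  finally show ?thesis .
qed

lemma bump_nonneg: "0 \<le> bump m a b t"
  by (simp add: bump_def half_bump_nonneg)

lemma bump_le_1: "bump m a b t \<le> 1"
  using mult_mono[OF half_bump_le_1 half_bump_le_1] by (simp add: bump_def half_bump_nonneg)

lemma bump_pos_iff: "m > 0 \<Longrightarrow> bump m a b t > 0 \<longleftrightarrow> a < t \<and> t < b"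
  by (auto simp: bump_def half_bump_pos_iff zero_less_mult_iff
        half_bump_nonneg[THEN leD] half_bump_nonneg)

lemma bump_eq_0_iff: "m > 0 \<Longrightarrow> bump m a b t = 0 \<longleftrightarrow> \<not> (a < t \<and> t < b)"
  using bump_pos_iff[of m a b t] bump_nonneg[of m a b t] by auto

lemma bump_tendsto_indicator: "(\<lambda>m. bump (real m) a b t) \<longlonglongrightarrow> indicat_real {a<..<b} t"
proof -
  have lim: "(\<lambda>m. half_bump (real m * c)) \<longlonglongrightarrow> (if c > 0 then 1 else 0)" for c
  proof (cases "c > 0")
    case True
    have "(\<lambda>m. exp (- (1 / c) * (1 / real m))) \<longlonglongrightarrow> exp (- (1 / c) * 0)"
      by (intro tendsto_intros lim_1_over_n)
    moreover have "\<forall>\<^sub>F m in sequentially. exp (- (1 / c) * (1 / real m)) = half_bump (real m * c)"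
      using eventually_gt_at_top[of 0] by eventually_elim (use True in \<open>auto simp: half_bump_simps\<close>)
    ultimately show ?thesis using True by (auto dest: Lim_transform_eventually)
  next
    case False
    then have "half_bump (real m * c) = 0" for m
      by (intro half_bump_simps) (auto simp: mult_le_0_iff)
    then show ?thesis using False by simp
  qed
  have "(\<lambda>m. bump (real m) a b t) \<longlonglongrightarrow>
      (if t - a > 0 then 1 else 0) * (if b - t > 0 then 1 else 0)"
    unfolding bump_def by (intro tendsto_intros lim)
  then show ?thesis by (auto simp: indicator_def split: if_splits)
qed

text \<open>For \<open>m > 0\<close> such a \<open>\<theta>\<close> is a smooth step. The difference of two translates of \<open>\<theta>\<close> has compact
  support, and its derivative is the difference of two translated bumps.\<close>

lemma bump_antiderivative:
  obtains \<theta> where "\<And>t. (\<theta> has_real_derivative bump m a b t) (at t)" "\<And>n. continuously_diff n \<theta>"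
proof -
  define \<theta> where "\<theta> u = (LBINT y=0..ereal u. bump m a b y)" for u
  have cont: "continuous_on S (bump m a b)" for S
    using continuously_diff_continuous_on[OF continuously_diff_bump] continuous_on_subset by blast
  have d: "(\<theta> has_real_derivative bump m a b t) (at t)" for t
  proof -
    define R where "R = \<bar>t\<bar> + 1"
    have "((\<lambda>u. LBINT y=ereal 0..ereal u. bump m a b y) has_vector_derivative bump m a b t)
        (at t within {- R..R})"
      by (rule interval_integral_FTC2) (auto simp: R_def cont)
    then have "(\<theta> has_vector_derivative bump m a b t) (at t within {- R..R})"
      by (simp add: \<theta>_def[abs_def] zero_ereal_def)
    moreover have "at t within {- R..R} = at t"
      by (rule at_within_interior) (auto simp: R_def interior_atLeastAtMost_real)
    ultimately show ?thesis
      by (simp add: has_real_derivative_iff_has_vector_derivative)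
  qed
  have "continuously_diff n \<theta>" for n
    by (rule continuously_diff_SucD) (rule continuously_diff_real_SucI[OF d continuously_diff_bump])
  then show ?thesis using d that by blast
qed

section \<open>Functions with vanishing weak gradient\<close>

definition box_bump :: "real \<Rightarrow> 'a::euclidean_space \<Rightarrow> 'a \<Rightarrow> 'a \<Rightarrow> real" where
  "box_bump m l u x = (\<Prod>b\<in>Basis. bump m (l \<bullet> b) (u \<bullet> b) (x \<bullet> b))"

lemma continuously_diff_box_bump: "continuously_diff n (box_bump m l u)"
proof -
  have "continuously_diff n (\<lambda>x. \<Prod>b\<in>Basis. bump m (l \<bullet> b) (u \<bullet> b) (x \<bullet> b + 0))"
    by (intro continuously_diff_prod continuously_diff_compose_affine continuously_diff_bump)
  then show ?thesis by (simp add: box_bump_def[abs_def])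
qed

lemma box_bump_nonneg: "0 \<le> box_bump m l u x"
  by (auto simp: box_bump_def intro: prod_nonneg bump_nonneg)

lemma box_bump_le_1: "box_bump m l u x \<le> 1"
  by (auto simp: box_bump_def intro!: prod_le_1 bump_nonneg bump_le_1)

lemma box_bump_pos_iff: "m > 0 \<Longrightarrow> box_bump m l u x > 0 \<longleftrightarrow> x \<in> box l u"
  using box_bump_nonneg[of m l u x]
  by (auto simp: less_le box_bump_def bump_eq_0_iff mem_box)

lemma box_bump_eq_0: "m > 0 \<Longrightarrow> x \<notin> box l u \<Longrightarrow> box_bump m l u x = 0"
  using box_bump_pos_iff[of m l u x] box_bump_nonneg[of m l u x] by linarith

lemma box_bump_tendsto_indicator:
  "(\<lambda>m. box_bump (real m) l u x) \<longlonglongrightarrow> indicat_real (box l u) x"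
proof -
  have "(\<lambda>m. box_bump (real m) l u x) \<longlonglongrightarrow>
      (\<Prod>b\<in>Basis. indicat_real {l \<bullet> b<..<u \<bullet> b} (x \<bullet> b))"
    unfolding box_bump_def by (intro tendsto_prod bump_tendsto_indicator)
  also have "(\<Prod>b\<in>Basis. indicat_real {l \<bullet> b<..<u \<bullet> b} (x \<bullet> b)) = indicat_real (box l u) x"
    by (auto simp: indicator_def mem_box intro!: prod.neutral)
  finally show ?thesis .
qed

lemma test_functionI:
  assumes "\<And>n. continuously_diff n \<psi>" "compact C" "C \<subseteq> \<Omega>" "\<And>x. x \<notin> C \<Longrightarrow> \<psi> x = 0"
  shows "test_function \<Omega> \<psi>"
proof -
  have "{x. \<psi> x \<noteq> 0} \<subseteq> C" using assms(4) by auto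
  then have "closure {x. \<psi> x \<noteq> 0} \<subseteq> C"
    by (rule closure_minimal) (rule compact_imp_closed[OF assms(2)])
  then show ?thesis
    using assms compact_closure bounded_subset compact_imp_bounded
    unfolding test_function_def by (metis bounded_closure closure_closure order_trans compact_eq_bounded_closed closed_closure)
qed

lemma test_function_box_bump:
  assumes "m > 0" "cbox l u \<subseteq> \<Omega>"
  shows "test_function \<Omega> (box_bump m l u)"
  by (rule test_functionI[OF continuously_diff_box_bump compact_cbox assms(2)])
     (use assms(1) box_subset_cbox in \<open>blast intro: box_bump_eq_0\<close>)

text \<open>Open boxes form an intersection-stable generator of the Borel sets. Hence, inside a fixed box,
  vanishing integrals over boxes yield vanishing integrals over all Borel subsets.\<close>

lemma AE_eq_0_if_integral_boxes_0:
  fixes w :: "'a::euclidean_space \<Rightarrow> real"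
  assumes w: "integrable lebesgue w" and "open E"
    and boxes: "\<And>l u. cbox l u \<subseteq> E \<Longrightarrow> (LINT x|lebesgue. indicator (box l u) x * w x) = 0"
  shows "AE x in lebesgue. x \<in> E \<longrightarrow> w x = 0"
proof -
  obtain w' where w': "w' \<in> borel_measurable lborel" "AE x in lborel. w x = w' x"
    using completion_ex_borel_measurable_real[of w lborel] w by auto
  have ae: "AE x in lebesgue. w x = w' x"
    using w'(2) by (rule AE_completion)
  have mlb: "w' \<in> borel_measurable lebesgue"
    using w'(1) by (rule measurable_completion)
  have "integrable lebesgue w'"
    using integrable_cong_AE[OF _ mlb ae] w by auto
  then have w'_int: "integrable lborel w'"
    using w'(1) by (simp add: integrable_completion)
  have zero_on_box: "AE x in lebesgue. x \<in> box l u \<longrightarrow> w x = 0" if lu: "cbox l u \<subseteq> E" for l u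
  proof -
    define f where "f x = indicator (box l u) x * w' x" for x
    have f_int: "integrable lborel f"
      unfolding f_def using integrable_mult_indicator[OF _ w'_int, of "box l u"] by simp
    have f_set: "integrable lborel (\<lambda>x. indicator A x * f x)" if "A \<in> sets borel" for A
      using integrable_mult_indicator[OF _ f_int, of A] that by simp
    have gen: "(LINT x|lborel. indicator (box c d) x * f x) = 0" for c d
    proof -
      obtain c' d' where box': "box c d \<inter> box l u = box c' d'" "cbox c' d' \<subseteq> E"
      proof (cases "box c d \<inter> box l u = {}")
        case True
        obtain b :: 'a where "b \<in> Basis" using nonempty_Basis by blast
        then have "box One (0 :: 'a) = {}" "cbox One (0 :: 'a) = {}"
          by (auto simp: box_eq_empty)
        then show ?thesis using that[of One 0] True by simp
      next
        case False
        then obtain c' d' where eq: "box c d \<inter> box l u = box c' d'"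
          unfolding box_Int_box by blast
        have "closure (box c' d') \<subseteq> closure (box l u)"
          using eq by (intro closure_mono) auto
        then have "cbox c' d' \<subseteq> cbox l u"
          using False eq by (metis closure_box inf_bot_right)
        then show ?thesis using that eq lu by blast
      qed
      have "(LINT x|lborel. indicator (box c d) x * f x) = (LINT x|lborel. indicator (box c' d') x * w' x)"
        unfolding f_def box'(1)[symmetric] by (simp add: indicator_inter_arith mult.assoc)
      also have "\<dots> = (LINT x|lebesgue. indicator (box c' d') x * w' x)"
        using w'(1) by (intro integral_completion[symmetric]) auto
      also have "\<dots> = (LINT x|lebesgue. indicator (box c' d') x * w x)"
      proof (rule integral_cong_AE)
        have ind: "indicat_real (box c' d') \<in> borel_measurable lebesgue"
          by (rule borel_measurable_indicator) simp
        show "(\<lambda>x. indicator (box c' d') x * w' x) \<in> borel_measurable lebesgue"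
          by (intro borel_measurable_times ind mlb)
        show "(\<lambda>x. indicator (box c' d') x * w x) \<in> borel_measurable lebesgue"
          using w by (intro borel_measurable_times ind) auto
      qed (use ae in auto)
      also have "\<dots> = 0" by (rule boxes[OF box'(2)])
      finally show ?thesis .
    qed
    have borel_0: "(LINT x|lborel. indicator A x * f x) = 0" if "A \<in> sets borel" for A
    proof -
      have A: "A \<in> sigma_sets UNIV (range (\<lambda>(a, b). box a b :: 'a set))"
        using that by (simp add: borel_eq_box)
      have stable: "Int_stable (range (\<lambda>(a, b). box a b :: 'a set))"
        by (auto simp: Int_stable_def box_Int_box)
      have subset_Pow: "range (\<lambda>(a, b). box a b :: 'a set) \<subseteq> Pow UNIV" by auto
      show ?thesis
        using stable subset_Pow A
      proof (induction rule: sigma_sets_induct_disjoint)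
        case (basic A)
        then show ?case using gen by auto
      next
        case (compl A)
        then have A: "A \<in> sets borel" by (simp add: borel_eq_box)
        have tot: "(LINT x|lborel. f x) = 0"
          using gen[of l u] by (simp add: f_def mult.assoc[symmetric] flip: indicator_inter_arith)
        have "(LINT x|lborel. indicator (UNIV - A) x * f x)
            = (LINT x|lborel. f x - indicator A x * f x)"
          by (intro Bochner_Integration.integral_cong) (auto simp: indicator_def)
        also have "\<dots> = 0"
          using f_int f_set[OF A] tot compl by simp
        finally show ?case .
      next
        case (union A)
        then have A: "A i \<in> sets borel" for i by (auto simp: borel_eq_box)
        have "(LINT x:(\<Union>i. A i)|lborel. f x) = (\<Sum>i. (LINT x:(A i)|lborel. f x))"
        proof (rule lebesgue_integral_countable_add)
          have "(\<Union>i. A i) \<in> sets borel" using A by auto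
          then show "set_integrable lborel (\<Union>i. A i) f"
            using f_set by (simp add: set_integrable_def)
        qed (use A union in \<open>auto simp: disjoint_family_on_def\<close>)
        then show ?case using union by (simp add: set_lebesgue_integral_def)
      qed auto
    qed
    have "AE x in lborel. f x = 0"
      by (rule density_unique_real[OF f_int]) (use borel_0 in \<open>auto simp: set_lebesgue_integral_def\<close>)
    then have "AE x in lebesgue. f x = 0" by (rule AE_completion)
    with ae show ?thesis by eventually_elim (auto simp: f_def)
  qed
  obtain \<D> where \<D>: "countable \<D>" "\<D> \<subseteq> Pow E" "\<And>X. X \<in> \<D> \<Longrightarrow> \<exists>a b. X = cbox a b" "\<Union>\<D> = E"
    using open_countable_Union_open_cbox[OF \<open>open E\<close>] by metis
  have "AE x in lebesgue. x \<in> X \<longrightarrow> w x = 0" if X: "X \<in> \<D>" for X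
  proof -
    obtain l u where lu: "X = cbox l u" using \<D>(3)[OF X] by blast
    then have "cbox l u \<subseteq> E" using \<D>(2) X by auto
    then have "AE x in lebesgue. x \<in> box l u \<longrightarrow> w x = 0" by (rule zero_on_box)
    moreover have "AE x in lebesgue. x \<notin> cbox l u - box l u"
      using negligible_frontier_interval[of l u] AE_not_in negligible_iff_null_sets by blast
    ultimately show ?thesis by eventually_elim (auto simp: lu)
  qed
  then have "AE x in lebesgue. \<forall>X\<in>\<D>. x \<in> X \<longrightarrow> w x = 0"
    by (subst AE_ball_countable[OF \<D>(1)]) blast
  then show ?thesis by eventually_elim (use \<D>(4) in auto)
qed

text \<open>The fundamental lemma of the calculus of variations: the indicator of a box is the
  bounded pointwise limit of test functions.\<close>

lemma AE_eq_0_if_integral_test_functions_0: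
  fixes w :: "'a::euclidean_space \<Rightarrow> real"
  assumes w: "integrable (lebesgue_on \<Omega>) w" and "open \<Omega>" "open E" "E \<subseteq> \<Omega>"
    and test: "\<And>\<psi>. test_function E \<psi> \<Longrightarrow> (LINT x|lebesgue_on \<Omega>. w x * \<psi> x) = 0"
  shows "AE x in lebesgue. x \<in> E \<longrightarrow> w x = 0"
proof -
  have \<Omega>: "\<Omega> \<in> sets lebesgue" using \<open>open \<Omega>\<close> by auto
  define W where "W x = indicator \<Omega> x * w x" for x
  have W: "integrable lebesgue W"
    using w \<Omega> by (simp add: W_def[abs_def] integrable_restrict_space)
  have "AE x in lebesgue. x \<in> E \<longrightarrow> W x = 0"
  proof (rule AE_eq_0_if_integral_boxes_0[OF W \<open>open E\<close>])
    fix l u :: 'a assume lu: "cbox l u \<subseteq> E"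
    have meas: "box_bump m l u \<in> borel_measurable lebesgue" for m
      using borel_measurable_continuous_onI[OF continuously_diff_continuous_on[OF continuously_diff_box_bump]]
      by (intro measurable_completion) simp
    have lim: "(\<lambda>m. LINT x|lebesgue. box_bump (real m) l u x * W x) \<longlonglongrightarrow>
        (LINT x|lebesgue. indicator (box l u) x * W x)"
    proof (rule integral_dominated_convergence[where w = "\<lambda>x. \<bar>W x\<bar>"])
      show "AE x in lebesgue. (\<lambda>m. box_bump (real m) l u x * W x) \<longlonglongrightarrow> indicator (box l u) x * W x"
        by (intro AE_I2 tendsto_intros box_bump_tendsto_indicator)
      show "AE x in lebesgue. norm (box_bump (real m) l u x * W x) \<le> \<bar>W x\<bar>" for m
        by (intro AE_I2)
           (simp add: abs_mult box_bump_nonneg box_bump_le_1 mult_left_le_one_le)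
      have "indicat_real (box l u) \<in> borel_measurable lebesgue"
        by (rule borel_measurable_indicator) simp
      then show "(\<lambda>x. indicator (box l u) x * W x) \<in> borel_measurable lebesgue"
        using W by (intro borel_measurable_times) auto
    qed (use W meas in \<open>auto intro!: borel_measurable_times\<close>)
    have ev: "\<forall>\<^sub>F m in sequentially. (LINT x|lebesgue. box_bump (real m) l u x * W x) = 0"
      using eventually_gt_at_top[of 0]
    proof eventually_elim
      case (elim m)
      have "(LINT x|lebesgue_on \<Omega>. w x * box_bump (real m) l u x) = 0"
        using elim lu by (intro test test_function_box_bump) auto
      then show ?case
        using \<Omega> by (simp add: integral_restrict_space W_def mult_ac)
    qed
    show "(LINT x|lebesgue. indicator (box l u) x * W x) = 0"
      by (rule LIMSEQ_unique[OF lim tendsto_eventually[OF ev]])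
  qed
  then show ?thesis
    by eventually_elim (use \<open>E \<subseteq> \<Omega>\<close> in \<open>auto simp: W_def indicator_def\<close>)
qed

text \<open>On a set of finite measure \<open>norm (f x)\<close> is dominated by \<open>1 + (norm (f x))\<^sup>2\<close>.\<close>

lemma L2_integrable:
  fixes f :: "'a::euclidean_space \<Rightarrow> 'b::{banach, second_countable_topology}"
  assumes "L2 (lebesgue_on \<Omega>) f" "\<Omega> \<in> lmeasurable"
  shows "integrable (lebesgue_on \<Omega>) f"
proof (rule Bochner_Integration.integrable_bound)
  show "integrable (lebesgue_on \<Omega>) (\<lambda>x. 1 + (norm (f x))\<^sup>2)"
    using assms by (intro Bochner_Integration.integrable_add) (auto simp: L2_def integrable_restrict_space fmeasurable_def)
  have "t \<le> 1 + t\<^sup>2" for t :: real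
    using sum_squares_bound[of t 1] by (simp add: power2_eq_square) (sos)
  then show "AE x in lebesgue_on \<Omega>. norm (f x) \<le> norm (1 + (norm (f x))\<^sup>2)"
    by (intro AE_I2) (smt (verit) real_norm_def zero_le_power2)
qed (use assms in \<open>auto simp: L2_def\<close>)

lemma test_function_mono: "test_function E \<psi> \<Longrightarrow> E \<subseteq> \<Omega> \<Longrightarrow> test_function \<Omega> \<psi>"
  by (auto simp: test_function_def)

lemma frechet_derivative_test_function_outside:
  assumes "test_function E \<psi>" "x \<notin> E"
  shows "frechet_derivative \<psi> (at x) b = 0"
proof -
  have "(\<psi> has_derivative (\<lambda>_. 0)) (at x)"
  proof (rule has_derivative_transform_within_open[where f = "\<lambda>_. 0"])
    show "open (- closure {x. \<psi> x \<noteq> 0})" by auto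
    show "x \<in> - closure {x. \<psi> x \<noteq> 0}" using assms by (auto simp: test_function_def)
    show "0 = \<psi> y" if "y \<in> - closure {x. \<psi> x \<noteq> 0}" for y
      using that closure_subset[of "{x. \<psi> x \<noteq> 0}"] by auto
  qed auto
  then show ?thesis by (simp add: frechet_derivative_at[symmetric])
qed

text \<open>A test function supported in \<open>E\<close> sees \<open>v\<close> only where it is zero, so the weak gradient
  integrates to zero against all of them.\<close>

lemma H1_gradient_eq_0_where_function_0:
  assumes grad: "H1_gradient \<Omega> v G" and "open \<Omega>" "bounded \<Omega>" "open E" "E \<subseteq> \<Omega>"
    and v: "\<And>x. x \<in> E \<Longrightarrow> v x = 0"
  shows "AE x in lebesgue. x \<in> E \<longrightarrow> G x = 0"
proof -
  have "\<Omega> \<in> lmeasurable" using \<open>open \<Omega>\<close> \<open>bounded \<Omega>\<close> lmeasurable_open by blast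
  then have G: "integrable (lebesgue_on \<Omega>) G"
    using grad by (auto simp: H1_gradient_def intro: L2_integrable)
  have "AE x in lebesgue. x \<in> E \<longrightarrow> G x \<bullet> b = 0" if b: "b \<in> Basis" for b
  proof (rule AE_eq_0_if_integral_test_functions_0[OF _ \<open>open \<Omega>\<close> \<open>open E\<close> \<open>E \<subseteq> \<Omega>\<close>])
    show "integrable (lebesgue_on \<Omega>) (\<lambda>x. G x \<bullet> b)" using G by auto
    fix \<psi> assume \<psi>: "test_function E \<psi>"
    have "(\<lambda>x. v x * frechet_derivative \<psi> (at x) b) = (\<lambda>_. 0)"
      using frechet_derivative_test_function_outside[OF \<psi>, of _ b] v by fastforce
    then show "(LINT x|lebesgue_on \<Omega>. G x \<bullet> b * \<psi> x) = 0"
      using grad b test_function_mono[OF \<psi> \<open>E \<subseteq> \<Omega>\<close>] by (fastforce simp: H1_gradient_def)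
  qed
  then have "AE x in lebesgue. \<forall>b\<in>Basis. x \<in> E \<longrightarrow> G x \<bullet> b = 0"
    by (rule AE_finite_allI[OF finite_Basis])
  then show ?thesis
    by eventually_elim (auto intro: euclidean_eqI)
qed

lemma frechet_derivative_directional:
  assumes "continuously_diff (Suc n) \<psi>" "((\<lambda>t. \<psi> (x + t *\<^sub>R b)) has_real_derivative D) (at 0)"
  shows "frechet_derivative \<psi> (at x) b = D"
proof -
  have "((\<lambda>t::real. x + t *\<^sub>R b) has_derivative (\<lambda>t. t *\<^sub>R b)) (at 0)"
    by (auto intro!: derivative_eq_intros)
  moreover have d: "(\<psi> has_derivative frechet_derivative \<psi> (at x)) (at (x + 0 *\<^sub>R b))"
    using continuously_diff_has_derivative[OF assms(1)] by simp
  ultimately have "((\<lambda>t. \<psi> (x + t *\<^sub>R b)) has_derivative (\<lambda>t. frechet_derivative \<psi> (at x) (t *\<^sub>R b))) (at 0)"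
    by (rule has_derivative_compose)
  moreover have "frechet_derivative \<psi> (at x) (t *\<^sub>R b) = frechet_derivative \<psi> (at x) b * t" for t
    using linear_scale[OF has_derivative_linear[OF d]] by simp
  ultimately have "((\<lambda>t. \<psi> (x + t *\<^sub>R b)) has_real_derivative frechet_derivative \<psi> (at x) b) (at 0)"
    by (simp add: has_field_derivative_def)
  then show ?thesis using assms(2) DERIV_unique by blast
qed

lemma integral_lborel_translate:
  fixes f :: "'a::euclidean_space \<Rightarrow> real"
  assumes "f \<in> borel_measurable borel"
  shows "(LINT x|lborel. f (c + x)) = (LINT x|lborel. f x)"
proof -
  have "(LINT x|distr lborel borel ((+) c). f x) = (LINT x|lborel. f (c + x))"
    using assms by (intro integral_distr) auto
  then show ?thesis by (simp add: lborel_distr_plus)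
qed

lemma sup_norm_neighbourhood:
  fixes y :: "'a::euclidean_space"
  assumes "open U" "y \<in> U"
  obtains \<delta> where "\<delta> > 0" "\<And>x. (\<And>c. c \<in> Basis \<Longrightarrow> \<bar>(x - y) \<bullet> c\<bar> \<le> \<delta>) \<Longrightarrow> x \<in> U"
proof -
  obtain e where e: "e > 0" "ball y e \<subseteq> U" using assms openE by blast
  define \<delta> where "\<delta> = e / (2 * real DIM('a))"
  have "x \<in> U" if "\<And>c. c \<in> Basis \<Longrightarrow> \<bar>(x - y) \<bullet> c\<bar> \<le> \<delta>" for x
  proof -
    have "norm (x - y) \<le> (\<Sum>c\<in>Basis. \<bar>(x - y) \<bullet> c\<bar>)" by (rule norm_le_l1)
    also have "\<dots> \<le> real DIM('a) * \<delta>" using that by (intro sum_bounded_above) auto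
    also have "\<dots> < e" using e(1) by (simp add: \<delta>_def)
    finally show ?thesis using e(2) by (auto simp: dist_norm norm_minus_commute)
  qed
  moreover have "\<delta> > 0" using e(1) by (simp add: \<delta>_def)
  ultimately show ?thesis using that by blast
qed

text \<open>Let \<open>\<rho> p\<close> be a nonnegative smooth bump around \<open>p\<close>. If \<open>y\<close> and \<open>z\<close> differ only in the
  direction \<open>b\<close>, then \<open>\<rho> y - \<rho> z\<close> is the derivative in that direction of a test function whose
  support stays near the segment from \<open>y\<close> to \<open>z\<close>. A vanishing weak gradient therefore makes the
  weighted averages of \<open>v\<close> near \<open>y\<close> and near \<open>z\<close> equal, which is impossible if \<open>v y > v z\<close> and
  the bumps are narrow.\<close>

lemma weak_gradient_0_no_decrease:
  fixes v :: "'a::euclidean_space \<Rightarrow> real"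
  assumes grad: "H1_gradient \<Omega> v G" and G0: "AE x in lebesgue_on \<Omega>. G x = 0"
    and "open \<Omega>" "bounded \<Omega>" and cont: "continuous_on \<Omega> v"
    and lu: "box l u \<subseteq> \<Omega>" "y \<in> box l u" "z \<in> box l u"
    and b: "b \<in> Basis" and yz: "\<And>c. c \<in> Basis \<Longrightarrow> c \<noteq> b \<Longrightarrow> y \<bullet> c = z \<bullet> c"
  shows "v y \<le> v z"
proof (rule ccontr)
  assume "\<not> v y \<le> v z"
  \<comment> \<open>The level \<open>\<kappa>\<close> separates the values of \<open>v\<close> on the two narrow cubes around \<open>y\<close> and \<open>z\<close>.\<close>
  define \<kappa> where "\<kappa> = (v y + v z) / 2"
  have \<kappa>: "v z < \<kappa>" "\<kappa> < v y" using \<open>\<not> v y \<le> v z\<close> by (auto simp: \<kappa>_def)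
  have cont': "continuous_on (box l u) v" using cont lu(1) continuous_on_subset by blast
  have "open {x \<in> box l u. v x > \<kappa>}" "open {x \<in> box l u. v x < \<kappa>}"
    using continuous_on_open_vimage[OF open_box, of l u v] cont'
    by (auto simp: vimage_def Collect_conj_eq Int_commute dest: spec[of _ "{\<kappa><..}"] spec[of _ "{..<\<kappa>}"])
  then obtain \<delta>1 \<delta>2 where \<delta>12: "\<delta>1 > 0" "\<delta>2 > 0"
      "\<And>x. (\<And>c. c \<in> Basis \<Longrightarrow> \<bar>(x - y) \<bullet> c\<bar> \<le> \<delta>1) \<Longrightarrow> x \<in> {x \<in> box l u. v x > \<kappa>}"
      "\<And>x. (\<And>c. c \<in> Basis \<Longrightarrow> \<bar>(x - z) \<bullet> c\<bar> \<le> \<delta>2) \<Longrightarrow> x \<in> {x \<in> box l u. v x < \<kappa>}"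
    using sup_norm_neighbourhood[of "{x \<in> box l u. v x > \<kappa>}" y]
      sup_norm_neighbourhood[of "{x \<in> box l u. v x < \<kappa>}" z] lu \<kappa> by (metis (mono_tags, lifting) mem_Collect_eq)
  define \<delta> where "\<delta> = min \<delta>1 \<delta>2"
  have \<delta>: "\<delta> > 0"
      "\<And>x. (\<And>c. c \<in> Basis \<Longrightarrow> \<bar>(x - y) \<bullet> c\<bar> \<le> \<delta>) \<Longrightarrow> x \<in> box l u \<and> v x > \<kappa>"
      "\<And>x. (\<And>c. c \<in> Basis \<Longrightarrow> \<bar>(x - z) \<bullet> c\<bar> \<le> \<delta>) \<Longrightarrow> x \<in> box l u \<and> v x < \<kappa>"
    using \<delta>12 by (auto simp: \<delta>_def)
  define \<rho> where "\<rho> p = box_bump 1 (p - \<delta> *\<^sub>R One) (p + \<delta> *\<^sub>R One)" for p :: 'a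
  have One: "One \<bullet> c = 1" if "c \<in> Basis" for c :: 'a using that by simp
  have in_cube: "x \<in> box (p - \<delta> *\<^sub>R One) (p + \<delta> *\<^sub>R One) \<longleftrightarrow> (\<forall>c\<in>Basis. \<bar>(x - p) \<bullet> c\<bar> < \<delta>)" for x p :: 'a
    by (auto simp: mem_box One inner_diff_left inner_add_left abs_less_iff algebra_simps) 
  have \<rho>_pos: "\<rho> p x > 0 \<longleftrightarrow> (\<forall>c\<in>Basis. \<bar>(x - p) \<bullet> c\<bar> < \<delta>)" for p x
    unfolding \<rho>_def using in_cube by (simp add: box_bump_pos_iff)
  have \<rho>_nonneg: "0 \<le> \<rho> p x" for p x by (simp add: \<rho>_def box_bump_nonneg)
  have \<rho>_le_1: "\<rho> p x \<le> 1" for p x by (simp add: \<rho>_def box_bump_le_1)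
  have \<rho>_alt: "\<rho> p x = (\<Prod>c\<in>Basis. bump 1 (-\<delta>) \<delta> (x \<bullet> c - p \<bullet> c))" for p x
    unfolding \<rho>_def box_bump_def
    by (intro prod.cong) (auto simp: bump_def One inner_diff_left inner_add_left algebra_simps)
  have \<rho>_cont: "continuous_on UNIV (\<rho> p)" for p
    unfolding \<rho>_def by (rule continuously_diff_continuous_on[OF continuously_diff_box_bump])
  then have \<rho>_borel: "\<rho> p \<in> borel_measurable borel" for p
    by (rule borel_measurable_continuous_onI)

  obtain \<theta> where \<theta>: "\<And>t. (\<theta> has_real_derivative bump 1 (-\<delta>) \<delta> t) (at t)" "\<And>n. continuously_diff n \<theta>"
    using bump_antiderivative by blast
  have \<theta>_const: "\<theta> s = \<theta> t" if "(s \<le> -\<delta> \<and> t \<le> -\<delta>) \<or> (s \<ge> \<delta> \<and> t \<ge> \<delta>)" for s t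
  proof -
    have "\<theta> s = \<theta> t" if "S \<in> {{..-\<delta>}, {\<delta>..}}" "s \<in> S" "t \<in> S" for S
    proof (rule has_field_derivative_zero_constant[THEN exE])
      show "convex S" using that by auto
      show "(\<theta> has_field_derivative 0) (at x within S)" if "x \<in> S" for x
      proof -
        have "bump 1 (-\<delta>) \<delta> x = 0"
          using that \<open>S \<in> _\<close> \<delta>(1) by (auto simp: bump_eq_0_iff)
        then show ?thesis using has_field_derivative_at_within[OF \<theta>(1)[of x]] by simp
      qed
    qed (use that in auto)
    from this[of "{..-\<delta>}"] this[of "{\<delta>..}"] that show ?thesis by auto
  qed
  define R where "R x = (\<Prod>c\<in>Basis - {b}. bump 1 (-\<delta>) \<delta> (x \<bullet> c - y \<bullet> c))" for x
  define \<psi> where "\<psi> x = R x * (\<theta> (x \<bullet> b - y \<bullet> b) - \<theta> (x \<bullet> b - z \<bullet> b))" for x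
  have smooth: "continuously_diff n \<psi>" for n
  proof -
    have "continuously_diff n (\<lambda>x. (\<Prod>c\<in>Basis - {b}. bump 1 (-\<delta>) \<delta> (x \<bullet> c + - (y \<bullet> c))) *
        (\<theta> (x \<bullet> b + - (y \<bullet> b)) + (-1) * \<theta> (x \<bullet> b + - (z \<bullet> b))))"
      by (intro continuously_diff_mult continuously_diff_add continuously_diff_const
          continuously_diff_prod continuously_diff_compose_affine[OF \<theta>(2)]
          continuously_diff_compose_affine[OF continuously_diff_bump])
    then show ?thesis by (simp add: \<psi>_def[abs_def] R_def)
  qed
  have R_alt: "\<rho> p x = R x * bump 1 (-\<delta>) \<delta> (x \<bullet> b - p \<bullet> b)" if "p \<in> {y, z}" for p x
  proof -
    have "R x = (\<Prod>c\<in>Basis - {b}. bump 1 (-\<delta>) \<delta> (x \<bullet> c - p \<bullet> c))"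
      unfolding R_def using that yz by (intro prod.cong) auto
    then show ?thesis
      unfolding \<rho>_alt using b by (subst prod.remove[OF _ b]) (auto simp: mult.commute)
  qed
  have d\<psi>: "frechet_derivative \<psi> (at x) b = \<rho> y x - \<rho> z x" for x
  proof (rule frechet_derivative_directional[OF smooth])
    have "R (x + t *\<^sub>R b) = R x" for t
      unfolding R_def using b by (intro prod.cong) (auto simp: inner_add_left inner_not_same_Basis)
    then have \<psi>_line: "\<psi> (x + t *\<^sub>R b) = R x * (\<theta> (x \<bullet> b + t - y \<bullet> b) - \<theta> (x \<bullet> b + t - z \<bullet> b))" for t
      using b by (simp add: \<psi>_def inner_add_left)
    show "((\<lambda>t. \<psi> (x + t *\<^sub>R b)) has_real_derivative \<rho> y x - \<rho> z x) (at 0)"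
      unfolding \<psi>_line
      by (auto intro!: derivative_eq_intros DERIV_chain2[OF \<theta>(1)] simp: R_alt algebra_simps)
  qed

  have cube: "\<bar>(x - p) \<bullet> c\<bar> \<le> \<delta>" if "\<rho> p x \<noteq> 0" "c \<in> Basis" for p x c
    using that \<rho>_pos[of p x] \<rho>_nonneg[of p x] by (simp add: less_le)
  have supp_y: "x \<in> box l u \<and> v x > \<kappa>" if "\<rho> y x \<noteq> 0" for x
    using cube[OF that] \<delta>(2) by blast
  have supp_z: "x \<in> box l u \<and> v x < \<kappa>" if "\<rho> z x \<noteq> 0" for x
    using cube[OF that] \<delta>(3) by blast

  \<comment> \<open>The support of \<open>\<psi>\<close> is contained in the smallest closed box around both cubes.\<close>
  define l' where "l' = (\<Sum>c\<in>Basis. (min (y \<bullet> c) (z \<bullet> c) - \<delta>) *\<^sub>R c)"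
  define u' where "u' = (\<Sum>c\<in>Basis. (max (y \<bullet> c) (z \<bullet> c) + \<delta>) *\<^sub>R c)"
  have "cbox l' u' \<subseteq> box l u"
  proof -
    have "p + t *\<^sub>R One \<in> box l u" if "p \<in> {y, z}" "\<bar>t\<bar> \<le> \<delta>" for p t
      using \<delta>(2)[of "p + t *\<^sub>R One"] \<delta>(3)[of "p + t *\<^sub>R One"] that by (auto simp: One)
    from this[of y \<delta>] this[of z \<delta>] this[of y "-\<delta>"] this[of z "-\<delta>"]
    have "l \<bullet> c < min (y \<bullet> c) (z \<bullet> c) - \<delta> \<and> max (y \<bullet> c) (z \<bullet> c) + \<delta> < u \<bullet> c" if "c \<in> Basis" for c
      using that \<delta>(1) by (auto simp: mem_box inner_add_left inner_diff_left One min_def max_def)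
    then show ?thesis
      by (force simp: subset_eq mem_box l'_def u'_def)
  qed
  moreover have "\<psi> x = 0" if "x \<notin> cbox l' u'" for x
  proof -
    from that obtain c where c: "c \<in> Basis"
        "x \<bullet> c < min (y \<bullet> c) (z \<bullet> c) - \<delta> \<or> x \<bullet> c > max (y \<bullet> c) (z \<bullet> c) + \<delta>"
      by (auto simp: mem_box l'_def u'_def not_le)
    show ?thesis
    proof (cases "c = b")
      case True
      then have "\<theta> (x \<bullet> b - y \<bullet> b) = \<theta> (x \<bullet> b - z \<bullet> b)"
        using c by (intro \<theta>_const) (auto simp: min_def max_def split: if_splits)
      then show ?thesis by (simp add: \<psi>_def)
    next
      case False
      then have "bump 1 (-\<delta>) \<delta> (x \<bullet> c - y \<bullet> c) = 0" using c by (auto simp: bump_eq_0_iff)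
      then show ?thesis using False c(1) by (auto simp: \<psi>_def R_def)
    qed
  qed
  ultimately have test: "test_function \<Omega> \<psi>"
    using lu(1) by (intro test_functionI[OF smooth compact_cbox[of l' u']]) auto

  have \<Omega>_meas: "\<Omega> \<in> lmeasurable" using \<open>open \<Omega>\<close> \<open>bounded \<Omega>\<close> lmeasurable_open by blast
  have v_int: "integrable (lebesgue_on \<Omega>) v"
    using grad \<Omega>_meas by (auto simp: H1_gradient_def intro: L2_integrable)
  have \<rho>_meas: "\<rho> p \<in> borel_measurable (lebesgue_on \<Omega>)" for p
    by (intro measurable_restrict_space1 measurable_completion) (simp add: \<rho>_borel)
  have \<rho>_int: "integrable (lebesgue_on \<Omega>) (\<rho> p)" for p
  proof (rule Bochner_Integration.integrable_bound[where f = "\<lambda>_. 1 :: real"])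
    show "integrable (lebesgue_on \<Omega>) (\<lambda>_. 1 :: real)"
      using \<Omega>_meas by (auto simp: integrable_restrict_space fmeasurable_def)
  qed (use \<rho>_nonneg \<rho>_le_1 \<rho>_meas in auto)
  have v\<rho>_int: "integrable (lebesgue_on \<Omega>) (\<lambda>x. v x * \<rho> p x)" for p
    by (rule Bochner_Integration.integrable_bound[OF v_int])
       (use v_int \<rho>_meas \<rho>_nonneg \<rho>_le_1 in \<open>auto simp: abs_mult intro!: mult_left_le\<close>)
  have "(LINT x|lebesgue_on \<Omega>. G x \<bullet> b * \<psi> x) = 0"
    by (rule integral_eq_zero_AE) (use G0 in auto)
  then have int1: "(LINT x|lebesgue_on \<Omega>. v x * (\<rho> y x - \<rho> z x)) = 0"
    unfolding d\<psi>[symmetric] using grad test b by (simp add: H1_gradient_def)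
  have int\<rho>: "(LINT x|lebesgue_on \<Omega>. \<rho> p x) = (LINT x|lborel. \<rho> 0 x)" if "p \<in> {y, z}" for p
  proof -
    have ind: "indicator \<Omega> x * \<rho> p x = \<rho> p x" for x
    proof (cases "\<rho> p x = 0")
      case False
      then have "x \<in> \<Omega>" using supp_y[of x] supp_z[of x] that lu(1) by blast
      then show ?thesis by simp
    qed simp
    have "(LINT x|lebesgue_on \<Omega>. \<rho> p x) = (LINT x|lebesgue. indicator \<Omega> x *\<^sub>R \<rho> p x)"
      using \<Omega>_meas by (intro integral_restrict_space) auto
    also have "\<dots> = (LINT x|lebesgue. \<rho> p x)"
      by (simp only: real_scaleR_def ind)
    also have "\<dots> = (LINT x|lborel. \<rho> p x)"
      using \<rho>_borel by (intro integral_completion) auto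
    also have "\<dots> = (LINT x|lborel. \<rho> p (p + x))"
      by (rule integral_lborel_translate[OF \<rho>_borel, symmetric])
    also have "\<dots> = (LINT x|lborel. \<rho> 0 x)"
      by (simp add: \<rho>_alt inner_add_left)
    finally show ?thesis .
  qed
  \<comment> \<open>The integrals of \<open>\<rho> y\<close> and \<open>\<rho> z\<close> agree, so \<open>v\<close> may be replaced by \<open>v - \<kappa>\<close>; the integrand is then
    nonnegative, and positive near \<open>y\<close>.\<close>
  define f where "f x = (v x - \<kappa>) * (\<rho> y x - \<rho> z x)" for x
  have f_split: "f = (\<lambda>x. (v x * \<rho> y x - v x * \<rho> z x) - \<kappa> * (\<rho> y x - \<rho> z x))"
    by (auto simp: f_def algebra_simps)
  have f_int: "integrable (lebesgue_on \<Omega>) f"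
    unfolding f_split using v\<rho>_int \<rho>_int by auto
  have "(LINT x|lebesgue_on \<Omega>. f x) = 0"
    unfolding f_split using v\<rho>_int \<rho>_int int\<rho> int1 by (simp add: algebra_simps)
  moreover have f_nonneg: "0 \<le> f x" for x
  proof -
    show ?thesis
      using supp_y[of x] supp_z[of x] \<rho>_nonneg[of y x] \<rho>_nonneg[of z x]
      by (cases "\<rho> y x = 0"; cases "\<rho> z x = 0") (auto simp: f_def mult_nonpos_nonneg)
  qed
  ultimately have "AE x in lebesgue_on \<Omega>. f x = 0"
    using f_int by (subst (asm) integral_nonneg_eq_0_iff_AE) auto
  then have ae: "AE x in lebesgue. x \<in> \<Omega> \<longrightarrow> f x = 0"
    using \<Omega>_meas by (subst (asm) AE_restrict_space_iff) auto
  define C where "C = box (y - \<delta> *\<^sub>R One) (y + \<delta> *\<^sub>R One)"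
  have "f x > 0 \<and> x \<in> \<Omega>" if "x \<in> C" for x
  proof -
    have *: "\<forall>c\<in>Basis. \<bar>(x - y) \<bullet> c\<bar> < \<delta>" using that in_cube by (simp add: C_def)
    then have "x \<in> box l u" "v x > \<kappa>" using \<delta>(2)[of x] by (auto intro: less_imp_le)
    moreover have "\<rho> y x > 0" using * \<rho>_pos by blast
    moreover have "\<rho> z x = 0"
      using supp_z[of x] \<open>v x > \<kappa>\<close> by linarith
    ultimately show ?thesis using lu(1) by (auto simp: f_def)
  qed
  then have "AE x in lebesgue. x \<notin> C"
    by (intro eventually_mono[OF ae]) fastforce
  then have "C \<in> null_sets lebesgue"
    by (subst AE_iff_null_sets) (auto simp: C_def)
  then have "negligible C" by (simp add: negligible_iff_null_sets)
  moreover have "y \<in> C" unfolding C_def in_cube using \<delta>(1) by simp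
  then have "\<not> negligible C"
    using open_not_negligible[of C] by (auto simp: C_def)
  ultimately show False by blast
qed

text \<open>Inside a box any point is reached from any other by changing one coordinate at a time.\<close>

lemma weak_gradient_0_imp_constant:
  fixes v :: "'a::euclidean_space \<Rightarrow> real"
  assumes grad: "H1_gradient \<Omega> v G" "AE x in lebesgue_on \<Omega>. G x = 0"
    and dom: "open \<Omega>" "bounded \<Omega>" "connected \<Omega>" and cont: "continuous_on \<Omega> v"
  shows "v constant_on \<Omega>"
proof (rule locally_constant_imp_constant[OF dom(3)])
  fix p assume "p \<in> \<Omega>"
  obtain l u where lu: "p \<in> box l u" "box l u \<subseteq> \<Omega>"
    by (rule open_contains_box[OF dom(1) \<open>p \<in> \<Omega>\<close>]) (rule that)
  have line: "v y = v z"
    if "y \<in> box l u" "z \<in> box l u" "b \<in> Basis" "\<And>c. c \<in> Basis \<Longrightarrow> c \<noteq> b \<Longrightarrow> y \<bullet> c = z \<bullet> c" for y z b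
    by (intro antisym weak_gradient_0_no_decrease[OF grad dom(1,2) cont lu(2)]) (use that in auto)
  have "v y = v p"
    if "finite I" "I \<subseteq> Basis" "y \<in> box l u" "\<And>c. c \<in> Basis - I \<Longrightarrow> y \<bullet> c = p \<bullet> c" for I y
    using that
  proof (induction I arbitrary: y rule: finite_induct)
    case empty
    have "y = p" by (rule euclidean_eqI) (use empty in simp)
    then show ?case by simp
  next
    case (insert b I)
    define y' where "y' = y + (p \<bullet> b - y \<bullet> b) *\<^sub>R b"
    have y': "y' \<bullet> c = (if c = b then p \<bullet> b else y \<bullet> c)" if "c \<in> Basis" for c
      using that insert.prems(1) by (auto simp: y'_def inner_add_left inner_not_same_Basis)
    have "y' \<in> box l u" using insert.prems(2) lu(1) y' by (auto simp: mem_box)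
    moreover have "v y' = v p"
      by (rule insert.IH) (use insert.prems calculation y' in auto)
    moreover have "v y = v y'"
      by (rule line[of _ _ b]) (use insert.prems calculation y' in auto)
    ultimately show ?case by simp
  qed
  from this[of Basis] have "\<forall>y\<in>box l u. v y = v p" by auto
  then show "\<exists>T. openin (top_of_set \<Omega>) T \<and> p \<in> T \<and> (\<forall>x\<in>T. v x = v p)"
    using lu open_subset[OF lu(2) open_box] by blast
qed

section \<open>Surface measure of polyhedral boundaries\<close>

text \<open>A bounded subset of an \<open>m\<close>-dimensional affine subspace is covered by \<open>n ^ m\<close> cells of
  diameter \<open>O(1 / n)\<close>, obtained by cutting the coordinates with respect to an orthonormal basis
  into \<open>n\<close> intervals. The covering sums therefore stay bounded as the mesh is refined. The
  countable cover is padded with empty sets, whose contribution \<open>0 ^ m\<close> vanishes for \<open>m > 0\<close>.\<close>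

lemma hausdorff_pre_bound:
  fixes P :: "'a::euclidean_space set"
  assumes B: "finite B" "card B = m" "m > 0" "pairwise Linear_Algebra.orthogonal B" "\<And>b. b \<in> B \<Longrightarrow> norm b = 1"
    and P: "\<And>x. x \<in> P \<Longrightarrow> x - a \<in> span B" "\<And>x. x \<in> P \<Longrightarrow> norm (x - a) < L"
    and "\<delta> > 0" "L > 0"
  shows "hausdorff_pre m \<delta> P \<le> ennreal (unit_ball_vol (real m) * (real m * L) ^ m)"
proof -
  obtain n :: nat where n: "2 * L * real m / \<delta> < real n" using reals_Archimedean2 by blast
  have "0 < 2 * L * real m / \<delta>" using assms by simp
  with n have n0: "n > 0" by (metis less_trans of_nat_0_less_iff)
  define cell where "cell k = {x \<in> P. \<forall>b\<in>B. \<lfloor>((x - a) \<bullet> b + L) * real n / (2 * L)\<rfloor> = int (k b)}" for k :: "'a \<Rightarrow> nat"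
  define I where "I = (B \<rightarrow>\<^sub>E {..<n})"
  have I: "finite I" "card I = n ^ m"
    using B by (auto simp: I_def finite_PiE card_PiE)
  then obtain e where e: "bij_betw e {..<n ^ m} I"
    using ex_bij_betw_nat_finite[OF I(1)] by (auto simp: atLeast0LessThan)
  define U where "U i = (if i < n ^ m then cell (e i) else {})" for i
  have "P \<subseteq> (\<Union>i. U i)"
  proof
    fix x assume x: "x \<in> P"
    define k where "k = (\<lambda>b\<in>B. nat \<lfloor>((x - a) \<bullet> b + L) * real n / (2 * L)\<rfloor>)"
    have bounds: "0 \<le> ((x - a) \<bullet> b + L) * real n / (2 * L)" "((x - a) \<bullet> b + L) * real n / (2 * L) < real n"
      if "b \<in> B" for b
    proof -
      have "\<bar>(x - a) \<bullet> b\<bar> \<le> norm (x - a) * norm b" by (rule Cauchy_Schwarz_ineq2)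
      then have *: "\<bar>(x - a) \<bullet> b\<bar> < L" using B(5)[OF that] P(2)[OF x] by simp
      then show "0 \<le> ((x - a) \<bullet> b + L) * real n / (2 * L)" using \<open>L > 0\<close> by (auto simp: zero_le_divide_iff zero_le_mult_iff)
      have "((x - a) \<bullet> b + L) / (2 * L) < 1" using * \<open>L > 0\<close> by (simp add: divide_simps)
      then have "((x - a) \<bullet> b + L) / (2 * L) * real n < 1 * real n"
        using n0 by (intro mult_strict_right_mono) auto
      then show "((x - a) \<bullet> b + L) * real n / (2 * L) < real n" by simp
    qed
    have "k \<in> I"
      unfolding I_def
    proof (rule PiE_I)
      fix b assume b: "b \<in> B"
      have "\<lfloor>((x - a) \<bullet> b + L) * real n / (2 * L)\<rfloor> < int n" "0 \<le> \<lfloor>((x - a) \<bullet> b + L) * real n / (2 * L)\<rfloor>"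
        using bounds[OF b] by (simp_all add: floor_less_iff del: times_divide_eq_left)
      then show "k b \<in> {..<n}" using b by (simp add: k_def nat_less_iff)
    qed (simp add: k_def)
    moreover have "x \<in> cell k"
      using x bounds by (auto simp: cell_def k_def)
    ultimately obtain i where "i < n ^ m" "x \<in> cell (e i)"
      using e by (metis bij_betw_iff_bijections lessThan_iff)
    then show "x \<in> (\<Union>i. U i)" by (auto simp: U_def)
  qed
  have small: "norm (x - y) \<le> real m * (2 * L / real n)" if "x \<in> cell k" "y \<in> cell k" for x y k
  proof -
    have "x - y \<in> span B"
      using span_diff[OF P(1)[of x] P(1)[of y]] that by (simp add: cell_def)
    then have "x - y = (\<Sum>b\<in>B. ((x - y) \<bullet> b) *\<^sub>R b)"
      using orthonormal_basis_expand[OF B(4,5) _ B(1)] by simp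
    then have "norm (x - y) \<le> (\<Sum>b\<in>B. norm (((x - y) \<bullet> b) *\<^sub>R b))"
      by (metis norm_sum)
    also have "\<dots> \<le> (\<Sum>b\<in>B. 2 * L / real n)"
    proof (rule sum_mono)
      fix b assume b: "b \<in> B"
      define s where "s = ((x - a) \<bullet> b + L) * real n / (2 * L)"
      define t where "t = ((y - a) \<bullet> b + L) * real n / (2 * L)"
      have "\<lfloor>s\<rfloor> = \<lfloor>t\<rfloor>" using that b by (auto simp: cell_def s_def t_def)
      then have "\<bar>s - t\<bar> < 1" by linarith
      moreover have "(x - y) \<bullet> b = (s - t) * (2 * L / real n)"
        using n0 \<open>L > 0\<close> by (simp add: s_def t_def inner_diff_left field_simps)
      ultimately have "\<bar>(x - y) \<bullet> b\<bar> = \<bar>s - t\<bar> * (2 * L / real n)"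
        using \<open>L > 0\<close> by (simp add: abs_mult)
      also have "\<dots> \<le> 1 * (2 * L / real n)"
        using \<open>L > 0\<close> \<open>\<bar>s - t\<bar> < 1\<close> by (intro mult_right_mono) auto
      finally have "\<bar>(x - y) \<bullet> b\<bar> \<le> 2 * L / real n" by simp
      then show "norm (((x - y) \<bullet> b) *\<^sub>R b) \<le> 2 * L / real n"
        using B(5)[OF b] by simp
    qed
    finally show ?thesis using B(2) by simp
  qed
  define D where "D = real m * (2 * L / real n)"
  have D: "0 \<le> D" "D \<le> \<delta>"
    using n n0 \<open>L > 0\<close> \<open>\<delta> > 0\<close> by (auto simp: D_def field_simps)
  have diam: "bounded (U i) \<and> diameter (U i) \<le> D" for i
  proof
    show "diameter (U i) \<le> D"
      using D(1) small by (intro diameter_le) (auto simp: U_def D_def split: if_splits)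
    have "U i \<subseteq> ball a L" using P(2) by (auto simp: U_def cell_def dist_norm norm_minus_commute split: if_splits)
    then show "bounded (U i)" using bounded_ball bounded_subset by blast
  qed
  have "hausdorff_pre m \<delta> P \<le> (\<Sum>i. ennreal (unit_ball_vol (real m) * (diameter (U i) / 2) ^ m))"
    unfolding hausdorff_pre_def
    by (rule INF_lower) (use diam D(2) \<open>P \<subseteq> _\<close> order_trans in \<open>blast intro: order_trans\<close>)
  also have "\<dots> = (\<Sum>i<n ^ m. ennreal (unit_ball_vol (real m) * (diameter (U i) / 2) ^ m))"
    by (rule suminf_finite) (use \<open>m > 0\<close> in \<open>auto simp: U_def diameter_def\<close>)
  also have "\<dots> \<le> (\<Sum>i<n ^ m. ennreal (unit_ball_vol (real m) * (D / 2) ^ m))"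
    using diam by (intro sum_mono ennreal_leI mult_left_mono power_mono divide_right_mono)
      (auto intro!: divide_nonneg_nonneg diameter_ge_0)
  also have "\<dots> = ennreal (real (n ^ m) * (unit_ball_vol (real m) * (D / 2) ^ m))"
    using D(1) by (simp add: ennreal_mult ennreal_of_nat_eq_real_of_nat)
  also have "real (n ^ m) * (unit_ball_vol (real m) * (D / 2) ^ m)
      = unit_ball_vol (real m) * (real n * (D / 2)) ^ m"
    by (simp add: power_mult_distrib del: times_divide_eq_right)
  also have "real n * (D / 2) = real m * L"
    using n0 by (simp add: D_def)
  finally show ?thesis .
qed

lemma hausdorff_outer_affine_bounded_finite:
  fixes P :: "'a::euclidean_space set"
  assumes "bounded P" "aff_dim P = int m" "m > 0"
  shows "hausdorff_outer m P < \<infinity>"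
proof -
  have "P \<noteq> {}" using assms by auto
  then obtain a where a: "a \<in> P" by blast
  have dim: "dim ((\<lambda>x. x - a) ` P) = m"
    using assms(2) aff_dim_eq_dim_subtract[of a P] a by (simp add: hull_inc)
  obtain B where B: "B \<subseteq> span ((\<lambda>x. x - a) ` P)" "pairwise Linear_Algebra.orthogonal B" "\<And>x. x \<in> B \<Longrightarrow> norm x = 1"
      "independent B" "card B = dim (span ((\<lambda>x. x - a) ` P))" "span B = span ((\<lambda>x. x - a) ` P)"
    using orthonormal_basis_subspace[OF subspace_span] by blast
  obtain L0 where L0: "\<And>x. x \<in> P \<Longrightarrow> norm x \<le> L0" using assms(1) bounded_iff by metis
  define L where "L = \<bar>L0\<bar> + norm a + 1"
  have L: "L > 0" "\<And>x. x \<in> P \<Longrightarrow> norm (x - a) < L"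
    using L0 norm_triangle_ineq4[of _ a] by (auto simp: L_def intro: add_nonneg_pos) (smt (verit))
  have "hausdorff_pre m \<delta> P \<le> ennreal (unit_ball_vol (real m) * (real m * L) ^ m)" if "\<delta> > 0" for \<delta>
  proof (rule hausdorff_pre_bound[where B = B and a = a])
    show "finite B" using B(4) independent_imp_finite by blast
    show "card B = m" using B(5) dim by simp
    show "x - a \<in> span B" if "x \<in> P" for x using that B(6) by (auto intro: span_base)
  qed (use B L that assms in auto)
  then have "hausdorff_outer m P \<le> ennreal (unit_ball_vol (real m) * (real m * L) ^ m)"
    unfolding hausdorff_outer_def by (intro SUP_least) auto
  then show ?thesis using le_less_trans by fastforce
qed

lemma sets_surface_borel: "A \<in> sets borel \<Longrightarrow> A \<in> sets surface"
  unfolding surface_def hausdorff_measure_def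
  by (rule sets_completionI_sets) (simp add: sets_measure_of_conv sets.sigma_sets_eq[of borel, simplified])

lemma space_surface [simp]: "space surface = UNIV"
  by (simp add: surface_def hausdorff_measure_def space_measure_of_conv)

text \<open>A measure built by \<^const>\<open>measure_of\<close> either agrees with the given set function or is zero; the
  inequality covers both cases.\<close>

lemma emeasure_surface_le:
  assumes "(A :: (real^'d) set) \<in> sets borel"
  shows "emeasure surface A \<le> hausdorff_outer (CARD('d) - 1) A"
proof -
  let ?M = "measure_of UNIV (sets borel) (hausdorff_outer (CARD('d) - 1)) :: (real^'d) measure"
  have "A \<in> sets ?M" using assms by (simp add: sets_measure_of_conv sets.sigma_sets_eq[of borel, simplified])
  then have "emeasure surface A = emeasure ?M A"
    by (simp add: surface_def hausdorff_measure_def)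
  then show ?thesis by (simp add: emeasure_measure_of_conv)
qed

lemma emeasure_surface_frontier_finite:
  fixes U :: "(real^'d) set"
  assumes "CARD('d) \<ge> 2" "polyhedral_domain U"
  shows "emeasure surface (frontier U) < \<infinity>"
proof -
  obtain F where F: "finite F" "frontier U = \<Union>F"
      "\<And>f. f \<in> F \<Longrightarrow> polytope f \<and> aff_dim f = int CARD('d) - 1"
    using assms(2) by (auto simp: polyhedral_domain_def face_decomposition_def)
  have f_sets: "f \<in> sets borel" if "f \<in> F" for f
    using F(3)[OF that] by (intro borel_closed polytope_imp_closed) simp
  have "emeasure surface f < \<infinity>" if "f \<in> F" for f
  proof -
    have "hausdorff_outer (CARD('d) - 1) f < \<infinity>"
      using F(3)[OF that] assms(1)
      by (intro hausdorff_outer_affine_bounded_finite polytope_imp_bounded) (auto simp: of_nat_diff)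
    then show ?thesis using emeasure_surface_le[OF f_sets[OF that]] by (rule le_less_trans[rotated])
  qed
  then have "(\<Sum>f\<in>F. emeasure surface f) < \<infinity>" by (simp add: F(1))
  moreover have "emeasure surface (\<Union>f\<in>F. f) \<le> (\<Sum>f\<in>F. emeasure surface f)"
    using F(1) f_sets by (intro emeasure_subadditive_finite) (auto intro: sets_surface_borel)
  ultimately show ?thesis using F(2) by (auto intro: le_less_trans)
qed

text \<open>The faces are convex sets without interior points.\<close>

lemma negligible_polyhedral_frontier:
  assumes "face_decomposition (U :: (real^'d) set) F"
  shows "negligible (frontier U)"
proof -
  have "negligible f" if "f \<in> F" for f
  proof -
    have f: "polytope f" "aff_dim f = int CARD('d) - 1" using assms that by (auto simp: face_decomposition_def)
    then have "interior f = {}"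
      using aff_dim_nonempty_interior[of f] by auto
    then show ?thesis
      using f negligible_convex_interior polytope_imp_convex by blast
  qed
  then show ?thesis using assms by (auto simp: face_decomposition_def intro: negligible_Union)
qed

section \<open>Extreme eigenvalues of a symmetric definite matrix pencil\<close>

text \<open>If \<open>f v \<noteq> 0\<close>, a small step from \<open>v\<close> in the direction \<open>- f v\<close> makes the quadratic form negative.\<close>

lemma self_adjoint_nonneg_kernel:
  fixes f :: "'a::real_inner \<Rightarrow> 'a"
  assumes "linear f" and sym: "\<And>x y. f x \<bullet> y = x \<bullet> f y" and nonneg: "\<And>x. 0 \<le> f x \<bullet> x"
    and v: "f v \<bullet> v = 0"
  shows "f v = 0"
proof (rule ccontr)
  assume "f v \<noteq> 0"
  define a where "a = f v \<bullet> f v"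
  define c where "c = f (f v) \<bullet> f v"
  have a: "a > 0" and c: "c \<ge> 0" using \<open>f v \<noteq> 0\<close> nonneg by (auto simp: a_def c_def)
  \<comment> \<open>The form at \<open>v - t *\<^sub>R f v\<close> is \<open>t\<^sup>2 * c - 2 * t * a\<close>; this \<open>t\<close> makes it negative also if \<open>c = 0\<close>.\<close>
  define t where "t = a / (c + 1)"
  have "0 \<le> f (v - t *\<^sub>R f v) \<bullet> (v - t *\<^sub>R f v)" by (rule nonneg)
  also have "\<dots> = t * (t * c - 2 * a)"
    using v sym[of "f v" v]
    by (simp add: linear_diff[OF assms(1)] linear_scale[OF assms(1)] inner_diff_left inner_diff_right
        a_def c_def algebra_simps inner_commute)
  finally have "0 \<le> t * (t * c - 2 * a)" .
  moreover have "t > 0" using a c by (simp add: t_def)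
  moreover have "t * c \<le> a" using a c by (simp add: t_def field_simps)
  ultimately show False using a by (simp add: zero_le_mult_iff)
qed

lemma transpose_inner_commute:
  fixes A :: "real^'n^'n"
  assumes "transpose A = A"
  shows "(A *v x) \<bullet> y = x \<bullet> (A *v y)"
  by (metis assms dot_lmul_matrix vector_transpose_matrix inner_commute)

context
  fixes A B :: "real^'n^'n"
  assumes A: "transpose A = A" and B: "transpose B = B"
    and B_pos: "\<And>v. v \<noteq> 0 \<Longrightarrow> 0 < (B *v v) \<bullet> v"
begin

lemma eigenvalues_pencil_iff:
  "\<mu> \<in> eigenvalues (matrix_inv B ** A) \<longleftrightarrow> (\<exists>v. v \<noteq> 0 \<and> A *v v = \<mu> *\<^sub>R (B *v v))"
proof -
  have "invertible B"
    using B_pos by (metis inner_zero_left invertible_left_inverse less_irrefl matrix_left_invertible_ker)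
  then have inv: "matrix_inv B ** B = Finite_Cartesian_Product.mat 1" "B ** matrix_inv B = Finite_Cartesian_Product.mat 1"
    unfolding invertible_def matrix_inv_def by (metis (mono_tags, lifting) someI_ex)+
  have "(matrix_inv B ** A) *v v = \<mu> *\<^sub>R v \<longleftrightarrow> A *v v = \<mu> *\<^sub>R (B *v v)" for v
  proof
    assume "(matrix_inv B ** A) *v v = \<mu> *\<^sub>R v"
    then have "B *v ((matrix_inv B ** A) *v v) = \<mu> *\<^sub>R (B *v v)"
      by (simp add: matrix_vector_mult_scaleR)
    then show "A *v v = \<mu> *\<^sub>R (B *v v)"
      by (simp add: matrix_vector_mul_assoc matrix_mul_assoc inv)
  next
    assume "A *v v = \<mu> *\<^sub>R (B *v v)"
    then have "matrix_inv B *v (A *v v) = \<mu> *\<^sub>R (matrix_inv B *v (B *v v))"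
      by (simp add: matrix_vector_mult_scaleR)
    then show "(matrix_inv B ** A) *v v = \<mu> *\<^sub>R v"
      by (simp add: matrix_vector_mul_assoc inv)
  qed
  then show ?thesis by (auto simp: eigenvalues_def)
qed

text \<open>Eigenvectors of distinct eigenvalues are orthogonal with respect to \<open>B\<close>, hence linearly
  independent.\<close>

lemma finite_eigenvalues_pencil: "finite (eigenvalues (matrix_inv B ** A))"
proof -
  let ?S = "eigenvalues (matrix_inv B ** A)"
  obtain e where e: "\<And>\<mu>. \<mu> \<in> ?S \<Longrightarrow> e \<mu> \<noteq> 0 \<and> A *v e \<mu> = \<mu> *\<^sub>R (B *v e \<mu>)"
    using eigenvalues_pencil_iff by metis
  have orth: "(B *v e \<mu>) \<bullet> e \<nu> = 0" if "\<mu> \<in> ?S" "\<nu> \<in> ?S" "\<mu> \<noteq> \<nu>" for \<mu> \<nu>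
  proof -
    have "\<mu> * ((B *v e \<mu>) \<bullet> e \<nu>) = \<nu> * ((B *v e \<mu>) \<bullet> e \<nu>)"
      using transpose_inner_commute[OF A, of "e \<mu>" "e \<nu>"] transpose_inner_commute[OF B, of "e \<mu>" "e \<nu>"]
        e[OF that(1)] e[OF that(2)] by simp
    then show ?thesis using that by simp
  qed
  have inj: "inj_on e ?S"
  proof (rule inj_onI, rule ccontr)
    fix \<mu> \<nu> assume *: "\<mu> \<in> ?S" "\<nu> \<in> ?S" "e \<mu> = e \<nu>" "\<mu> \<noteq> \<nu>"
    then show False using orth[OF *(1,2,4)] B_pos[of "e \<mu>"] e[OF *(1)] by simp
  qed
  have "independent (e ` ?S)"
    unfolding real_vector.independent_explicit_module
  proof (intro allI impI)
    fix T u v assume T: "finite T" "T \<subseteq> e ` ?S" "(\<Sum>w\<in>T. u w *\<^sub>R w) = 0" "v \<in> T"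
    have "(B *v v) \<bullet> (\<Sum>w\<in>T. u w *\<^sub>R w) = (\<Sum>w\<in>T. u w * ((B *v v) \<bullet> w))"
      by (simp add: inner_sum_right)
    also have "\<dots> = (\<Sum>w\<in>T. if w = v then u v * ((B *v v) \<bullet> v) else 0)"
    proof (intro sum.cong refl)
      fix w assume "w \<in> T"
      then obtain \<mu> \<nu> where "\<mu> \<in> ?S" "\<nu> \<in> ?S" "v = e \<mu>" "w = e \<nu>" using T by blast
      then show "u w * ((B *v v) \<bullet> w) = (if w = v then u v * ((B *v v) \<bullet> v) else 0)"
        using orth[of \<mu> \<nu>] by (cases "\<mu> = \<nu>") auto
    qed
    also have "\<dots> = u v * ((B *v v) \<bullet> v)" using T by simp
    finally have "u v * ((B *v v) \<bullet> v) = 0" using T by simp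
    moreover from T obtain \<mu> where "\<mu> \<in> ?S" "v = e \<mu>" by blast
    then have "v \<noteq> 0" using e by simp
    ultimately show "u v = 0" using B_pos[of v] by simp
  qed
  then have "finite (e ` ?S)" using independent_bound by blast
  then show ?thesis using inj finite_imageD by blast
qed

text \<open>The Rayleigh quotient, multiplied by the sign \<open>\<sigma>\<close>, attains its minimum on the unit sphere.
  At a minimiser the nonnegative form \<open>\<sigma> (A - \<mu> B)\<close> vanishes, so the minimiser is an eigenvector.\<close>

lemma rayleigh_extremum_eigenvalue:
  fixes \<sigma> :: real
  assumes "\<bar>\<sigma>\<bar> = 1"
  obtains \<mu> where "\<mu> \<in> eigenvalues (matrix_inv B ** A)"
    "\<And>w. 0 \<le> \<sigma> * ((A *v w) \<bullet> w - \<mu> * ((B *v w) \<bullet> w))"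
proof -
  define f where "f v = \<sigma> * (((A *v v) \<bullet> v) / ((B *v v) \<bullet> v))" for v
  have Bn0: "(B *v v) \<bullet> v \<noteq> 0" if "v \<in> sphere 0 1" for v
    using B_pos[of v] that by force
  have "continuous_on (sphere 0 1) f"
    unfolding f_def using Bn0
    by (intro continuous_intros matrix_vector_mult_linear_continuous_on) auto
  moreover have "sphere (0 :: real^'n) 1 \<noteq> {}" by simp
  ultimately obtain v0 where v0: "v0 \<in> sphere 0 1" "\<And>v. v \<in> sphere 0 1 \<Longrightarrow> f v0 \<le> f v"
    using continuous_attains_inf[of "sphere 0 1" f] by auto
  define \<mu> where "\<mu> = ((A *v v0) \<bullet> v0) / ((B *v v0) \<bullet> v0)"
  have nonneg: "0 \<le> \<sigma> * ((A *v w) \<bullet> w - \<mu> * ((B *v w) \<bullet> w))" for w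
  proof (cases "w = 0")
    case False
    define v where "v = (1 / norm w) *\<^sub>R w"
    have v: "v \<in> sphere 0 1" "w = norm w *\<^sub>R v" using False by (auto simp: v_def)
    have "\<sigma> * \<mu> \<le> \<sigma> * (((A *v v) \<bullet> v) / ((B *v v) \<bullet> v))"
      using v0(2)[OF v(1)] by (simp add: f_def \<mu>_def)
    then have "\<sigma> * \<mu> * ((B *v v) \<bullet> v) \<le> \<sigma> * (((A *v v) \<bullet> v) / ((B *v v) \<bullet> v)) * ((B *v v) \<bullet> v)"
      using B_pos[of v] v(1) by (intro mult_right_mono) force+
    then have "0 \<le> \<sigma> * ((A *v v) \<bullet> v - \<mu> * ((B *v v) \<bullet> v))"
      using Bn0[OF v(1)] by (simp add: algebra_simps)
    then have "0 \<le> (norm w)\<^sup>2 * (\<sigma> * ((A *v v) \<bullet> v - \<mu> * ((B *v v) \<bullet> v)))" by simp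
    also have "\<dots> = \<sigma> * ((A *v w) \<bullet> w - \<mu> * ((B *v w) \<bullet> w))"
    proof -
      have "(M *v (t *\<^sub>R v)) \<bullet> (t *\<^sub>R v) = t\<^sup>2 * ((M *v v) \<bullet> v)" for M :: "real^'n^'n" and t
        by (simp add: matrix_vector_mult_scaleR power2_eq_square)
      from this[of A "norm w"] this[of B "norm w"] show ?thesis
        unfolding v(2)[symmetric] by (simp add: algebra_simps)
    qed
    finally show ?thesis .
  qed simp
  define C where "C w = \<sigma> *\<^sub>R (A *v w - \<mu> *\<^sub>R (B *v w))" for w
  have "C v0 = 0"
  proof (rule self_adjoint_nonneg_kernel[where f = C and v = v0])
    show "linear C"
      by (rule linearI) (simp_all add: C_def matrix_vector_right_distrib matrix_vector_mult_scaleR algebra_simps)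
    show "C x \<bullet> y = x \<bullet> C y" for x y
      by (simp add: C_def inner_diff_left inner_diff_right transpose_inner_commute[OF A] transpose_inner_commute[OF B])
    show "0 \<le> C x \<bullet> x" for x using nonneg[of x] by (simp add: C_def inner_diff_left)
    show "C v0 \<bullet> v0 = 0" using Bn0[OF v0(1)] by (simp add: C_def inner_diff_left \<mu>_def)
  qed
  then have "A *v v0 = \<mu> *\<^sub>R (B *v v0)" using assms by (auto simp: C_def)
  moreover have "v0 \<noteq> 0" using v0(1) by auto
  ultimately show ?thesis using that eigenvalues_pencil_iff nonneg by blast
qed

lemma eig_min_rayleigh: "eig_min (matrix_inv B ** A) * ((B *v w) \<bullet> w) \<le> (A *v w) \<bullet> w"
proof -
  obtain \<mu> where \<mu>: "\<mu> \<in> eigenvalues (matrix_inv B ** A)"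
      "\<And>w. 0 \<le> 1 * ((A *v w) \<bullet> w - \<mu> * ((B *v w) \<bullet> w))"
    using rayleigh_extremum_eigenvalue[of 1] by auto
  have "eig_min (matrix_inv B ** A) \<le> \<mu>"
    unfolding eig_min_def using \<mu>(1) finite_eigenvalues_pencil by simp
  then have "eig_min (matrix_inv B ** A) * ((B *v w) \<bullet> w) \<le> \<mu> * ((B *v w) \<bullet> w)"
    using B_pos[of w] by (cases "w = 0") (auto intro: mult_right_mono)
  then show ?thesis using \<mu>(2)[of w] by simp
qed

lemma eig_max_rayleigh: "(A *v w) \<bullet> w \<le> eig_max (matrix_inv B ** A) * ((B *v w) \<bullet> w)"
proof -
  obtain \<mu> where \<mu>: "\<mu> \<in> eigenvalues (matrix_inv B ** A)"
      "\<And>w. 0 \<le> -1 * ((A *v w) \<bullet> w - \<mu> * ((B *v w) \<bullet> w))"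
    using rayleigh_extremum_eigenvalue[of "-1"] by auto
  have "\<mu> \<le> eig_max (matrix_inv B ** A)"
    unfolding eig_max_def using \<mu>(1) finite_eigenvalues_pencil by simp
  then have "\<mu> * ((B *v w) \<bullet> w) \<le> eig_max (matrix_inv B ** A) * ((B *v w) \<bullet> w)"
    using B_pos[of w] by (cases "w = 0") (auto intro: mult_right_mono)
  then show ?thesis using \<mu>(2)[of w] by simp
qed

end

section \<open>Eigenvalue bounds for symmetric pencils from subspaces\<close>

text \<open>Elimination of one equation and one unknown at a time.\<close>

lemma underdetermined_system_nontrivial:
  fixes M :: "'x \<Rightarrow> 'y \<Rightarrow> 'a::field"
  assumes "finite X" "finite Y" "card X < card Y"
  shows "\<exists>a. (\<exists>y\<in>Y. a y \<noteq> 0) \<and> (\<forall>x\<in>X. (\<Sum>y\<in>Y. a y * M x y) = 0)"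
  using assms
proof (induction X arbitrary: Y M rule: finite_induct)
  case empty
  then obtain y where "y \<in> Y" by fastforce
  then show ?case by (intro exI[of _ "\<lambda>_. 1"]) auto
next
  case (insert x X)
  show ?case
  proof (cases "\<forall>y\<in>Y. M x y = 0")
    case True
    have "card X < card Y" using insert by simp
    then obtain a where "\<exists>y\<in>Y. a y \<noteq> 0" "\<forall>x\<in>X. (\<Sum>y\<in>Y. a y * M x y) = 0"
      using insert.IH[OF insert.prems(1)] by blast
    then show ?thesis using True by (intro exI[of _ a]) auto
  next
    case False
    then obtain y0 where y0: "y0 \<in> Y" "M x y0 \<noteq> 0" by blast
    \<comment> \<open>Equation \<open>x\<close> determines the unknown \<open>y0\<close>; \<open>M'\<close> is the system that remains after its
      substitution.\<close>
    define M' where "M' x' y = M x' y - M x' y0 / M x y0 * M x y" for x' y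
    have "card X < card (Y - {y0})" using insert y0 by (simp add: card_insert_if)
    then obtain a where a: "\<exists>y\<in>Y - {y0}. a y \<noteq> 0" "\<forall>x'\<in>X. (\<Sum>y\<in>Y - {y0}. a y * M' x' y) = 0"
      using insert.IH[of "Y - {y0}" M'] insert.prems(1) by blast
    define s where "s = (\<Sum>y\<in>Y - {y0}. a y * M x y)"
    define a' where "a' = a(y0 := - s / M x y0)"
    have split: "(\<Sum>y\<in>Y. a' y * M x' y) = - s / M x y0 * M x' y0 + (\<Sum>y\<in>Y - {y0}. a y * M x' y)" for x'
      using insert.prems(1) y0(1) by (subst sum.remove[of _ y0]) (auto simp: a'_def intro!: sum.cong)
    have "(\<Sum>y\<in>Y. a' y * M x' y) = 0" if "x' \<in> insert x X" for x'
    proof (cases "x' = x")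
      case True
      then show ?thesis using y0(2) unfolding split by (simp add: s_def)
    next
      case False
      then have "0 = (\<Sum>y\<in>Y - {y0}. a y * M' x' y)" using a(2) that by simp
      also have "\<dots> = (\<Sum>y\<in>Y - {y0}. a y * M x' y - M x' y0 / M x y0 * (a y * M x y))"
        by (intro sum.cong) (auto simp: M'_def algebra_simps)
      also have "\<dots> = (\<Sum>y\<in>Y - {y0}. a y * M x' y) - M x' y0 / M x y0 * s"
        by (simp add: sum_subtractf sum_distrib_left s_def)
      finally show ?thesis unfolding split by (simp add: algebra_simps)
    qed
    moreover have "\<exists>y\<in>Y. a' y \<noteq> 0" using a(1) by (auto simp: a'_def)
    ultimately show ?thesis by blast
  qed
qed

text \<open>Vectors with \<open>N\<close> entries are represented by functions on \<open>nat\<close>, of which the form sees the values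
  on \<open>{..<N}\<close>. Linear combinations are then pointwise sums.\<close>

definition mat_form :: "nat \<Rightarrow> real mat \<Rightarrow> (nat \<Rightarrow> real) \<Rightarrow> (nat \<Rightarrow> real) \<Rightarrow> real" where
  "mat_form N M x y = (\<Sum>i<N. x i * (\<Sum>j<N. M $$ (i, j) * y j))"

definition sym_mat :: "nat \<Rightarrow> real mat \<Rightarrow> bool" where
  "sym_mat N M \<longleftrightarrow> (\<forall>i<N. \<forall>j<N. M $$ (i, j) = M $$ (j, i))"

definition pos_def_mat :: "nat \<Rightarrow> real mat \<Rightarrow> bool" where
  "pos_def_mat N M \<longleftrightarrow> (\<forall>x. (\<exists>i<N. x i \<noteq> 0) \<longrightarrow> 0 < mat_form N M x x)"

lemma mat_form_commute: "sym_mat N M \<Longrightarrow> mat_form N M x y = mat_form N M y x"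
  unfolding mat_form_def sum_distrib_left
  by (subst sum.swap) (auto simp: sym_mat_def mult_ac intro!: sum.cong)

lemma mat_form_sum_right:
  "mat_form N M x (\<lambda>i. \<Sum>k\<in>I. c k * y k i) = (\<Sum>k\<in>I. c k * mat_form N M x (y k))"
proof -
  have "mat_form N M x (\<lambda>i. \<Sum>k\<in>I. c k * y k i)
      = (\<Sum>i<N. \<Sum>j<N. \<Sum>k\<in>I. c k * (x i * (M $$ (i, j) * y k j)))"
    by (simp add: mat_form_def sum_distrib_left mult_ac)
  also have "\<dots> = (\<Sum>i<N. \<Sum>k\<in>I. \<Sum>j<N. c k * (x i * (M $$ (i, j) * y k j)))"
    by (intro sum.cong refl sum.swap)
  also have "\<dots> = (\<Sum>k\<in>I. \<Sum>i<N. \<Sum>j<N. c k * (x i * (M $$ (i, j) * y k j)))"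
    by (rule sum.swap)
  also have "\<dots> = (\<Sum>k\<in>I. c k * mat_form N M x (y k))"
    by (simp add: mat_form_def sum_distrib_left)
  finally show ?thesis .
qed

lemma mat_form_sum_left:
  "mat_form N M (\<lambda>i. \<Sum>k\<in>I. c k * y k i) x = (\<Sum>k\<in>I. c k * mat_form N M (y k) x)"
proof -
  have "mat_form N M (\<lambda>i. \<Sum>k\<in>I. c k * y k i) x
      = (\<Sum>i<N. \<Sum>k\<in>I. c k * (y k i * (\<Sum>j<N. M $$ (i, j) * x j)))"
    by (simp add: mat_form_def sum_distrib_right mult_ac)
  also have "\<dots> = (\<Sum>k\<in>I. c k * mat_form N M (y k) x)"
    by (subst sum.swap) (simp add: mat_form_def sum_distrib_left)
  finally show ?thesis .
qed

lemma mat_form_diff_right: "mat_form N M x (\<lambda>i. y i - z i) = mat_form N M x y - mat_form N M x z"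
  by (simp add: mat_form_def right_diff_distrib sum_subtractf)

text \<open>Gram-Schmidt with respect to the form of \<open>Kt\<close>, applied to a basis in which \<open>Kt\<inverse> K\<close> is
  upper triangular. This operator is self-adjoint for the form of \<open>Kt\<close>, so an orthogonal basis of this
  kind consists of eigenvectors: the image of the \<open>n\<close>-th vector minus \<open>lam n\<close> times the vector lies in
  the span of its predecessors, and it is orthogonal to each of them.\<close>

lemma triangular_imp_orthogonal_eigenvectors:
  fixes p :: "nat \<Rightarrow> nat \<Rightarrow> real"
  assumes sym: "sym_mat N K" "sym_mat N Kt" and pos: "pos_def_mat N Kt"
    and indep: "\<And>a. (\<And>i. i < N \<Longrightarrow> (\<Sum>j<N. a j * p j i) = 0) \<Longrightarrow> \<forall>j<N. a j = 0"
    and tri: "\<And>x j. j < N \<Longrightarrow> mat_form N K x (p j) =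
        lam j * mat_form N Kt x (p j) + (\<Sum>i<j. T i j * mat_form N Kt x (p i))"
    and "n \<le> N"
  shows "\<exists>q C. (\<forall>j<n. \<forall>x. mat_form N K x (q j) = lam j * mat_form N Kt x (q j)) \<and>
      (\<forall>j<n. \<forall>k<n. j \<noteq> k \<longrightarrow> mat_form N Kt (q j) (q k) = 0) \<and>
      (\<forall>j<n. 0 < mat_form N Kt (q j) (q j)) \<and>
      (\<forall>j<n. p j = (\<lambda>i. \<Sum>k<n. C j k * q k i))"
  using \<open>n \<le> N\<close>
proof (induction n)
  case 0
  then show ?case by simp
next
  case (Suc n)
  let ?a = "mat_form N K" and ?b = "mat_form N Kt"
  obtain q C where IH:
      "(\<forall>j<n. \<forall>x. ?a x (q j) = lam j * ?b x (q j)) \<and>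
       (\<forall>j<n. \<forall>k<n. j \<noteq> k \<longrightarrow> ?b (q j) (q k) = 0) \<and>
       (\<forall>j<n. 0 < ?b (q j) (q j)) \<and> (\<forall>j<n. p j = (\<lambda>i. \<Sum>k<n. C j k * q k i))"
    using Suc.IH[OF Suc_leD[OF Suc.prems]] by (elim exE) (rule that)
  have eig: "?a x (q j) = lam j * ?b x (q j)" if "j < n" for j x
    using IH[THEN conjunct1] that by simp
  have orth: "?b (q j) (q k) = 0" if "j < n" "k < n" "j \<noteq> k" for j k
    using IH[THEN conjunct2, THEN conjunct1] that by simp
  have q_pos: "0 < ?b (q j) (q j)" if "j < n" for j
    using IH[THEN conjunct2, THEN conjunct2, THEN conjunct1] that by simp
  have C: "p j = (\<lambda>i. \<Sum>k<n. C j k * q k i)" if "j < n" for j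
    using IH[THEN conjunct2, THEN conjunct2, THEN conjunct2] that by blast
  have n: "n < N" using Suc.prems by simp
  have coeff: "(\<Sum>k<n. e k * ?b (q j) (q k)) = e j * ?b (q j) (q j)" if "j < n" for e j
  proof -
    have "(\<Sum>k<n. e k * ?b (q j) (q k)) = (\<Sum>k<n. if k = j then e j * ?b (q j) (q j) else 0)"
      using that orth by (intro sum.cong) auto
    then show ?thesis using that by simp
  qed
  define c where "c j = ?b (q j) (p n) / ?b (q j) (q j)" for j
  define r where "r i = p n i - (\<Sum>j<n. c j * q j i)" for i
  have b_r: "?b x r = ?b x (p n) - (\<Sum>j<n. c j * ?b x (q j))" for x
    unfolding r_def[abs_def] by (simp add: mat_form_diff_right mat_form_sum_right)
  have a_r: "?a x r = ?a x (p n) - (\<Sum>j<n. c j * ?a x (q j))" for x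
    unfolding r_def[abs_def] by (simp add: mat_form_diff_right mat_form_sum_right)
  have orth_r: "?b (q j) r = 0" if "j < n" for j
    using q_pos[OF that] unfolding b_r coeff[OF that] by (simp add: c_def)
  \<comment> \<open>The coordinates, in the basis \<open>q\<close>, of the image of \<open>r\<close> under \<open>Kt\<inverse> K\<close> minus \<open>lam n\<close> times \<open>r\<close>.\<close>
  define e where "e k = lam n * c k + (\<Sum>i<n. T i n * C i k) - c k * lam k" for k
  have a_r': "?a x r = lam n * ?b x r + (\<Sum>k<n. e k * ?b x (q k))" for x
  proof -
    have "(\<Sum>i<n. T i n * ?b x (p i)) = (\<Sum>i<n. \<Sum>k<n. T i n * C i k * ?b x (q k))"
      using C by (intro sum.cong) (simp_all add: mat_form_sum_right sum_distrib_left mult.assoc)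
    also have "\<dots> = (\<Sum>k<n. \<Sum>i<n. T i n * C i k * ?b x (q k))"
      by (rule sum.swap)
    finally have "?a x (p n) = lam n * ?b x (p n) + (\<Sum>k<n. (\<Sum>i<n. T i n * C i k) * ?b x (q k))"
      using tri[OF n, of x] by (simp add: sum_distrib_right)
    moreover have "(\<Sum>j<n. c j * ?a x (q j)) = (\<Sum>j<n. c j * lam j * ?b x (q j))"
      using eig by (intro sum.cong) auto
    ultimately show ?thesis
      unfolding a_r b_r e_def
      by (simp add: sum_subtractf sum.distrib sum_distrib_left algebra_simps)
  qed
  have "e k = 0" if "k < n" for k
  proof -
    have "?a (q k) r = lam k * ?b r (q k)"
      using mat_form_commute[OF sym(1)] eig[OF that] by simp
    also have "\<dots> = 0" using orth_r[OF that] mat_form_commute[OF sym(2)] by simp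
    finally have "e k * ?b (q k) (q k) = 0"
      unfolding a_r' coeff[OF that] using orth_r[OF that] by simp
    then show ?thesis using q_pos[OF that] by simp
  qed
  then have eig_r: "?a x r = lam n * ?b x r" for x
    unfolding a_r' by simp

  define C' where "C' j = (if j = n then c else C j)" for j
  \<comment> \<open>If \<open>r\<close> were zero, the \<open>n + 1\<close> vectors \<open>p 0, \<dots>, p n\<close> would lie in the span of \<open>n\<close> vectors.\<close>
  have "\<exists>i<N. r i \<noteq> 0"
  proof (rule ccontr)
    assume "\<not> (\<exists>i<N. r i \<noteq> 0)"
    then have p_C': "p j i = (\<Sum>k<n. C' j k * q k i)" if "j \<le> n" "i < N" for j i
      using that C[of j] by (cases "j = n") (auto simp: C'_def r_def)
    obtain a where a: "\<exists>j\<in>{..n}. a j \<noteq> 0" "\<forall>k\<in>{..<n}. (\<Sum>j\<in>{..n}. a j * C' j k) = 0"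
      using underdetermined_system_nontrivial[of "{..<n}" "{..n}" "\<lambda>k j. C' j k"] by auto
    define a' where "a' j = (if j \<le> n then a j else 0)" for j
    have "(\<Sum>j<N. a' j * p j i) = 0" if "i < N" for i
    proof -
      have "(\<Sum>j<N. a' j * p j i) = (\<Sum>j\<in>{..n}. a j * p j i)"
        using n by (intro sum.mono_neutral_cong_right) (auto simp: a'_def)
      also have "\<dots> = (\<Sum>j\<in>{..n}. \<Sum>k<n. a j * C' j k * q k i)"
        using p_C' that by (intro sum.cong) (auto simp: sum_distrib_left mult.assoc)
      also have "\<dots> = (\<Sum>k<n. (\<Sum>j\<in>{..n}. a j * C' j k) * q k i)"
        by (subst sum.swap) (simp add: sum_distrib_right)
      also have "\<dots> = 0" using a(2) by simp
      finally show ?thesis .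
    qed
    then have "\<forall>j<N. a' j = 0" by (rule indep)
    moreover obtain j where "j \<le> n" "a j \<noteq> 0" using a(1) by auto
    ultimately show False using n by (metis a'_def le_less_trans)
  qed
  then have r_pos: "0 < ?b r r" using pos by (simp add: pos_def_mat_def)

  define q' where "q' = q(n := r)"
  define C'' where "C'' j k = (if k = n then (if j = n then 1 else 0) else C' j k)" for j k
  have "p j = (\<lambda>i. \<Sum>k<Suc n. C'' j k * q' k i)" if "j < Suc n" for j
  proof
    fix i
    have "(\<Sum>k<n. C'' j k * q' k i) = (\<Sum>k<n. C' j k * q k i)"
      by (intro sum.cong) (auto simp: C''_def q'_def)
    then show "p j i = (\<Sum>k<Suc n. C'' j k * q' k i)"
      using that C[of j] by (cases "j = n") (auto simp: C''_def q'_def r_def C'_def)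
  qed
  moreover have "\<forall>j<Suc n. \<forall>x. ?a x (q' j) = lam j * ?b x (q' j)"
    using eig eig_r by (auto simp: q'_def less_Suc_eq)
  moreover have "\<forall>j<Suc n. \<forall>k<Suc n. j \<noteq> k \<longrightarrow> ?b (q' j) (q' k) = 0"
    using orth orth_r mat_form_commute[OF sym(2), of r] by (auto simp: q'_def less_Suc_eq)
  moreover have "\<forall>j<Suc n. 0 < ?b (q' j) (q' j)"
    using q_pos r_pos by (auto simp: q'_def less_Suc_eq)
  ultimately show ?case by blast
qed

lemma index_mult_mat_sum:
  assumes "A \<in> carrier_mat n n" "B \<in> carrier_mat n n" "i < n" "j < n"
  shows "(A * B) $$ (i, j) = (\<Sum>k<n. A $$ (i, k) * B $$ (k, j))"
  using assms by (auto simp: scalar_prod_def atLeast0LessThan intro!: sum.cong)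

lemma pos_def_mat_inverse:
  assumes M: "M \<in> carrier_mat N N" "pos_def_mat N M"
  obtains M' where "mat_inverse M = Some M'" "M * M' = 1\<^sub>m N" "M' \<in> carrier_mat N N"
proof -
  have "Determinant.det M \<noteq> 0"
  proof
    assume "Determinant.det M = 0"
    then obtain v where v: "v \<in> carrier_vec N" "v \<noteq> 0\<^sub>v N" "M *\<^sub>v v = 0\<^sub>v N"
      using det_0_iff_vec_prod_zero_field[OF M(1)] by blast
    have "(\<Sum>j<N. M $$ (i, j) * v $ j) = 0" if "i < N" for i
    proof -
      have "(M *\<^sub>v v) $ i = (\<Sum>j<N. M $$ (i, j) * v $ j)"
        using M(1) v(1) that by (auto simp: scalar_prod_def atLeast0LessThan intro!: sum.cong)
      then show ?thesis using v(3) that by simp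
    qed
    then have "mat_form N M (\<lambda>i. v $ i) (\<lambda>i. v $ i) = 0" by (simp add: mat_form_def)
    moreover have "\<exists>i<N. v $ i \<noteq> 0"
      using v(1,2) by (metis carrier_vecD eq_vecI index_zero_vec)
    ultimately show False using M(2) unfolding pos_def_mat_def by (metis less_irrefl)
  qed
  then have "M \<in> Units (ring_mat TYPE(real) N ())"
    by (rule det_non_zero_imp_unit[OF M(1)])
  then obtain M' where "mat_inverse M = Some M'"
    using mat_inverse(1)[OF M(1)] by fastforce
  then show ?thesis using mat_inverse(2)[OF M(1)] that by blast
qed

text \<open>The span of \<open>card J\<close> eigenvectors meets nontrivially every coordinate subspace of dimension larger than
  \<open>N - card J\<close>. On a common vector the two forms are sums over \<open>J\<close> with the same nonnegative
  weights, with and without the eigenvalues.\<close>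

lemma pencil_eigenvalues_coordinate_subspace:
  assumes K: "K \<in> carrier_mat N N" "sym_mat N K"
    and Kt: "Kt \<in> carrier_mat N N" "sym_mat N Kt" "pos_def_mat N Kt"
    and char: "char_poly (the (mat_inverse Kt) * K) = (\<Prod>k<N. [:- lam k, 1:])"
    and SJ: "S \<subseteq> {..<N}" "J \<subseteq> {..<N}" "N < card S + card J"
  obtains x w where "\<exists>i<N. x i \<noteq> 0" "\<And>i. i < N \<Longrightarrow> i \<notin> S \<Longrightarrow> x i = 0" "\<And>j. 0 \<le> w j"
    "mat_form N K x x = (\<Sum>j\<in>J. w j * lam j)" "mat_form N Kt x x = (\<Sum>j\<in>J. w j)"
proof -
  obtain Kt' where Kt': "mat_inverse Kt = Some Kt'" "Kt * Kt' = 1\<^sub>m N" "Kt' \<in> carrier_mat N N"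
    using pos_def_mat_inverse[OF Kt(1,3)] .
  define M where "M = Kt' * K"
  have M: "M \<in> carrier_mat N N" using Kt'(3) K(1) by (simp add: M_def)
  define es where "es = map lam [0..<N]"
  have "char_poly M = (\<Prod>e\<leftarrow>es. [:- e, 1:])"
    using char prod.distinct_set_conv_list[of "[0..<N]" "\<lambda>k. [:- lam k, 1:]"]
    by (simp add: M_def Kt'(1) es_def o_def atLeast0LessThan)
  then obtain T P Q where "similar_mat_wit M T P Q" "upper_triangular T" "diag_mat T = es"
    using schur_decomposition[OF M] by (metis prod_cases3)
  then have T: "T \<in> carrier_mat N N" "P \<in> carrier_mat N N" "Q \<in> carrier_mat N N"
      "Q * P = 1\<^sub>m N" "M = P * T * Q" "upper_triangular T" "diag_mat T = es"
    using M by (auto simp: similar_mat_wit_def Let_def)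
  have "M * P = P * T * (Q * P)"
    using T by (simp add: assoc_mult_mat[of _ N N _ N _ N])
  then have MP: "M * P = P * T" using T by simp
  have "K * P = (Kt * Kt') * (K * P)" using K(1) T(2) Kt'(2) by simp
  also have "\<dots> = Kt * (M * P)"
    unfolding M_def using K(1) T(2) Kt(1) Kt'(3) by (simp add: assoc_mult_mat[of _ N N _ N _ N])
  also have "\<dots> = (Kt * P) * T"
    unfolding MP using T(1,2) Kt(1) by (simp add: assoc_mult_mat[of _ N N _ N _ N])
  finally have KP: "K * P = (Kt * P) * T" .
  define p where "p j i = P $$ (i, j)" for i j :: nat
  have diag: "T $$ (j, j) = lam j" if "j < N" for j
  proof -
    have "diag_mat T ! j = T $$ (j, j)" using T(1) that by (simp add: diag_mat_def)
    then show ?thesis using T(7) that by (simp add: es_def)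
  qed
  have tri: "mat_form N K x (p j) =
      lam j * mat_form N Kt x (p j) + (\<Sum>i<j. T $$ (i, j) * mat_form N Kt x (p i))" if "j < N" for x j
  proof -
    have "mat_form N K x (p j) = (\<Sum>m<N. x m * (K * P) $$ (m, j))"
      using that K(1) T(2) by (simp add: mat_form_def p_def index_mult_mat_sum del: index_mult_mat(1))
    also have "\<dots> = (\<Sum>m<N. x m * (\<Sum>i<N. (Kt * P) $$ (m, i) * T $$ (i, j)))"
    proof (intro sum.cong refl)
      fix m assume "m \<in> {..<N}"
      then show "x m * (K * P) $$ (m, j) = x m * (\<Sum>i<N. (Kt * P) $$ (m, i) * T $$ (i, j))"
        unfolding KP using index_mult_mat_sum[OF mult_carrier_mat[OF Kt(1) T(2)] T(1) _ that, of m] by (simp only: lessThan_iff)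
    qed
    also have "\<dots> = (\<Sum>i<N. T $$ (i, j) * mat_form N Kt x (p i))"
      using Kt(1) T(2)
      by (simp add: mat_form_def p_def index_mult_mat_sum sum_distrib_left sum_distrib_right mult_ac
            del: index_mult_mat(1))
         (rule sum.swap)
    also have "\<dots> = (\<Sum>i<Suc j. T $$ (i, j) * mat_form N Kt x (p i))"
      using that T(1,6) by (intro sum.mono_neutral_right) (auto simp: upper_triangular_def)
    finally show ?thesis using diag[OF that] by simp
  qed
  have indep: "\<forall>j<N. a j = 0" if a: "\<And>i. i < N \<Longrightarrow> (\<Sum>j<N. a j * p j i) = 0" for a
  proof (intro allI impI)
    fix k assume k: "k < N"
    have "a k = (\<Sum>j<N. (1\<^sub>m N) $$ (k, j) * a j)"
      using k by (simp add: if_distrib[of "\<lambda>x. x * _"] cong: if_cong)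
    also have "\<dots> = (\<Sum>j<N. (\<Sum>i<N. Q $$ (k, i) * P $$ (i, j)) * a j)"
      unfolding T(4)[symmetric] using T(2,3) k by (simp add: index_mult_mat_sum del: index_mult_mat(1))
    also have "\<dots> = (\<Sum>i<N. Q $$ (k, i) * (\<Sum>j<N. a j * p j i))"
      by (simp add: sum_distrib_left sum_distrib_right p_def) (subst sum.swap, simp add: mult_ac)
    also have "\<dots> = 0" using a by simp
    finally show "a k = 0" .
  qed
  obtain q where q: "\<And>j x. j < N \<Longrightarrow> mat_form N K x (q j) = lam j * mat_form N Kt x (q j)"
      "\<And>j k. j < N \<Longrightarrow> k < N \<Longrightarrow> j \<noteq> k \<Longrightarrow> mat_form N Kt (q j) (q k) = 0"
      "\<And>j. j < N \<Longrightarrow> 0 < mat_form N Kt (q j) (q j)"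
    using triangular_imp_orthogonal_eigenvectors[OF K(2) Kt(2,3) indep tri order_refl] by metis
  \<comment> \<open>A combination of the eigenvectors in \<open>J\<close> vanishes outside \<open>S\<close> if it solves \<open>N - card S\<close> equations
    in \<open>card J\<close> unknowns.\<close>
  have fin: "finite S" "finite J" using SJ finite_subset by auto
  have "card ({..<N} - S) < card J"
    using SJ fin card_mono[of "{..<N}" S] by (simp add: card_Diff_subset)
  then obtain a where a: "\<exists>j\<in>J. a j \<noteq> 0" "\<forall>i\<in>{..<N} - S. (\<Sum>j\<in>J. a j * q j i) = 0"
    using underdetermined_system_nontrivial[of "{..<N} - S" J "\<lambda>i j. q j i"] fin by auto
  define x where "x i = (\<Sum>j\<in>J. a j * q j i)" for i
  define w where "w j = (if j \<in> J then (a j)\<^sup>2 * mat_form N Kt (q j) (q j) else 0)" for j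
  have w_nonneg: "0 \<le> w j" for j
    using q(3)[of j] SJ(2) by (auto simp: w_def intro: less_imp_le)
  have Kt_q: "mat_form N Kt x (q j) = a j * mat_form N Kt (q j) (q j)" if "j \<in> J" for j
  proof -
    have "mat_form N Kt x (q j) = (\<Sum>k\<in>J. a k * mat_form N Kt (q k) (q j))"
      unfolding x_def[abs_def] by (rule mat_form_sum_left)
    also have "\<dots> = (\<Sum>k\<in>J. if k = j then a j * mat_form N Kt (q j) (q j) else 0)"
      using q(2) SJ(2) that by (intro sum.cong) (auto dest: subsetD)
    finally show ?thesis using that fin by simp
  qed
  have Kt_x: "mat_form N Kt x x = (\<Sum>j\<in>J. w j)"
  proof -
    have "mat_form N Kt x x = (\<Sum>j\<in>J. a j * mat_form N Kt x (q j))"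
      by (subst (2) x_def[abs_def]) (rule mat_form_sum_right)
    then show ?thesis using Kt_q by (simp add: w_def power2_eq_square mult.assoc)
  qed
  have K_x: "mat_form N K x x = (\<Sum>j\<in>J. w j * lam j)"
  proof -
    have "mat_form N K x x = (\<Sum>j\<in>J. a j * mat_form N K x (q j))"
      by (subst (2) x_def[abs_def]) (rule mat_form_sum_right)
    also have "\<dots> = (\<Sum>j\<in>J. w j * lam j)"
      using Kt_q q(1) SJ(2) by (intro sum.cong) (auto simp: w_def power2_eq_square dest: subsetD)
    finally show ?thesis .
  qed
  have "0 < (\<Sum>j\<in>J. w j)"
  proof -
    obtain j where j: "j \<in> J" "a j \<noteq> 0" using a(1) by blast
    then have "0 < w j" using q(3)[of j] SJ(2) by (auto simp: w_def)
    then show ?thesis using j fin w_nonneg by (intro sum_pos2) auto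
  qed
  then have "mat_form N Kt x x \<noteq> 0" by (simp add: Kt_x)
  moreover have "mat_form N Kt x x = 0" if "\<not> (\<exists>i<N. x i \<noteq> 0)"
    using that by (simp add: mat_form_def)
  ultimately have "\<exists>i<N. x i \<noteq> 0" by blast
  then show ?thesis
    using that[of x w] a(2) w_nonneg Kt_x K_x by (auto simp: x_def)
qed

text \<open>One direction of the Courant-Fischer principle: \<open>\<sigma> = 1\<close> bounds some eigenvalue with index in \<open>J\<close>
  from below, \<open>\<sigma> = - 1\<close> from above. Otherwise the weighted sum over \<open>J\<close> would be negative.\<close>

lemma pencil_eigenvalue_bound:
  assumes "K \<in> carrier_mat N N" "sym_mat N K"
    and "Kt \<in> carrier_mat N N" "sym_mat N Kt" and pos: "pos_def_mat N Kt"
    and "char_poly (the (mat_inverse Kt) * K) = (\<Prod>k<N. [:- lam k, 1:])"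
    and "S \<subseteq> {..<N}" "J \<subseteq> {..<N}" "N < card S + card J"
    and form: "\<And>x. (\<And>i. i < N \<Longrightarrow> i \<notin> S \<Longrightarrow> x i = 0) \<Longrightarrow>
      0 \<le> \<sigma> * (mat_form N K x x - \<mu> * mat_form N Kt x x)"
  shows "\<exists>j\<in>J. 0 \<le> \<sigma> * (lam j - \<mu>)"
proof (rule ccontr)
  assume "\<not> (\<exists>j\<in>J. 0 \<le> \<sigma> * (lam j - \<mu>))"
  then have neg: "\<sigma> * (lam j - \<mu>) < 0" if "j \<in> J" for j using that by force
  obtain x w where x: "\<exists>i<N. x i \<noteq> 0" "\<And>i. i < N \<Longrightarrow> i \<notin> S \<Longrightarrow> x i = 0"
    and w: "\<And>j. 0 \<le> w j" "mat_form N K x x = (\<Sum>j\<in>J. w j * lam j)" "mat_form N Kt x x = (\<Sum>j\<in>J. w j)"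
    by (rule pencil_eigenvalues_coordinate_subspace[OF assms(1-9)]) (rule that)
  have fin: "finite J" using assms(8) finite_subset by auto
  have "0 < (\<Sum>j\<in>J. w j)" using pos x(1) w(3) unfolding pos_def_mat_def by metis
  then obtain j where j: "j \<in> J" "0 < w j" using w(1) by (meson not_less sum_nonpos)
  have "0 \<le> \<sigma> * (mat_form N K x x - \<mu> * mat_form N Kt x x)" by (rule form[OF x(2)])
  also have "\<dots> = (\<Sum>j\<in>J. w j * (\<sigma> * (lam j - \<mu>)))"
    unfolding w by (simp add: sum_distrib_left sum_subtractf algebra_simps)
  also have "\<dots> < 0"
  proof -
    have "(\<Sum>j\<in>J. w j * (\<sigma> * (lam j - \<mu>))) < (\<Sum>j\<in>J. 0)"
    proof (rule sum_strict_mono_ex1[OF fin])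
      show "\<forall>j\<in>J. w j * (\<sigma> * (lam j - \<mu>)) \<le> 0"
        by (intro ballI) (rule mult_nonneg_nonpos[OF w(1) less_imp_le[OF neg]])
      show "\<exists>j\<in>J. w j * (\<sigma> * (lam j - \<mu>)) < 0"
        using mult_pos_neg[OF j(2) neg[OF j(1)]] j(1) by blast
    qed
    then show ?thesis by simp
  qed
  finally show False by simp
qed

section \<open>Stiffness forms as integrals\<close>

lemma L2_scaleR: "L2 M f \<Longrightarrow> L2 M (\<lambda>x. c *\<^sub>R f x)"
  for f :: "'a \<Rightarrow> 'b::{banach, second_countable_topology}"
  by (auto simp: L2_def power_mult_distrib)

lemma L2_add:
  fixes f g :: "'a \<Rightarrow> 'b::{banach, second_countable_topology}"
  assumes "L2 M f" "L2 M g"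
  shows "L2 M (\<lambda>x. f x + g x)"
proof -
  have meas: "(\<lambda>x. f x + g x) \<in> borel_measurable M" using assms by (auto simp: L2_def)
  have "integrable M (\<lambda>x. (norm (f x + g x))\<^sup>2)"
  proof (rule Bochner_Integration.integrable_bound)
    show "integrable M (\<lambda>x. 2 * (norm (f x))\<^sup>2 + 2 * (norm (g x))\<^sup>2)"
      using assms by (auto simp: L2_def)
    have "(norm (a + b))\<^sup>2 \<le> 2 * (norm a)\<^sup>2 + 2 * (norm b)\<^sup>2" for a b :: 'b
    proof -
      have "(norm (a + b))\<^sup>2 \<le> (norm a + norm b)\<^sup>2" by (intro power_mono norm_triangle_ineq) auto
      then show ?thesis using sum_squares_bound[of "norm a" "norm b"] by (simp add: power2_sum)
    qed
    then show "AE x in M. norm ((norm (f x + g x))\<^sup>2) \<le> norm (2 * (norm (f x))\<^sup>2 + 2 * (norm (g x))\<^sup>2)"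
      by auto
  qed (use meas in auto)
  with meas show ?thesis by (simp add: L2_def)
qed

lemma test_function_bounded:
  assumes "continuous_on UNIV f" "compact C" "\<And>x. x \<notin> C \<Longrightarrow> f x = (0::real)"
  shows "\<exists>B. \<forall>x. \<bar>f x\<bar> \<le> B"
proof -
  have "bounded (f ` C)"
    using assms by (intro compact_imp_bounded compact_continuous_image) (auto intro: continuous_on_subset)
  then obtain B where "\<And>x. x \<in> C \<Longrightarrow> \<bar>f x\<bar> \<le> B" by (auto simp: bounded_iff)
  then have "\<bar>f x\<bar> \<le> max B 0" for x using assms(3)[of x] by (cases "x \<in> C") fastforce+
  then show ?thesis by blast
qed

text \<open>Test functions and their derivatives are bounded, which makes the integrals in the definition of
  the weak gradient additive.\<close>

lemma integrable_times_continuous_compact_support: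
  fixes w f :: "'a::euclidean_space \<Rightarrow> real"
  assumes "integrable (lebesgue_on \<Omega>) w" "continuous_on UNIV f" "compact C" "\<And>x. x \<notin> C \<Longrightarrow> f x = 0"
  shows "integrable (lebesgue_on \<Omega>) (\<lambda>x. w x * f x)"
proof -
  obtain B where B: "\<bar>f x\<bar> \<le> B" for x using test_function_bounded[OF assms(2-4)] by blast
  have f: "f \<in> borel_measurable (lebesgue_on \<Omega>)"
    using assms(2) by (intro measurable_restrict_space1 measurable_completion) (simp add: borel_measurable_continuous_onI)
  show ?thesis
  proof (rule Bochner_Integration.integrable_bound)
    show "integrable (lebesgue_on \<Omega>) (\<lambda>x. B * w x)" using assms(1) by simp
    show "AE x in lebesgue_on \<Omega>. norm (w x * f x) \<le> norm (B * w x)"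
    proof (intro AE_I2)
      fix x
      have "\<bar>f x\<bar> \<le> \<bar>B\<bar>" using B[of x] by linarith
      then show "norm (w x * f x) \<le> norm (B * w x)"
        by (simp add: abs_mult mult.commute mult_right_mono)
    qed
  qed (use assms(1) f in \<open>auto intro!: borel_measurable_times\<close>)
qed

lemma H1_gradient_integrable:
  assumes "H1_gradient \<Omega> v G" "\<Omega> \<in> lmeasurable" "test_function \<Omega> \<psi>" "b \<in> Basis"
  shows "integrable (lebesgue_on \<Omega>) (\<lambda>x. v x * frechet_derivative \<psi> (at x) b)"
    "integrable (lebesgue_on \<Omega>) (\<lambda>x. G x \<bullet> b * \<psi> x)"
proof -
  have v: "integrable (lebesgue_on \<Omega>) v" and G: "integrable (lebesgue_on \<Omega>) G"
    using assms(1,2) by (auto simp: H1_gradient_def intro: L2_integrable)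
  define C where "C = closure {x. \<psi> x \<noteq> 0}"
  have C: "compact C" "test_function C \<psi>" using assms(3) by (auto simp: test_function_def C_def)
  have smooth: "continuously_diff n \<psi>" for n using assms(3) by (simp add: test_function_def)
  have "continuous_on UNIV (\<lambda>x. frechet_derivative \<psi> (at x) b)"
    using smooth[of "Suc 0"] assms(4) by simp
  then show "integrable (lebesgue_on \<Omega>) (\<lambda>x. v x * frechet_derivative \<psi> (at x) b)"
    using frechet_derivative_test_function_outside[OF C(2)] 
    by (intro integrable_times_continuous_compact_support[OF v _ C(1)]) auto
  have "\<psi> x = 0" if "x \<notin> C" for x
    using that closure_subset[of "{x. \<psi> x \<noteq> 0}"] by (auto simp: C_def)
  then show "integrable (lebesgue_on \<Omega>) (\<lambda>x. G x \<bullet> b * \<psi> x)"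
    using G smooth[of 0] by (intro integrable_times_continuous_compact_support[OF _ _ C(1)]) auto
qed

lemma H1_gradient_sum:
  assumes "finite I" and "\<And>k. k \<in> I \<Longrightarrow> H1_gradient \<Omega> (v k) (G k)" and \<Omega>: "\<Omega> \<in> lmeasurable"
  shows "H1_gradient (\<Omega> :: 'a::euclidean_space set) (\<lambda>x. \<Sum>k\<in>I. c k * v k x) (\<lambda>x. \<Sum>k\<in>I. c k *\<^sub>R G k x)"
  using assms(1,2)
proof (induction I rule: finite_induct)
  case empty
  then show ?case by (simp add: H1_gradient_def L2_def)
next
  case (insert k I)
  let ?v = "\<lambda>x. \<Sum>k\<in>I. c k * v k x" and ?G = "\<lambda>x. \<Sum>k\<in>I. c k *\<^sub>R G k x"
  have k: "H1_gradient \<Omega> (v k) (G k)" and I: "H1_gradient \<Omega> ?v ?G" using insert by auto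
  have "H1_gradient \<Omega> (\<lambda>x. c k * v k x + ?v x) (\<lambda>x. c k *\<^sub>R G k x + ?G x)"
    unfolding H1_gradient_def
  proof (intro conjI allI impI ballI)
    show "L2 (lebesgue_on \<Omega>) (\<lambda>x. c k * v k x + ?v x)"
      using k I L2_scaleR[of _ "v k" "c k"] by (auto simp: H1_gradient_def intro!: L2_add)
    show "L2 (lebesgue_on \<Omega>) (\<lambda>x. c k *\<^sub>R G k x + ?G x)"
      using k I by (auto simp: H1_gradient_def intro!: L2_add L2_scaleR)
    fix \<psi> and b :: 'a assume \<psi>: "test_function \<Omega> \<psi>" and b: "b \<in> Basis"
    note int = H1_gradient_integrable[OF k \<Omega> \<psi> b] H1_gradient_integrable[OF I \<Omega> \<psi> b]
    have "(LINT x|lebesgue_on \<Omega>. (c k * v k x + ?v x) * frechet_derivative \<psi> (at x) b)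
        = (LINT x|lebesgue_on \<Omega>. c k * (v k x * frechet_derivative \<psi> (at x) b) + ?v x * frechet_derivative \<psi> (at x) b)"
      by (simp add: algebra_simps)
    also have "\<dots> = c k * (LINT x|lebesgue_on \<Omega>. v k x * frechet_derivative \<psi> (at x) b) +
        (LINT x|lebesgue_on \<Omega>. ?v x * frechet_derivative \<psi> (at x) b)"
      using int by (subst Bochner_Integration.integral_add) auto
    also have "\<dots> = - (c k * (LINT x|lebesgue_on \<Omega>. G k x \<bullet> b * \<psi> x) + (LINT x|lebesgue_on \<Omega>. ?G x \<bullet> b * \<psi> x))"
      using k I \<psi> b by (simp add: H1_gradient_def)
    also have "\<dots> = - (LINT x|lebesgue_on \<Omega>. c k * (G k x \<bullet> b * \<psi> x) + ?G x \<bullet> b * \<psi> x)"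
      using int by (subst Bochner_Integration.integral_add) auto
    also have "(\<lambda>x. c k * (G k x \<bullet> b * \<psi> x) + ?G x \<bullet> b * \<psi> x) = (\<lambda>x. (c k *\<^sub>R G k x + ?G x) \<bullet> b * \<psi> x)"
      by (auto simp: algebra_simps inner_add_left)
    finally show "(LINT x|lebesgue_on \<Omega>. (c k * v k x + ?v x) * frechet_derivative \<psi> (at x) b)
        = - (LINT x|lebesgue_on \<Omega>. (c k *\<^sub>R G k x + ?G x) \<bullet> b * \<psi> x)" .
  qed
  then show ?case using insert.hyps by simp
qed

text \<open>Positivity of \<open>A x\<close> on \<open>G x + H x\<close> and \<open>G x - H x\<close> bounds the mixed term by the two
  diagonal ones.\<close>

lemma diffusion_form_integrable:
  fixes A :: "real^'d \<Rightarrow> real^'d^'d"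
  assumes A: "diffusion_tensor \<Omega> A" and GH: "L2 (lebesgue_on \<Omega>) G" "L2 (lebesgue_on \<Omega>) H"
  shows "integrable (lebesgue_on \<Omega>) (\<lambda>x. G x \<bullet> (A x *v H x))"
proof -
  obtain c C where cC: "0 < c" "\<And>x v. x \<in> \<Omega> \<Longrightarrow> c * (norm v)\<^sup>2 \<le> (A x *v v) \<bullet> v"
      "\<And>x v. x \<in> \<Omega> \<Longrightarrow> (A x *v v) \<bullet> v \<le> C * (norm v)\<^sup>2"
    and sym: "\<And>x. x \<in> \<Omega> \<Longrightarrow> transpose (A x) = A x"
    using A unfolding diffusion_tensor_def by blast
  show ?thesis
  proof (rule Bochner_Integration.integrable_bound)
    show "integrable (lebesgue_on \<Omega>) (\<lambda>x. C * (norm (G x))\<^sup>2 + C * (norm (H x))\<^sup>2)"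
      using GH by (auto simp: L2_def)
    have meas: "A \<in> borel_measurable (lebesgue_on \<Omega>)" "G \<in> borel_measurable (lebesgue_on \<Omega>)"
        "H \<in> borel_measurable (lebesgue_on \<Omega>)"
      using A GH by (auto simp: diffusion_tensor_def Linf_def L2_def)
    have "(\<lambda>M :: real^'d^'d. vec_nth (vec_nth M i) j) \<in> borel_measurable borel" for i j
      by (intro borel_measurable_continuous_onI continuous_intros)
    then have A_ij: "(\<lambda>x. vec_nth (vec_nth (A x) i) j) \<in> borel_measurable (lebesgue_on \<Omega>)" for i j
      using measurable_compose[OF meas(1)] by blast
    have "(\<lambda>v :: real^'d. vec_nth v i) \<in> borel_measurable borel" for i
      by (intro borel_measurable_continuous_onI continuous_intros)
    then have GH_i: "(\<lambda>x. vec_nth (G x) i) \<in> borel_measurable (lebesgue_on \<Omega>)"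
        "(\<lambda>x. vec_nth (H x) i) \<in> borel_measurable (lebesgue_on \<Omega>)" for i
      using measurable_compose[OF meas(2)] measurable_compose[OF meas(3)] by blast+
    show "(\<lambda>x. G x \<bullet> (A x *v H x)) \<in> borel_measurable (lebesgue_on \<Omega>)"
      unfolding inner_vec_def matrix_vector_mult_def
      using A_ij GH_i by (simp add: borel_measurable_sum borel_measurable_times)
    show "AE x in lebesgue_on \<Omega>. norm (G x \<bullet> (A x *v H x)) \<le> norm (C * (norm (G x))\<^sup>2 + C * (norm (H x))\<^sup>2)"
    proof (intro AE_I2)
      fix x assume "x \<in> space (lebesgue_on \<Omega>)"
      then have x: "x \<in> \<Omega>" by simp
      have nonneg: "0 \<le> (A x *v v) \<bullet> v" for v
        using cC(2)[OF x, of v] cC(1) by (smt (verit) mult_nonneg_nonneg zero_le_power2)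
      have comm: "(A x *v G x) \<bullet> H x = G x \<bullet> (A x *v H x)"
        by (rule transpose_inner_commute[OF sym[OF x]])
      have "2 * \<bar>G x \<bullet> (A x *v H x)\<bar> \<le> (A x *v G x) \<bullet> G x + (A x *v H x) \<bullet> H x"
        using nonneg[of "G x + H x"] nonneg[of "G x - H x"] comm
        by (simp add: matrix_vector_right_distrib matrix_vector_mult_diff_distrib
            inner_add_left inner_add_right inner_diff_left inner_diff_right inner_commute abs_le_iff)
      also have "\<dots> \<le> C * (norm (G x))\<^sup>2 + C * (norm (H x))\<^sup>2"
        using cC(3)[OF x] by (intro add_mono)
      finally show "norm (G x \<bullet> (A x *v H x)) \<le> norm (C * (norm (G x))\<^sup>2 + C * (norm (H x))\<^sup>2)"
        by simp
    qed
  qed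
qed

lemma borel_measurable_surface_continuous:
  fixes f :: "real^'d \<Rightarrow> real"
  assumes "continuous_on S f" "S \<in> sets borel" "\<Gamma> \<subseteq> S"
  shows "f \<in> borel_measurable (restrict_space surface \<Gamma>)"
proof -
  define f' where "f' x = (if x \<in> S then f x else 0)" for x
  have "f' \<in> borel_measurable borel"
    unfolding f'_def using assms by (intro borel_measurable_continuous_on_if) auto
  then have "f' \<in> borel_measurable surface"
    by (rule measurable_mono[THEN subsetD, rotated -1]) (auto intro: sets_surface_borel)
  then have "f' \<in> borel_measurable (restrict_space surface \<Gamma>)"
    by (rule measurable_restrict_space1)
  then show ?thesis
    by (rule measurable_cong[THEN iffD1, rotated]) (use assms(3) in \<open>auto simp: f'_def space_restrict_space\<close>)
qed

lemma boundary_form_integrable: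
  fixes g u v :: "real^'d \<Rightarrow> real"
  assumes g: "Linf (restrict_space surface \<Gamma>) g"
    and \<Gamma>: "\<Gamma> \<in> sets surface" "emeasure surface \<Gamma> < \<infinity>" "\<Gamma> \<subseteq> S" "compact S"
    and uv: "continuous_on S u" "continuous_on S v"
  shows "integrable (restrict_space surface \<Gamma>) (\<lambda>x. g x * u x * v x)"
proof -
  let ?M = "restrict_space surface \<Gamma>"
  obtain C where C: "AE x in ?M. norm (g x) \<le> C" and g_meas: "g \<in> borel_measurable ?M"
    using g by (auto simp: Linf_def)
  have S: "S \<in> sets borel" using \<Gamma>(4) by (simp add: borel_closed compact_imp_closed)
  have meas: "u \<in> borel_measurable ?M" "v \<in> borel_measurable ?M"
    using borel_measurable_surface_continuous[OF _ S \<Gamma>(3)] uv by auto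
  have "\<exists>B. \<forall>x\<in>S. \<bar>f x\<bar> \<le> B" if "continuous_on S f" for f :: "real^'d \<Rightarrow> real"
    using compact_imp_bounded[OF compact_continuous_image[OF that \<Gamma>(4)]] by (auto simp: bounded_iff)
  then obtain Bu Bv where B: "\<And>x. x \<in> S \<Longrightarrow> \<bar>u x\<bar> \<le> Bu" "\<And>x. x \<in> S \<Longrightarrow> \<bar>v x\<bar> \<le> Bv"
    using uv by meson
  show ?thesis
  proof (rule integrableI_bounded_set)
    show "space ?M \<in> sets ?M" by auto
    show "emeasure ?M (space ?M) < \<infinity>"
      using \<Gamma>(1,2) by (simp add: emeasure_restrict_space space_restrict_space)
    show "(\<lambda>x. g x * u x * v x) \<in> borel_measurable ?M" using g_meas meas by auto
    show "AE x\<in>space ?M in ?M. norm (g x * u x * v x) \<le> C * Bu * Bv"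
      using C
    proof eventually_elim
      case (elim x)
      show ?case
      proof
        assume "x \<in> space ?M"
        then have x: "x \<in> S" using \<Gamma>(3) by (auto simp: space_restrict_space)
        have "\<bar>g x\<bar> * \<bar>u x\<bar> * \<bar>v x\<bar> \<le> C * Bu * Bv"
          using elim B[OF x] by (intro mult_mono mult_nonneg_nonneg) (auto intro: order_trans[OF abs_ge_zero])
        then show "norm (g x * u x * v x) \<le> C * Bu * Bv" by (simp add: abs_mult)
      qed
    qed
  qed auto
qed

section \<open>Local bounds on the coefficients\<close>

text \<open>A function that is not measurable has essential infimum \<open>- \<infinity>\<close> and essential supremum \<open>\<infinity>\<close>, so
  the essential bounds hold almost everywhere for arbitrary functions.\<close>

lemma essinf_AE: "AE x in M. essinf M f \<le> f x"
  using esssup_AE[of "\<lambda>x. - f x" M]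
  by eventually_elim (simp add: essinf_def ereal_uminus_le_reorder)

lemma diffusion_tensor_symmetric_positive:
  assumes "diffusion_tensor \<Omega> A" "x \<in> \<Omega>"
  shows "transpose (A x) = A x" "v \<noteq> 0 \<Longrightarrow> 0 < (A x *v v) \<bullet> v" "0 \<le> (A x *v v) \<bullet> v"
proof -
  obtain c where c: "0 < c" "\<And>v. c * (norm v)\<^sup>2 \<le> (A x *v v) \<bullet> v"
    using assms by (auto simp: diffusion_tensor_def)
  show "transpose (A x) = A x" using assms by (auto simp: diffusion_tensor_def)
  show pos: "0 < (A x *v v) \<bullet> v" if "v \<noteq> 0" for v
    using c(2)[of v] c(1) that by (smt (verit) zero_less_norm_iff zero_less_power mult_pos_pos)
  show "0 \<le> (A x *v v) \<bullet> v"
    using pos[of v] by (cases "v = 0") auto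
qed

lemma alpha_min_volume:
  assumes tens: "diffusion_tensor \<Omega> A" "diffusion_tensor \<Omega> B" and "e \<subseteq> \<Omega>"
    and \<mu>: "ereal \<mu> \<le> alpha_min \<Gamma> A B g h e F"
  shows "AE x in lebesgue_on e. \<forall>w. 0 \<le> 1 * ((A x *v w) \<bullet> w - \<mu> * ((B x *v w) \<bullet> w))"
proof -
  let ?f = "\<lambda>x. ereal (eig_min (matrix_inv (B x) ** A x))"
  have le: "ereal \<mu> \<le> essinf (lebesgue_on e) ?f"
    using \<mu> by (auto simp: alpha_min_def Let_def split: if_splits)
  have "AE x in lebesgue_on e. ereal \<mu> \<le> ?f x"
    by (rule eventually_mono[OF essinf_AE[of "lebesgue_on e" ?f]]) (rule order_trans[OF le])
  then show ?thesis
    using AE_space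
  proof eventually_elim
    case (elim x)
    then have x: "x \<in> \<Omega>" "\<mu> \<le> eig_min (matrix_inv (B x) ** A x)" using \<open>e \<subseteq> \<Omega>\<close> by auto
    note A = diffusion_tensor_symmetric_positive[OF tens(1) x(1)]
    note B = diffusion_tensor_symmetric_positive[OF tens(2) x(1)]
    show ?case
    proof
      fix w
      have "\<mu> * ((B x *v w) \<bullet> w) \<le> eig_min (matrix_inv (B x) ** A x) * ((B x *v w) \<bullet> w)"
        using x(2) B(3) by (rule mult_right_mono)
      also have "\<dots> \<le> (A x *v w) \<bullet> w" by (rule eig_min_rayleigh[OF A(1) B(1,2)])
      finally show "0 \<le> 1 * ((A x *v w) \<bullet> w - \<mu> * ((B x *v w) \<bullet> w))" by simp
    qed
  qed
qed

lemma alpha_max_volume: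
  assumes tens: "diffusion_tensor \<Omega> A" "diffusion_tensor \<Omega> B" and "e \<subseteq> \<Omega>"
    and \<mu>: "alpha_max \<Gamma> A B g h e F \<le> ereal \<mu>"
  shows "AE x in lebesgue_on e. \<forall>w. 0 \<le> - 1 * ((A x *v w) \<bullet> w - \<mu> * ((B x *v w) \<bullet> w))"
proof -
  let ?f = "\<lambda>x. ereal (eig_max (matrix_inv (B x) ** A x))"
  have le: "esssup (lebesgue_on e) ?f \<le> ereal \<mu>"
    using \<mu> by (auto simp: alpha_max_def Let_def split: if_splits)
  have "AE x in lebesgue_on e. ?f x \<le> ereal \<mu>"
    by (rule eventually_mono[OF esssup_AE[of ?f "lebesgue_on e"]]) (rule order_trans[OF _ le])
  then show ?thesis
    using AE_space
  proof eventually_elim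
    case (elim x)
    then have x: "x \<in> \<Omega>" "eig_max (matrix_inv (B x) ** A x) \<le> \<mu>" using \<open>e \<subseteq> \<Omega>\<close> by auto
    note A = diffusion_tensor_symmetric_positive[OF tens(1) x(1)]
    note B = diffusion_tensor_symmetric_positive[OF tens(2) x(1)]
    show ?case
    proof
      fix w
      have "(A x *v w) \<bullet> w \<le> eig_max (matrix_inv (B x) ** A x) * ((B x *v w) \<bullet> w)"
        by (rule eig_max_rayleigh[OF A(1) B(1,2)])
      also have "\<dots> \<le> \<mu> * ((B x *v w) \<bullet> w)"
        using x(2) B(3) by (rule mult_right_mono)
      finally show "0 \<le> - 1 * ((A x *v w) \<bullet> w - \<mu> * ((B x *v w) \<bullet> w))" by simp
    qed
  qed
qed

lemma robin_set_measurable: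
  fixes \<Gamma> C :: "(real^'d) set"
  assumes "Linf (restrict_space surface \<Gamma>) g" "\<Gamma> \<in> sets surface" "closed C"
  shows "{x \<in> \<Gamma> \<inter> C. g x \<noteq> (0::real)} \<in> sets surface"
proof -
  have g: "g \<in> borel_measurable (restrict_space surface \<Gamma>)" using assms(1) by (simp add: Linf_def)
  have "{x \<in> space (restrict_space surface \<Gamma>). g x \<noteq> 0} \<in> sets (restrict_space surface \<Gamma>)"
    by (rule borel_measurable_neq[OF g borel_measurable_const])
  then have "{x \<in> \<Gamma>. g x \<noteq> 0} \<in> sets surface"
    using assms(2) by (simp add: sets_restrict_space_iff space_restrict_space)
  moreover have "C \<in> sets surface" using assms(3) by (intro sets_surface_borel borel_closed)
  ultimately have "{x \<in> \<Gamma>. g x \<noteq> 0} \<inter> C \<in> sets surface" by (rule sets.Int)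
  also have "{x \<in> \<Gamma>. g x \<noteq> 0} \<inter> C = {x \<in> \<Gamma> \<inter> C. g x \<noteq> 0}" by auto
  finally show ?thesis .
qed

context
  fixes \<Gamma> :: "(real^'d) set" and g h :: "real^'d \<Rightarrow> real" and e :: "(real^'d) set"
  assumes g: "Linf (restrict_space surface \<Gamma>) g" and \<Gamma>: "\<Gamma> \<in> sets surface"
    and h_nonneg: "\<And>x. x \<in> \<Gamma> \<Longrightarrow> 0 \<le> h x"
    and null_iff: "\<And>x. x \<in> \<Gamma> \<Longrightarrow> g x = 0 \<longleftrightarrow> h x = 0"
begin

text \<open>Where \<open>g\<close> vanishes, so does \<open>h\<close>, and the comparison of the Robin coefficients is trivial; elsewhere
  it is a bound on the quotient.\<close>

lemma alpha_min_robin: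
  assumes \<mu>: "ereal \<mu> \<le> alpha_min \<Gamma> A B g h e F" and "\<exists>f\<in>F. face_in f \<Gamma>"
  shows "AE x in surface. x \<in> \<Gamma> \<inter> closure e \<longrightarrow> 0 \<le> 1 * (g x - \<mu> * h x)"
proof -
  let ?R = "{x \<in> \<Gamma> \<inter> closure e. g x \<noteq> 0}" and ?f = "\<lambda>x. ereal (inverse (h x) * g x)"
  have le: "ereal \<mu> \<le> essinf (restrict_space surface ?R) ?f"
    using assms by (auto simp: alpha_min_def Let_def)
  have "AE x in restrict_space surface ?R. ereal \<mu> \<le> ?f x"
    by (rule eventually_mono[OF essinf_AE[of "restrict_space surface ?R" ?f]]) (rule order_trans[OF le])
  then have "AE x in surface. x \<in> ?R \<longrightarrow> ereal \<mu> \<le> ?f x"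
    using robin_set_measurable[OF g \<Gamma>, of "closure e"] by (subst (asm) AE_restrict_space_iff) auto
  then show ?thesis
  proof eventually_elim
    case (elim x)
    show ?case
    proof
      assume x: "x \<in> \<Gamma> \<inter> closure e"
      show "0 \<le> 1 * (g x - \<mu> * h x)"
      proof (cases "g x = 0")
        case True
        then show ?thesis using null_iff[of x] x by simp
      next
        case False
        then have "0 < h x" using null_iff[of x] h_nonneg[of x] x by force
        then show ?thesis using elim x False by (auto simp: field_simps)
      qed
    qed
  qed
qed

lemma alpha_max_robin:
  assumes \<mu>: "alpha_max \<Gamma> A B g h e F \<le> ereal \<mu>" and "\<exists>f\<in>F. face_in f \<Gamma>"
  shows "AE x in surface. x \<in> \<Gamma> \<inter> closure e \<longrightarrow> 0 \<le> - 1 * (g x - \<mu> * h x)"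
proof -
  let ?R = "{x \<in> \<Gamma> \<inter> closure e. g x \<noteq> 0}" and ?f = "\<lambda>x. ereal (inverse (h x) * g x)"
  have le: "esssup (restrict_space surface ?R) ?f \<le> ereal \<mu>"
    using assms by (auto simp: alpha_max_def Let_def)
  have "AE x in restrict_space surface ?R. ?f x \<le> ereal \<mu>"
    by (rule eventually_mono[OF esssup_AE[of ?f "restrict_space surface ?R"]]) (rule order_trans[OF _ le])
  then have "AE x in surface. x \<in> ?R \<longrightarrow> ?f x \<le> ereal \<mu>"
    using robin_set_measurable[OF g \<Gamma>, of "closure e"] by (subst (asm) AE_restrict_space_iff) auto
  then show ?thesis
  proof eventually_elim
    case (elim x)
    show ?case
    proof
      assume x: "x \<in> \<Gamma> \<inter> closure e"
      show "0 \<le> - 1 * (g x - \<mu> * h x)"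
      proof (cases "g x = 0")
        case True
        then show ?thesis using null_iff[of x] x by simp
      next
        case False
        then have "0 < h x" using null_iff[of x] h_nonneg[of x] x by force
        then show ?thesis using elim x False by (auto simp: field_simps)
      qed
    qed
  qed
qed

end

lemma lambda_L_le_alpha_min:
  assumes "j \<in> {1..Ne}" "E j \<subseteq> patch \<Omega> Ne E v"
  shows "lambda_L \<Omega> \<Gamma> A B g h Ne E F v \<le> alpha_min \<Gamma> A B g h (E j) (F j)"
  unfolding lambda_L_def using assms by (intro Min_le) auto

lemma alpha_max_le_lambda_U:
  assumes "j \<in> {1..Ne}" "E j \<subseteq> patch \<Omega> Ne E v"
  shows "alpha_max \<Gamma> A B g h (E j) (F j) \<le> lambda_U \<Omega> \<Gamma> A B g h Ne E F v"
  unfolding lambda_U_def using assms by (intro Max_ge) auto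

section \<open>Comparison of stiffness forms on a mesh\<close>

lemma integral_double_sum:
  fixes f :: "nat \<Rightarrow> nat \<Rightarrow> 'a \<Rightarrow> real"
  assumes f: "\<And>k l. k < N \<Longrightarrow> l < N \<Longrightarrow> integrable M (f k l)"
  shows "integrable M (\<lambda>x. \<Sum>k<N. \<Sum>l<N. c k * c l * f k l x)"
    and "(LINT x|M. (\<Sum>k<N. \<Sum>l<N. c k * c l * f k l x)) = (\<Sum>k<N. \<Sum>l<N. c k * c l * integral\<^sup>L M (f k l))"
proof -
  have int: "integrable M (\<lambda>x. c k * c l * f k l x)" if "k < N" "l < N" for k l
    using f[OF that] by simp
  have int': "integrable M (\<lambda>x. \<Sum>l<N. c k * c l * f k l x)" if "k < N" for k
    by (rule Bochner_Integration.integrable_sum, rule int[OF that]) simp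
  then show "integrable M (\<lambda>x. \<Sum>k<N. \<Sum>l<N. c k * c l * f k l x)"
    by (rule Bochner_Integration.integrable_sum) simp
  have "(LINT x|M. (\<Sum>k<N. \<Sum>l<N. c k * c l * f k l x))
      = (\<Sum>k<N. (LINT x|M. (\<Sum>l<N. c k * c l * f k l x)))"
    by (rule Bochner_Integration.integral_sum) (simp add: int')
  also have "\<dots> = (\<Sum>k<N. \<Sum>l<N. (LINT x|M. c k * c l * f k l x))"
    by (intro sum.cong refl Bochner_Integration.integral_sum int) auto
  finally show "(LINT x|M. (\<Sum>k<N. \<Sum>l<N. c k * c l * f k l x))
      = (\<Sum>k<N. \<Sum>l<N. c k * c l * integral\<^sup>L M (f k l))"
    by simp
qed

text \<open>The basis functions are \<open>\<phi> 1, \<dots>, \<phi> N\<close>, while vectors and matrices are indexed by \<open>{..<N}\<close>; hence the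
  shift in \<open>\<phi> (k + 1)\<close>.\<close>

locale finite_element_space =
  fixes \<Omega> \<Gamma>1 \<Gamma>2 :: "(real^'d) set"
    and Ne N :: nat
    and E :: "nat \<Rightarrow> (real^'d) set"
    and F :: "nat \<Rightarrow> (real^'d) set set"
    and \<phi> :: "nat \<Rightarrow> real^'d \<Rightarrow> real"
  assumes dim_ge_2: "CARD('d) \<ge> 2"
    and domain: "polyhedral_domain \<Omega>"
    and split: "frontier \<Omega> = \<Gamma>1 \<union> \<Gamma>2" "\<Gamma>1 \<inter> \<Gamma>2 = {}"
    and meas: "\<Gamma>1 \<in> sets surface" "\<Gamma>2 \<in> sets surface"
    and mesh: "mesh \<Omega> Ne E F"
    and faces: "\<forall>j\<in>{1..Ne}. \<forall>f\<in>F j. f \<subseteq> frontier \<Omega> \<longrightarrow> face_in f \<Gamma>1 \<or> face_in f \<Gamma>2"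
    and basis: "\<forall>k\<in>{1..N}. \<phi> k \<in> V_cont \<Omega> \<Gamma>1"
begin

lemma dom: "open \<Omega>" "connected \<Omega>" "bounded \<Omega>" "\<Omega> \<noteq> {}" "\<Omega> \<in> lmeasurable"
  using domain by (auto simp: polyhedral_domain_def intro: lmeasurable_open)

lemma element: 
  assumes "j \<in> {1..Ne}"
  shows "open (E j)" "E j \<subseteq> \<Omega>" "face_decomposition (E j) (F j)"
  using mesh assms by (auto simp: mesh_def polyhedral_domain_def)

lemma element_disjoint: "i \<in> {1..Ne} \<Longrightarrow> j \<in> {1..Ne} \<Longrightarrow> i \<noteq> j \<Longrightarrow> E i \<inter> E j = {}"
  using mesh by (simp add: mesh_def)

lemma closure_eq_elements: "closure \<Omega> = (\<Union>j\<in>{1..Ne}. closure (E j))"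
  using mesh by (simp add: mesh_def)

lemma face_on_boundary:
  "j \<in> {1..Ne} \<Longrightarrow> f \<in> F j \<Longrightarrow> f \<inter> frontier \<Omega> \<notin> null_sets surface \<Longrightarrow> f \<subseteq> frontier \<Omega>"
  using mesh[unfolded mesh_def, THEN conjunct2, THEN conjunct2, THEN conjunct2] by blast

lemma basis_function:
  assumes "k < N"
  shows "H1_gradient \<Omega> (\<phi> (k + 1)) (grad \<Omega> (\<phi> (k + 1)))" "continuous_on (closure \<Omega>) (\<phi> (k + 1))"
    "AE x in restrict_space surface \<Gamma>1. \<phi> (k + 1) x = 0"
proof -
  have V: "\<phi> (k + 1) \<in> V_cont \<Omega> \<Gamma>1" using basis assms by auto
  then have "\<exists>G. H1_gradient \<Omega> (\<phi> (k + 1)) G" by (simp add: V_cont_def H1_def)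
  then show "H1_gradient \<Omega> (\<phi> (k + 1)) (grad \<Omega> (\<phi> (k + 1)))"
    unfolding grad_def by (rule someI_ex)
  show "continuous_on (closure \<Omega>) (\<phi> (k + 1))" "AE x in restrict_space surface \<Gamma>1. \<phi> (k + 1) x = 0"
    using V by (simp_all add: V_cont_def)
qed

definition comb :: "(nat \<Rightarrow> real) \<Rightarrow> real^'d \<Rightarrow> real" where
  "comb c x = (\<Sum>k<N. c k * \<phi> (k + 1) x)"

definition grad_comb :: "(nat \<Rightarrow> real) \<Rightarrow> real^'d \<Rightarrow> real^'d" where
  "grad_comb c x = (\<Sum>k<N. c k *\<^sub>R grad \<Omega> (\<phi> (k + 1)) x)"

lemma H1_gradient_comb: "H1_gradient \<Omega> (comb c) (grad_comb c)"
  unfolding comb_def grad_comb_def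
  by (rule H1_gradient_sum[OF finite_lessThan _ dom(5)], rule basis_function(1)) simp

lemma continuous_on_comb: "continuous_on (closure \<Omega>) (comb c)"
  unfolding comb_def by (intro continuous_intros basis_function) auto

lemma \<Gamma>_subset: "\<Gamma>1 \<subseteq> closure \<Omega>" "\<Gamma>2 \<subseteq> closure \<Omega>"
  using split(1) by (auto simp: frontier_def)

lemma \<Gamma>2_finite: "emeasure surface \<Gamma>2 < \<infinity>"
proof -
  have "emeasure surface \<Gamma>2 \<le> emeasure surface (frontier \<Omega>)"
    by (rule emeasure_mono[OF _ sets_surface_borel[OF borel_closed[OF frontier_closed]]])
       (simp add: split(1))
  also have "\<dots> < \<infinity>" by (rule emeasure_surface_frontier_finite[OF dim_ge_2 domain])
  finally show ?thesis .
qed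

lemma stiffness_form:
  assumes A: "diffusion_tensor \<Omega> A" and g: "Linf (restrict_space surface \<Gamma>2) g"
  shows "mat_form N (stiffness \<Omega> \<Gamma>2 A g N \<phi>) c c =
      (LINT x|lebesgue_on \<Omega>. (A x *v grad_comb c x) \<bullet> grad_comb c x) +
      (LINT x|restrict_space surface \<Gamma>2. g x * (comb c x)\<^sup>2)" (is ?form)
    and "integrable (lebesgue_on \<Omega>) (\<lambda>x. (A x *v grad_comb c x) \<bullet> grad_comb c x)" (is ?vol)
    and "integrable (restrict_space surface \<Gamma>2) (\<lambda>x. g x * (comb c x)\<^sup>2)" (is ?bd)
proof -
  let ?G = "\<lambda>k. grad \<Omega> (\<phi> (k + 1))" and ?u = "\<lambda>k. \<phi> (k + 1)"
  let ?M = "restrict_space surface \<Gamma>2"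
  define a where "a k l x = ?G l x \<bullet> (A x *v ?G k x)" for k l x
  define b where "b k l x = g x * ?u l x * ?u k x" for k l x
  have a_int: "integrable (lebesgue_on \<Omega>) (a k l)" if "k < N" "l < N" for k l
    unfolding a_def using basis_function(1)[OF that(1)] basis_function(1)[OF that(2)]
    by (intro diffusion_form_integrable[OF A]) (auto simp: H1_gradient_def)
  have b_int: "integrable ?M (b k l)" if "k < N" "l < N" for k l
    unfolding b_def
    using dom(3) basis_function(2)[OF that(1)] basis_function(2)[OF that(2)]
    by (intro boundary_form_integrable[OF g meas(2) \<Gamma>2_finite \<Gamma>_subset(2)]) auto
  have a_sum: "(A x *v grad_comb c x) \<bullet> grad_comb c x = (\<Sum>k<N. \<Sum>l<N. c k * c l * a k l x)" for x
  proof -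
    have "A x *v grad_comb c x = (\<Sum>k<N. c k *\<^sub>R (A x *v ?G k x))"
      unfolding grad_comb_def linear_sum[OF matrix_vector_mul_linear] by (simp add: matrix_vector_mult_scaleR)
    then show ?thesis
      by (simp add: grad_comb_def a_def inner_sum_left inner_sum_right sum_distrib_left inner_commute mult.assoc)
  qed
  have b_sum: "g x * (comb c x)\<^sup>2 = (\<Sum>k<N. \<Sum>l<N. c k * c l * b k l x)" for x
    by (simp add: comb_def b_def power2_eq_square sum_product sum_distrib_left mult_ac)
  show ?vol unfolding a_sum by (rule integral_double_sum(1)[OF a_int])
  show ?bd unfolding b_sum by (rule integral_double_sum(1)[OF b_int])
  have vol_eq: "(LINT x|lebesgue_on \<Omega>. (A x *v grad_comb c x) \<bullet> grad_comb c x)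
      = (\<Sum>k<N. \<Sum>l<N. c k * c l * integral\<^sup>L (lebesgue_on \<Omega>) (a k l))"
    unfolding a_sum by (rule integral_double_sum(2)[OF a_int])
  have bd_eq: "(LINT x|?M. g x * (comb c x)\<^sup>2) = (\<Sum>k<N. \<Sum>l<N. c k * c l * integral\<^sup>L ?M (b k l))"
    unfolding b_sum by (rule integral_double_sum(2)[OF b_int])
  have entry: "stiffness \<Omega> \<Gamma>2 A g N \<phi> $$ (k, l) = integral\<^sup>L (lebesgue_on \<Omega>) (a k l) + integral\<^sup>L ?M (b k l)"
    if "k < N" "l < N" for k l
    using that by (simp add: stiffness_def a_def[abs_def] b_def[abs_def])
  have "mat_form N (stiffness \<Omega> \<Gamma>2 A g N \<phi>) c c
      = (\<Sum>k<N. \<Sum>l<N. c k * c l * stiffness \<Omega> \<Gamma>2 A g N \<phi> $$ (k, l))"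
    by (simp add: mat_form_def sum_distrib_left mult_ac)
  also have "\<dots> = (\<Sum>k<N. \<Sum>l<N. c k * c l * integral\<^sup>L (lebesgue_on \<Omega>) (a k l) + c k * c l * integral\<^sup>L ?M (b k l))"
    by (intro sum.cong refl) (simp add: entry distrib_left)
  also have "\<dots> = (\<Sum>k<N. \<Sum>l<N. c k * c l * integral\<^sup>L (lebesgue_on \<Omega>) (a k l)) +
      (\<Sum>k<N. \<Sum>l<N. c k * c l * integral\<^sup>L ?M (b k l))"
    by (simp add: sum.distrib)
  finally show ?form by (simp only: vol_eq bd_eq)
qed

lemma stiffness_carrier: "stiffness \<Omega> \<Gamma>2 A g N \<phi> \<in> carrier_mat N N"
  by (simp add: stiffness_def)

lemma stiffness_sym:
  assumes "diffusion_tensor \<Omega> A"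
  shows "sym_mat N (stiffness \<Omega> \<Gamma>2 A g N \<phi>)"
  unfolding sym_mat_def
proof (intro allI impI)
  fix k l assume kl: "k < N" "l < N"
  have "(LINT x|lebesgue_on \<Omega>. grad \<Omega> (\<phi> (l + 1)) x \<bullet> (A x *v grad \<Omega> (\<phi> (k + 1)) x))
      = (LINT x|lebesgue_on \<Omega>. grad \<Omega> (\<phi> (k + 1)) x \<bullet> (A x *v grad \<Omega> (\<phi> (l + 1)) x))"
    using transpose_inner_commute[OF diffusion_tensor_symmetric_positive(1)[OF assms]]
    by (intro Bochner_Integration.integral_cong) (auto simp: inner_commute)
  moreover have "(LINT x|restrict_space surface \<Gamma>2. g x * \<phi> (l + 1) x * \<phi> (k + 1) x)
      = (LINT x|restrict_space surface \<Gamma>2. g x * \<phi> (k + 1) x * \<phi> (l + 1) x)"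
    by (simp add: mult_ac)
  ultimately show "stiffness \<Omega> \<Gamma>2 A g N \<phi> $$ (k, l) = stiffness \<Omega> \<Gamma>2 A g N \<phi> $$ (l, k)"
    using kl by (simp add: stiffness_def)
qed

text \<open>A combination with zero energy has zero gradient, so it is constant on the connected
  domain; the constant is its value somewhere on the Dirichlet part, which has positive
  measure.\<close>

lemma stiffness_pos_def:
  assumes A: "diffusion_tensor \<Omega> A" and g: "Linf (restrict_space surface \<Gamma>2) g"
    and g_nonneg: "\<And>x. x \<in> \<Gamma>2 \<Longrightarrow> 0 \<le> g x"
    and indep: "\<forall>c :: nat \<Rightarrow> real. (\<forall>x\<in>\<Omega>. (\<Sum>k=1..N. c k * \<phi> k x) = 0) \<longrightarrow> (\<forall>k\<in>{1..N}. c k = 0)"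
    and dirichlet: "emeasure surface \<Gamma>1 > 0"
  shows "pos_def_mat N (stiffness \<Omega> \<Gamma>2 A g N \<phi>)"
  unfolding pos_def_mat_def
proof (intro allI impI, rule ccontr)
  fix c :: "nat \<Rightarrow> real"
  assume c: "\<exists>i<N. c i \<noteq> 0" and "\<not> 0 < mat_form N (stiffness \<Omega> \<Gamma>2 A g N \<phi>) c c"
  let ?f = "\<lambda>x. (A x *v grad_comb c x) \<bullet> grad_comb c x"
  have f_nonneg: "0 \<le> ?f x" if "x \<in> \<Omega>" for x
    by (rule diffusion_tensor_symmetric_positive(3)[OF A that])
  have "0 \<le> (LINT x|lebesgue_on \<Omega>. ?f x)"
    by (rule integral_nonneg_AE) (use f_nonneg in \<open>auto intro: AE_I2\<close>)
  moreover have "0 \<le> (LINT x|restrict_space surface \<Gamma>2. g x * (comb c x)\<^sup>2)"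
    using g_nonneg by (intro integral_nonneg_AE AE_I2) (auto simp: space_restrict_space)
  ultimately have "(LINT x|lebesgue_on \<Omega>. ?f x) = 0"
    using stiffness_form(1)[OF A g, of c] \<open>\<not> 0 < _\<close> by linarith
  then have "AE x in lebesgue_on \<Omega>. ?f x = 0"
    using f_nonneg by (subst (asm) integral_nonneg_eq_0_iff_AE[OF stiffness_form(2)[OF A g]]) (auto intro: AE_I2)
  then have "AE x in lebesgue_on \<Omega>. grad_comb c x = 0"
    using AE_space
  proof eventually_elim
    case (elim x)
    then have "x \<in> \<Omega>" by simp
    then show ?case using diffusion_tensor_symmetric_positive(2)[OF A, of x "grad_comb c x"] elim by fastforce
  qed
  then have "comb c constant_on \<Omega>"
    by (rule weak_gradient_0_imp_constant[OF H1_gradient_comb _ dom(1,3,2)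
          continuous_on_subset[OF continuous_on_comb closure_subset]])
  then obtain \<kappa> where \<kappa>: "\<And>x. x \<in> \<Omega> \<Longrightarrow> comb c x = \<kappa>" by (auto simp: constant_on_def)
  have \<kappa>': "comb c x = \<kappa>" if "x \<in> closure \<Omega>" for x
    by (rule continuous_constant_on_closure[OF continuous_on_comb \<kappa> that])
  have "AE x in restrict_space surface \<Gamma>1. \<forall>k\<in>{..<N}. \<phi> (k + 1) x = 0"
    by (rule AE_finite_allI[OF finite_lessThan], rule basis_function(3)) simp
  then have "AE x in surface. x \<in> \<Gamma>1 \<longrightarrow> (\<forall>k<N. \<phi> (k + 1) x = 0)"
    using meas(1) by (subst (asm) AE_restrict_space_iff) auto
  then have ae: "AE x in surface. x \<in> \<Gamma>1 \<longrightarrow> comb c x = 0"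
    by (rule eventually_mono) (auto simp: comb_def)
  have "\<exists>x\<in>\<Gamma>1. comb c x = 0"
  proof (rule ccontr)
    assume "\<not> (\<exists>x\<in>\<Gamma>1. comb c x = 0)"
    then have "AE x in surface. x \<notin> \<Gamma>1" by (intro eventually_mono[OF ae]) blast
    then have "\<Gamma>1 \<in> null_sets surface" using meas(1) AE_iff_null_sets by blast
    then show False using dirichlet by auto
  qed
  then have "\<kappa> = 0" using \<kappa>' \<Gamma>_subset(1) by auto
  have "\<forall>x\<in>\<Omega>. (\<Sum>k=1..N. c (k - 1) * \<phi> k x) = 0"
  proof
    fix x assume "x \<in> \<Omega>"
    then have "comb c x = 0" using \<kappa> \<open>\<kappa> = 0\<close> by simp
    then show "(\<Sum>k=1..N. c (k - 1) * \<phi> k x) = 0"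
      by (simp add: comb_def sum.atLeast1_atMost_eq)
  qed
  from spec[OF indep, of "\<lambda>k. c (k - 1)", THEN mp, OF this]
  have c0: "c (k - 1) = 0" if "k \<in> {1..N}" for k using that by blast
  obtain i where "i < N" "c i \<noteq> 0" using c by blast
  then show False using c0[of "Suc i"] by simp
qed

text \<open>Some union of closed elements covers the support of \<open>v\<close> without covering \<open>E j\<close>. It consists of other
  elements, whose closures do not meet the open set \<open>E j\<close>.\<close>

lemma vanishes_off_patch:
  assumes "j \<in> {1..Ne}" "\<not> E j \<subseteq> patch \<Omega> Ne E v" "x \<in> E j"
  shows "v x = 0"
proof (rule ccontr)
  assume "v x \<noteq> 0"
  obtain y J where y: "y \<in> E j" and J: "J \<subseteq> {1..Ne}" "closure {x\<in>\<Omega>. v x \<noteq> 0} \<subseteq> (\<Union>i\<in>J. closure (E i))"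
    and "y \<notin> (\<Union>i\<in>J. closure (E i))"
    using assms(2) unfolding patch_def by blast
  then have "j \<notin> J" using closure_subset by blast
  have "x \<in> closure {x\<in>\<Omega>. v x \<noteq> 0}"
    using element(2)[OF assms(1)] assms(3) \<open>v x \<noteq> 0\<close> closure_subset[of "{x\<in>\<Omega>. v x \<noteq> 0}"] by auto
  then obtain i where i: "i \<in> J" "x \<in> closure (E i)" using J(2) by blast
  then have "E j \<inter> E i = {}"
    using element_disjoint[of j i] assms(1) J(1) \<open>j \<notin> J\<close> by blast
  then have "E j \<inter> closure (E i) = {}"
    using open_Int_closure_eq_empty[OF element(1)[OF assms(1)]] by blast
  then show False using i(2) assms(3) by blast
qed

text \<open>The closed elements cover \<open>\<Omega>\<close>, and their frontiers are null sets.\<close>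

lemma AE_in_some_element: "AE x in lebesgue. x \<in> \<Omega> \<longrightarrow> (\<exists>j\<in>{1..Ne}. x \<in> E j)"
proof -
  have "AE x in lebesgue. x \<notin> frontier (E j)" if "j \<in> {1..Ne}" for j
    using negligible_polyhedral_frontier[OF element(3)[OF that]]
    by (simp add: negligible_iff_null_sets AE_not_in)
  then have "AE x in lebesgue. \<forall>j\<in>{1..Ne}. x \<notin> frontier (E j)"
    by (rule AE_finite_allI[OF finite_atLeastAtMost])
  then show ?thesis
  proof (rule eventually_mono, intro impI)
    fix x assume x: "\<forall>j\<in>{1..Ne}. x \<notin> frontier (E j)" "x \<in> \<Omega>"
    then have "x \<in> (\<Union>j\<in>{1..Ne}. closure (E j))"
      using closure_eq_elements closure_subset by blast
    then obtain j where j: "j \<in> {1..Ne}" "x \<in> closure (E j)" by blast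
    then have "x \<in> E j" using x(1) element(1)[OF j(1)] by (auto simp: frontier_def interior_open)
    then show "\<exists>j\<in>{1..Ne}. x \<in> E j" using j(1) by blast
  qed
qed

text \<open>A point of \<open>\<Gamma>2\<close> lies on a face of some element. The exceptional points are those on faces that meet
  the boundary of \<open>\<Omega>\<close> in a null set, and those of \<open>\<Gamma>2\<close> on faces that belong to \<open>\<Gamma>1\<close>. All of them form a null
  set.\<close>

lemma AE_in_robin_face:
  "AE x in surface. x \<in> \<Gamma>2 \<longrightarrow> (\<exists>j\<in>{1..Ne}. x \<in> closure (E j) \<and> (\<exists>f\<in>F j. face_in f \<Gamma>2))"
proof -
  have "AE x in surface. \<forall>f\<in>F j.
      (f \<inter> frontier \<Omega> \<in> null_sets surface \<longrightarrow> x \<notin> f \<inter> frontier \<Omega>) \<and> (face_in f \<Gamma>1 \<longrightarrow> x \<notin> f - \<Gamma>1)"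
    if j: "j \<in> {1..Ne}" for j
  proof (rule AE_finite_allI)
    show "finite (F j)" using element(3)[OF j] by (simp add: face_decomposition_def)
    fix f
    have "AE x in surface. f \<inter> frontier \<Omega> \<in> null_sets surface \<longrightarrow> x \<notin> f \<inter> frontier \<Omega>"
      using AE_not_in[of "f \<inter> frontier \<Omega>" surface] by (cases "f \<inter> frontier \<Omega> \<in> null_sets surface") auto
    moreover have "AE x in surface. face_in f \<Gamma>1 \<longrightarrow> x \<notin> f - \<Gamma>1"
      using AE_not_in[of "f - \<Gamma>1" surface] by (cases "face_in f \<Gamma>1") (auto simp: face_in_def)
    ultimately show "AE x in surface.
      (f \<inter> frontier \<Omega> \<in> null_sets surface \<longrightarrow> x \<notin> f \<inter> frontier \<Omega>) \<and> (face_in f \<Gamma>1 \<longrightarrow> x \<notin> f - \<Gamma>1)"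
      by (rule AE_conjI)
  qed
  then have "AE x in surface. \<forall>j\<in>{1..Ne}. \<forall>f\<in>F j.
      (f \<inter> frontier \<Omega> \<in> null_sets surface \<longrightarrow> x \<notin> f \<inter> frontier \<Omega>) \<and> (face_in f \<Gamma>1 \<longrightarrow> x \<notin> f - \<Gamma>1)"
    by (rule AE_finite_allI[OF finite_atLeastAtMost])
  then show ?thesis
  proof (rule eventually_mono, intro impI)
    fix x
    assume ae: "\<forall>j\<in>{1..Ne}. \<forall>f\<in>F j.
      (f \<inter> frontier \<Omega> \<in> null_sets surface \<longrightarrow> x \<notin> f \<inter> frontier \<Omega>) \<and> (face_in f \<Gamma>1 \<longrightarrow> x \<notin> f - \<Gamma>1)"
      and x: "x \<in> \<Gamma>2"
    have fr: "x \<in> frontier \<Omega>" "x \<notin> \<Gamma>1" "x \<in> closure \<Omega>" using x split \<Gamma>_subset by auto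
    then have "x \<notin> \<Omega>" using dom(1) by (auto simp: frontier_def interior_open)
    obtain j where j: "j \<in> {1..Ne}" "x \<in> closure (E j)"
      using fr(3) closure_eq_elements by blast
    have "x \<in> frontier (E j)"
      using j \<open>x \<notin> \<Omega>\<close> element(1,2)[OF j(1)] by (auto simp: frontier_def interior_open)
    then obtain f where f: "f \<in> F j" "x \<in> f"
      using element(3)[OF j(1)] by (auto simp: face_decomposition_def)
    have "f \<inter> frontier \<Omega> \<notin> null_sets surface" using ae j(1) f fr(1) by blast
    then have "f \<subseteq> frontier \<Omega>" by (rule face_on_boundary[OF j(1) f(1)])
    then have "face_in f \<Gamma>1 \<or> face_in f \<Gamma>2" using faces j(1) f(1) by blast
    moreover have "\<not> face_in f \<Gamma>1" using ae j(1) f fr(2) by blast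
    ultimately show "\<exists>j\<in>{1..Ne}. x \<in> closure (E j) \<and> (\<exists>f\<in>F j. face_in f \<Gamma>2)"
      using j f(1) by blast
  qed
qed

text \<open>Off the patches of the \<open>\<phi> (k + 1)\<close>, \<open>k \<in> S\<close>, a combination of these functions vanishes together with
  its gradient, so the integrands are compared on patch elements. By continuity, every element
  whose closure contains a boundary point \<open>x\<close> with \<open>\<phi> (k + 1) x \<noteq> 0\<close> belongs to the patch of
  \<open>\<phi> (k + 1)\<close>, in particular one with a Robin face through \<open>x\<close>.\<close>

lemma stiffness_comparison:
  assumes A: "diffusion_tensor \<Omega> A" "diffusion_tensor \<Omega> B"
    and g: "Linf (restrict_space surface \<Gamma>2) g" "Linf (restrict_space surface \<Gamma>2) h"
    and c: "\<And>k. k < N \<Longrightarrow> k \<notin> S \<Longrightarrow> c k = 0" and S: "S \<subseteq> {..<N}"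
    and vol: "\<And>j k. j \<in> {1..Ne} \<Longrightarrow> k \<in> S \<Longrightarrow> E j \<subseteq> patch \<Omega> Ne E (\<phi> (k + 1)) \<Longrightarrow>
        AE x in lebesgue_on (E j). \<forall>w. 0 \<le> \<sigma> * ((A x *v w) \<bullet> w - \<mu> * ((B x *v w) \<bullet> w))"
    and bd: "\<And>j k. j \<in> {1..Ne} \<Longrightarrow> k \<in> S \<Longrightarrow> E j \<subseteq> patch \<Omega> Ne E (\<phi> (k + 1)) \<Longrightarrow>
        \<exists>f\<in>F j. face_in f \<Gamma>2 \<Longrightarrow>
        AE x in surface. x \<in> \<Gamma>2 \<inter> closure (E j) \<longrightarrow> 0 \<le> \<sigma> * (g x - \<mu> * h x)"
  shows "0 \<le> \<sigma> * (mat_form N (stiffness \<Omega> \<Gamma>2 A g N \<phi>) c c - \<mu> * mat_form N (stiffness \<Omega> \<Gamma>2 B h N \<phi>) c c)"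
proof -
  let ?M = "restrict_space surface \<Gamma>2"
  define a where "a x = \<sigma> * ((A x *v grad_comb c x) \<bullet> grad_comb c x - \<mu> * ((B x *v grad_comb c x) \<bullet> grad_comb c x))" for x
  define b where "b x = \<sigma> * (g x * (comb c x)\<^sup>2 - \<mu> * (h x * (comb c x)\<^sup>2))" for x
  note FA = stiffness_form[OF A(1) g(1), of c] and FB = stiffness_form[OF A(2) g(2), of c]
  have "AE x in lebesgue. x \<in> E j \<longrightarrow> 0 \<le> a x" if j: "j \<in> {1..Ne}" for j
  proof (cases "\<exists>k\<in>S. E j \<subseteq> patch \<Omega> Ne E (\<phi> (k + 1))")
    case True
    then have "AE x in lebesgue_on (E j). \<forall>w. 0 \<le> \<sigma> * ((A x *v w) \<bullet> w - \<mu> * ((B x *v w) \<bullet> w))"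
      using vol[OF j] by blast
    then have "AE x in lebesgue. x \<in> E j \<longrightarrow> (\<forall>w. 0 \<le> \<sigma> * ((A x *v w) \<bullet> w - \<mu> * ((B x *v w) \<bullet> w)))"
      using element(1)[OF j] by (subst (asm) AE_restrict_space_iff) auto
    then show ?thesis by (rule eventually_mono) (simp add: a_def)
  next
    case False
    have "AE x in lebesgue. x \<in> E j \<longrightarrow> grad \<Omega> (\<phi> (k + 1)) x = 0" if "k \<in> S" for k
      using that False S vanishes_off_patch[OF j] element[OF j] dom
      by (intro H1_gradient_eq_0_where_function_0[OF basis_function(1)]) auto
    then have "AE x in lebesgue. \<forall>k\<in>S. x \<in> E j \<longrightarrow> grad \<Omega> (\<phi> (k + 1)) x = 0"
      by (rule AE_finite_allI[OF finite_subset[OF S finite_lessThan]])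
    then show ?thesis
    proof (rule eventually_mono, intro impI)
      fix x assume "\<forall>k\<in>S. x \<in> E j \<longrightarrow> grad \<Omega> (\<phi> (k + 1)) x = 0" "x \<in> E j"
      then have "grad_comb c x = 0"
        unfolding grad_comb_def using c by (intro sum.neutral) auto
      then show "0 \<le> a x" by (simp add: a_def)
    qed
  qed
  then have "AE x in lebesgue. \<forall>j\<in>{1..Ne}. x \<in> E j \<longrightarrow> 0 \<le> a x"
    by (rule AE_finite_allI[OF finite_atLeastAtMost])
  then have "AE x in lebesgue. x \<in> \<Omega> \<longrightarrow> 0 \<le> a x"
    by (rule eventually_mono[OF AE_conjI[OF AE_in_some_element]]) blast
  then have a: "0 \<le> integral\<^sup>L (lebesgue_on \<Omega>) a"
    using dom(5) by (intro integral_nonneg_AE) (subst AE_restrict_space_iff, auto)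

  have "AE x in surface. j \<in> {1..Ne} \<and> k \<in> S \<and> E j \<subseteq> patch \<Omega> Ne E (\<phi> (k + 1)) \<and> (\<exists>f\<in>F j. face_in f \<Gamma>2)
      \<longrightarrow> x \<in> \<Gamma>2 \<inter> closure (E j) \<longrightarrow> 0 \<le> \<sigma> * (g x - \<mu> * h x)" for j k
    using bd[of j k] by (cases "j \<in> {1..Ne} \<and> k \<in> S \<and> E j \<subseteq> patch \<Omega> Ne E (\<phi> (k + 1)) \<and> (\<exists>f\<in>F j. face_in f \<Gamma>2)") auto
  then have "AE x in surface. \<forall>j\<in>{1..Ne}. \<forall>k\<in>S. j \<in> {1..Ne} \<and> k \<in> S \<and> E j \<subseteq> patch \<Omega> Ne E (\<phi> (k + 1)) \<and> (\<exists>f\<in>F j. face_in f \<Gamma>2)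
      \<longrightarrow> x \<in> \<Gamma>2 \<inter> closure (E j) \<longrightarrow> 0 \<le> \<sigma> * (g x - \<mu> * h x)"
    by (intro AE_finite_allI[OF finite_atLeastAtMost] AE_finite_allI[OF finite_subset[OF S finite_lessThan]])
  with AE_in_robin_face have "AE x in surface. x \<in> \<Gamma>2 \<longrightarrow> 0 \<le> b x"
  proof eventually_elim
    case (elim x)
    show ?case
    proof
      assume x: "x \<in> \<Gamma>2"
      show "0 \<le> b x"
      proof (cases "comb c x = 0")
        case True
        then show ?thesis by (simp add: b_def)
      next
        case False
        then obtain k where k: "k < N" "c k * \<phi> (k + 1) x \<noteq> 0"
          unfolding comb_def by (meson lessThan_iff sum.neutral)
        then have kS: "k \<in> S" using c by fastforce
        obtain j where j: "j \<in> {1..Ne}" "x \<in> closure (E j)" "\<exists>f\<in>F j. face_in f \<Gamma>2"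
          using elim(1) x by blast
        have "E j \<subseteq> patch \<Omega> Ne E (\<phi> (k + 1))"
        proof (rule ccontr)
          assume "\<not> E j \<subseteq> patch \<Omega> Ne E (\<phi> (k + 1))"
          then have "\<phi> (k + 1) y = 0" if "y \<in> E j" for y
            using vanishes_off_patch[OF j(1)] that by blast
          moreover have "continuous_on (closure (E j)) (\<phi> (k + 1))"
            by (rule continuous_on_subset[OF basis_function(2)[OF k(1)] closure_mono[OF element(2)[OF j(1)]]])
          ultimately have "\<phi> (k + 1) x = 0"
            using continuous_constant_on_closure[of "E j" "\<phi> (k + 1)" 0 x] j(2) by simp
          then show False using k(2) by simp
        qed
        then have "0 \<le> \<sigma> * (g x - \<mu> * h x)" using elim(2) j kS x by blast
        then have "0 \<le> \<sigma> * (g x - \<mu> * h x) * (comb c x)\<^sup>2" by simp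
        then show ?thesis by (simp add: b_def algebra_simps)
      qed
    qed
  qed
  then have b: "0 \<le> integral\<^sup>L ?M b"
    using meas(2) by (intro integral_nonneg_AE) (subst AE_restrict_space_iff, auto)
  have "\<sigma> * (mat_form N (stiffness \<Omega> \<Gamma>2 A g N \<phi>) c c - \<mu> * mat_form N (stiffness \<Omega> \<Gamma>2 B h N \<phi>) c c)
      = integral\<^sup>L (lebesgue_on \<Omega>) a + integral\<^sup>L ?M b"
    unfolding FA(1) FB(1) a_def b_def using FA(2,3) FB(2,3) by (simp add: algebra_simps)
  then show ?thesis using a b by simp
qed

end

section \<open>Eigenvalue bounds by patches\<close>

theorem theorem4p2:
  fixes \<Omega> \<Gamma>1 \<Gamma>2 :: "(real^'d) set"
    and A At :: "real^'d \<Rightarrow> real^'d^'d"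
    and g3 gt3 :: "real^'d \<Rightarrow> real"
    and cg Cg :: real
    and Ne N :: nat
    and E :: "nat \<Rightarrow> (real^'d) set"
    and F :: "nat \<Rightarrow> (real^'d) set set"
    and \<phi> :: "nat \<Rightarrow> real^'d \<Rightarrow> real"
    and r s :: "nat \<Rightarrow> nat"
    and lam :: "nat \<Rightarrow> real"
  defines "K \<equiv> stiffness \<Omega> \<Gamma>2 A g3 N \<phi>"
    and "Kt \<equiv> stiffness \<Omega> \<Gamma>2 At gt3 N \<phi>"
    and "lamL \<equiv> \<lambda>k. lambda_L \<Omega> \<Gamma>2 A At g3 gt3 Ne E F (\<phi> k)"
    and "lamU \<equiv> \<lambda>k. lambda_U \<Omega> \<Gamma>2 A At g3 gt3 Ne E F (\<phi> k)"
  assumes dim: "CARD('d) = 2 \<or> CARD('d) = 3"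
    and domain: "polyhedral_domain \<Omega>"
    and split: "frontier \<Omega> = \<Gamma>1 \<union> \<Gamma>2" "\<Gamma>1 \<inter> \<Gamma>2 = {}"
    and meas: "\<Gamma>1 \<in> sets surface" "\<Gamma>2 \<in> sets surface"
    and tensors: "diffusion_tensor \<Omega> A" "diffusion_tensor \<Omega> At"
    and g_Linf: "Linf (restrict_space surface \<Gamma>2) g3" "Linf (restrict_space surface \<Gamma>2) gt3"
    and g_nonneg: "\<forall>x\<in>\<Gamma>2. 0 \<le> g3 x \<and> 0 \<le> gt3 x"
    and cg: "0 < cg" "cg \<le> Cg"
    and g_equiv: "\<forall>x\<in>\<Gamma>2. 0 \<le> cg * gt3 x \<and> cg * gt3 x \<le> g3 x \<and> g3 x \<le> Cg * gt3 x"
    and mesh: "mesh \<Omega> Ne E F"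
    and faces: "\<forall>j\<in>{1..Ne}. \<forall>f\<in>F j. f \<subseteq> frontier \<Omega> \<longrightarrow> face_in f \<Gamma>1 \<or> face_in f \<Gamma>2"
    and basis: "\<forall>k\<in>{1..N}. \<phi> k \<in> V_cont \<Omega> \<Gamma>1"
    and indep: "\<forall>c :: nat \<Rightarrow> real. (\<forall>x\<in>\<Omega>. (\<Sum>k=1..N. c k * \<phi> k x) = 0) \<longrightarrow> (\<forall>k\<in>{1..N}. c k = 0)"
    and dirichlet: "emeasure surface \<Gamma>1 > 0"
    and lam_sorted: "mono_on {1..N} lam"
    and lam_eigenvalues: "char_poly (the (mat_inverse Kt) * K) = (\<Prod>k=1..N. [:- lam k, 1:])"
    and r: "bij_betw r {1..N} {1..N}" "mono_on {1..N} (\<lambda>k. lamL (r k))"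
    and s: "bij_betw s {1..N} {1..N}" "mono_on {1..N} (\<lambda>k. lamU (s k))"
  shows "\<forall>k\<in>{1..N}. 0 < lam k \<and> lamL (r k) \<le> ereal (lam k) \<and> ereal (lam k) \<le> lamU (s k)"
proof -
  have ge2: "CARD('d) \<ge> 2" using dim by auto
  interpret finite_element_space \<Omega> \<Gamma>1 \<Gamma>2 Ne N E F \<phi>
    by unfold_locales (fact ge2 domain split meas mesh faces basis)+
  have zero_iff: "g3 x = 0 \<longleftrightarrow> gt3 x = 0" if "x \<in> \<Gamma>2" for x
  proof
    have x: "cg * gt3 x \<le> g3 x" "g3 x \<le> Cg * gt3 x" "0 \<le> gt3 x" "0 \<le> g3 x"
      using g_equiv g_nonneg that by auto
    show "gt3 x = 0" if "g3 x = 0" using x that cg(1) by (simp add: mult_le_0_iff)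
    show "g3 x = 0" if "gt3 x = 0" using x that by simp
  qed
  have gt3_nonneg: "0 \<le> gt3 x" and g3_nonneg: "0 \<le> g3 x" if "x \<in> \<Gamma>2" for x
    using g_nonneg that by auto
  have pos: "pos_def_mat N K" "pos_def_mat N Kt"
    unfolding K_def Kt_def
    using stiffness_pos_def[OF tensors(1) g_Linf(1) g3_nonneg indep dirichlet]
      stiffness_pos_def[OF tensors(2) g_Linf(2) gt3_nonneg indep dirichlet] by blast+
  have mats: "K \<in> carrier_mat N N" "sym_mat N K" "Kt \<in> carrier_mat N N" "sym_mat N Kt"
    unfolding K_def Kt_def using stiffness_carrier stiffness_sym tensors by blast+
  have char: "char_poly (the (mat_inverse Kt) * K) = (\<Prod>k<N. [:- lam (k + 1), 1:])"
    using lam_eigenvalues by (simp add: prod.atLeast1_atMost_eq)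
  have pred_card: "card ((\<lambda>l. l - 1) ` t ` I) = card I" "(\<lambda>l. l - 1) ` t ` I \<subseteq> {..<N}"
    if "bij_betw t {1..N} {1..N}" "I \<subseteq> {1..N}" for t :: "nat \<Rightarrow> nat" and I
  proof -
    have sub: "t ` I \<subseteq> {1..N}" using that by (auto simp: bij_betw_def)
    have "inj_on t I" using that by (auto simp: bij_betw_def intro: inj_on_subset)
    moreover have "inj_on (\<lambda>l. l - 1 :: nat) (t ` I)"
    proof (rule inj_onI)
      fix a b assume "a \<in> t ` I" "b \<in> t ` I" "a - 1 = b - 1"
      moreover from this(1,2) have "a \<ge> 1" "b \<ge> 1" using sub by fastforce+
      ultimately show "a = b" by linarith
    qed
    ultimately show "card ((\<lambda>l. l - 1) ` t ` I) = card I" by (simp add: card_image)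
    show "(\<lambda>l. l - 1) ` t ` I \<subseteq> {..<N}" using sub by fastforce
  qed
  show ?thesis
  proof (intro ballI conjI)
    fix k assume k: "k \<in> {1..N}"
    show "0 < lam k"
    proof -
      \<comment> \<open>With \<open>S\<close> everything and \<open>J\<close> a singleton, the common vector is an eigenvector for \<open>lam k\<close>.\<close>
      obtain x w where x: "\<exists>i<N. x i \<noteq> 0"
        and w: "\<And>j. 0 \<le> w j" "mat_form N K x x = (\<Sum>j\<in>{k - 1}. w j * lam (j + 1))"
      proof (rule pencil_eigenvalues_coordinate_subspace[OF mats pos(2) char, of "{..<N}" "{k - 1}"])
        show "{k - 1} \<subseteq> {..<N}" using k by auto
      qed (use that in auto)
      have "0 < mat_form N K x x" using pos(1) x unfolding pos_def_mat_def by blast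
      then have "0 < w (k - 1) * lam k" using w(2) k by simp
      then show ?thesis using w(1)[of "k - 1"] by (simp add: zero_less_mult_iff)
    qed
    show "lamL (r k) \<le> ereal (lam k)"
    proof (rule ccontr)
      assume "\<not> lamL (r k) \<le> ereal (lam k)"
      then obtain \<mu> where \<mu>: "ereal (lam k) < ereal \<mu>" "ereal \<mu> < lamL (r k)"
        using ereal_dense2[of "ereal (lam k)" "lamL (r k)"] by (auto simp: not_le)
      \<comment> \<open>The \<open>N - k + 1\<close> largest lower bounds, shifted to indices from \<open>0\<close>, against the \<open>k\<close> smallest
        eigenvalues.\<close>
      define S where "S = (\<lambda>l. l - 1) ` r ` {k..N}"
      have S: "card S = N + 1 - k" "S \<subseteq> {..<N}"
        using pred_card[OF r(1), of "{k..N}"] k by (auto simp: S_def)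
      have S_bound: "ereal \<mu> \<le> lamL (l + 1)" if lS: "l \<in> S" for l
      proof -
        obtain i where i: "i \<in> {k..N}" "l = r i - 1" using lS unfolding S_def by blast
        then have "r i \<in> {1..N}" using r(1) k by (auto simp: bij_betw_def)
        then have "l + 1 = r i" using i(2) by simp
        moreover have "lamL (r k) \<le> lamL (r i)"
          using mono_onD[OF r(2), of k i] i k by auto
        ultimately show ?thesis using \<mu>(2) by (auto intro: less_imp_le order_trans)
      qed
      have alpha: "ereal \<mu> \<le> alpha_min \<Gamma>2 A At g3 gt3 (E j) (F j)"
        if "j \<in> {1..Ne}" "l \<in> S" "E j \<subseteq> patch \<Omega> Ne E (\<phi> (l + 1))" for j l
        using S_bound[OF that(2)] lambda_L_le_alpha_min[OF that(1,3)]
        unfolding lamL_def by (rule order_trans)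
      have "\<exists>j\<in>{..<k}. 0 \<le> 1 * (lam (j + 1) - \<mu>)"
      proof (rule pencil_eigenvalue_bound[OF mats pos(2) char S(2)])
        show "{..<k} \<subseteq> {..<N}" "N < card S + card {..<k}" using k S(1) by auto
        show "0 \<le> 1 * (mat_form N K c c - \<mu> * mat_form N Kt c c)"
          if "\<And>i. i < N \<Longrightarrow> i \<notin> S \<Longrightarrow> c i = 0" for c
          unfolding K_def Kt_def
        proof (rule stiffness_comparison[OF tensors g_Linf that S(2)])
          fix j l assume jl: "j \<in> {1..Ne}" "l \<in> S" "E j \<subseteq> patch \<Omega> Ne E (\<phi> (l + 1))"
          show "AE x in lebesgue_on (E j). \<forall>w. 0 \<le> 1 * ((A x *v w) \<bullet> w - \<mu> * ((At x *v w) \<bullet> w))"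
            by (rule alpha_min_volume[OF tensors element(2)[OF jl(1)] alpha[OF jl]])
          assume face: "\<exists>f\<in>F j. face_in f \<Gamma>2"
          show "AE x in surface. x \<in> \<Gamma>2 \<inter> closure (E j) \<longrightarrow> 0 \<le> 1 * (g3 x - \<mu> * gt3 x)"
            by (rule alpha_min_robin[OF g_Linf(1) meas(2) _ _ alpha[OF jl] face]) (use gt3_nonneg zero_iff in auto)
        qed
      qed
      then obtain j where "j < k" "\<mu> \<le> lam (j + 1)" by auto
      moreover have "lam (j + 1) \<le> lam k" using mono_onD[OF lam_sorted, of "j + 1" k] \<open>j < k\<close> k by auto
      ultimately show False using \<mu>(1) by simp
    qed
    show "ereal (lam k) \<le> lamU (s k)"
    proof (rule ccontr)
      assume "\<not> ereal (lam k) \<le> lamU (s k)"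
      then obtain \<mu> where \<mu>: "lamU (s k) < ereal \<mu>" "ereal \<mu> < ereal (lam k)"
        using ereal_dense2[of "lamU (s k)" "ereal (lam k)"] by (auto simp: not_le)
      \<comment> \<open>The \<open>k\<close> smallest upper bounds against the \<open>N - k + 1\<close> largest eigenvalues.\<close>
      define S where "S = (\<lambda>l. l - 1) ` s ` {1..k}"
      have S: "card S = k" "S \<subseteq> {..<N}"
        using pred_card[OF s(1), of "{1..k}"] k by (auto simp: S_def)
      have S_bound: "lamU (l + 1) \<le> ereal \<mu>" if lS: "l \<in> S" for l
      proof -
        obtain i where i: "i \<in> {1..k}" "l = s i - 1" using lS unfolding S_def by blast
        then have "s i \<in> {1..N}" using s(1) k by (auto simp: bij_betw_def)
        then have "l + 1 = s i" using i(2) by simp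
        moreover have "lamU (s i) \<le> lamU (s k)"
          using mono_onD[OF s(2), of i k] i k by auto
        ultimately show ?thesis using \<mu>(1) by (auto intro: less_imp_le order_trans)
      qed
      have alpha: "alpha_max \<Gamma>2 A At g3 gt3 (E j) (F j) \<le> ereal \<mu>"
        if "j \<in> {1..Ne}" "l \<in> S" "E j \<subseteq> patch \<Omega> Ne E (\<phi> (l + 1))" for j l
        using alpha_max_le_lambda_U[OF that(1,3)] S_bound[OF that(2)]
        unfolding lamU_def by (rule order_trans)
      have "\<exists>j\<in>{k - 1..<N}. 0 \<le> - 1 * (lam (j + 1) - \<mu>)"
      proof (rule pencil_eigenvalue_bound[OF mats pos(2) char S(2)])
        show "{k - 1..<N} \<subseteq> {..<N}" "N < card S + card {k - 1..<N}" using k S(1) by auto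
        show "0 \<le> - 1 * (mat_form N K c c - \<mu> * mat_form N Kt c c)"
          if "\<And>i. i < N \<Longrightarrow> i \<notin> S \<Longrightarrow> c i = 0" for c
          unfolding K_def Kt_def
        proof (rule stiffness_comparison[OF tensors g_Linf that S(2)])
          fix j l assume jl: "j \<in> {1..Ne}" "l \<in> S" "E j \<subseteq> patch \<Omega> Ne E (\<phi> (l + 1))"
          show "AE x in lebesgue_on (E j). \<forall>w. 0 \<le> - 1 * ((A x *v w) \<bullet> w - \<mu> * ((At x *v w) \<bullet> w))"
            by (rule alpha_max_volume[OF tensors element(2)[OF jl(1)] alpha[OF jl]])
          assume face: "\<exists>f\<in>F j. face_in f \<Gamma>2"
          show "AE x in surface. x \<in> \<Gamma>2 \<inter> closure (E j) \<longrightarrow> 0 \<le> - 1 * (g3 x - \<mu> * gt3 x)"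
            by (rule alpha_max_robin[OF g_Linf(1) meas(2) _ _ alpha[OF jl] face]) (use gt3_nonneg zero_iff in auto)
        qed
      qed
      then obtain j where "k - 1 \<le> j" "j < N" "lam (j + 1) \<le> \<mu>" by auto
      moreover have "lam k \<le> lam (j + 1)"
        using mono_onD[OF lam_sorted, of k "j + 1"] \<open>k - 1 \<le> j\<close> \<open>j < N\<close> k by auto
      ultimately show False using \<mu>(2) by simp
    qed
  qed
qed

end
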